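(* If two shares $I_1,I_2$ have isomorphic (colour-preserving) two-coloured intersection graphs, then $I_1$ and $I_2$ are equal as elements of $\mathcal S$; equivalently, $w_{\mathfrak{sl}_2}((I_1,H))=w_{\mathfrak{sl}_2}((I_2,H))$ for every share $H$.
   Context: A chord diagram is an oriented circle with $2n$ distinct points partitioned into $n$ pairs (chords), up to orientation-preserving diffeomorphism; $w_{\mathfrak{sl}_2}(D)=\sum_\varphi x_{\varphi(p_1)}\cdots x_{\varphi(p_{2n})}\in\mathbb C[c]$ where $p_i$ are endpoints in order from a cut point, $\varphi$ runs over maps chords$\to\{1,2,3\}$, $x_1=\tfrac12\begin{pmatrix}0&1\\1&0\end{pmatrix}$, $x_2=\tfrac12\begin{pmatrix}0&-i\\ i&0\end{pmatrix}$, $x_3=\tfrac12\begin{pmatrix}1&0\\0&-1\end{pmatrix}$, $c=x_1^2+x_2^2+x_3^2$. A share consists of two oriented intervals (strand 1, strand 2) and finitely many chords (disjoint pairs of distinct points of their union), up to orientation-preserving diffeomorphisms of each strand; a chord is an arch if both endpoints are on one strand, a bridge otherwise. $A_2$ is the $\mathbb C$-span of shares. The join $(I,H)$ of shares is the chord diagram whose circle reads strand 1 of $I$, strand 1 of $H$, strand 2 of $I$, strand 2 of $H$; $I,I'\in A_2$ are equivalent if $w_{\mathfrak{sl}_2}((I,H))=w_{\mathfrak{sl}_2}((I',H))$ for all shares $H$ (bilinear extension), and $\mathcal S=A_2/\!\sim$. The two-coloured intersection graph of a share has the chords as vertices, arches coloured white and bridges black; two arches are adjacent iff they lie on the same strand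 with alternating endpoints; an arch and a bridge are adjacent iff an endpoint of the bridge lies between the endpoints of the arch; two bridges are adjacent iff their endpoints occur in different relative orders on strand 1 and on strand 2. *)

theory Defs
  imports Complex_Main "HOL-Library.FuncSet"
begin

text \<open>A share is a pair of words (strand 1, strand 2) over chord labels; each chord
label occurring must occur exactly twice in total (its two endpoints). The word
records the endpoints in order along the oriented strand, which is exactly a share
up to orientation preserving diffeomorphisms of each strand.\<close>

type_synonym 'a share = "'a list \<times> 'a list"

definition share_wf :: "'a share \<Rightarrow> bool" where
  "share_wf I = (\<forall>c \<in> set (fst I @ snd I). count_list (fst I @ snd I) c = 2)"

definition chords :: "'a share \<Rightarrow> 'a set" where
  "chords I = set (fst I @ snd I)"

text \<open>A chord diagram is a word (the endpoints read from a cut point along the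
oriented circle) in which every letter occurs exactly twice.\<close>

definition join :: "'a share \<Rightarrow> 'b share \<Rightarrow> ('a + 'b) list" where
  "join I H = map Inl (fst I) @ map Inr (fst H) @ map Inl (snd I) @ map Inr (snd H)"

section \<open>The tensor algebra on x1,x2,x3 (letters 0,1,2) and U(sl2)\<close>

text \<open>Noncommutative polynomials: coefficient functions on words over letters 0,1,2.\<close>

type_synonym ncpoly = "nat list \<Rightarrow> complex"

definition mono :: "nat list \<Rightarrow> ncpoly" where
  "mono u = (\<lambda>v. if v = u then 1 else 0)"

definition tmul :: "ncpoly \<Rightarrow> ncpoly \<Rightarrow> ncpoly" where
  "tmul p q = (\<lambda>w. \<Sum>k\<le>length w. p (take k w) * q (drop k w))"

text \<open>Commutation relations of sl2 in the basis x1,x2,x3 given by the matrices: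
[x1,x2] = i x3, [x2,x3] = i x1, [x3,x1] = i x2.\<close>

definition sl2_rel :: "nat \<Rightarrow> nat \<Rightarrow> nat \<Rightarrow> ncpoly" where
  "sl2_rel a b c = (\<lambda>v. mono [a,b] v - mono [b,a] v - \<i> * mono [c] v)"

text \<open>The two-sided ideal generated by the relations; U(sl2) = T(sl2)/sl2_ideal.\<close>

inductive_set sl2_ideal :: "ncpoly set" where
  zero: "(\<lambda>_. 0) \<in> sl2_ideal"
| gen: "(a, b, c) \<in> {(0,1,2), (1,2,0), (2,0,1)} \<Longrightarrow> p \<in> sl2_ideal \<Longrightarrow>
        (\<lambda>v. p v + z * tmul (tmul (mono u) (sl2_rel a b c)) (mono w) v) \<in> sl2_ideal"

definition eq_U :: "ncpoly \<Rightarrow> ncpoly \<Rightarrow> bool" where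
  "eq_U p q = ((\<lambda>v. p v - q v) \<in> sl2_ideal)"

text \<open>The sl2 weight system (as an element of the tensor algebra, to be read in U(sl2)):
sum over all maps phi : chords \<rightarrow> {1,2,3} of x_phi(p1) ... x_phi(p2n).\<close>

definition w_sl2 :: "'c list \<Rightarrow> ncpoly" where
  "w_sl2 D = (\<lambda>v. of_nat (card {\<phi> \<in> set D \<rightarrow>\<^sub>E {0, 1, 2}. map \<phi> D = v}))"

definition arch_on :: "'a list \<Rightarrow> 'a \<Rightarrow> bool" where
  "arch_on w c = (count_list w c = 2)"

definition is_arch :: "'a share \<Rightarrow> 'a \<Rightarrow> bool" where
  "is_arch I c = (arch_on (fst I) c \<or> arch_on (snd I) c)"

definition is_bridge :: "'a share \<Rightarrow> 'a \<Rightarrow> bool" where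
  "is_bridge I c = (c \<in> chords I \<and> \<not> is_arch I c)"

definition pos :: "'a list \<Rightarrow> 'a \<Rightarrow> nat set" where
  "pos w c = {i. i < length w \<and> w ! i = c}"

definition nbetween :: "'a list \<Rightarrow> 'a \<Rightarrow> 'a \<Rightarrow> nat" where
  "nbetween w a b = card {j \<in> pos w b. \<exists>i\<in>pos w a. \<exists>k\<in>pos w a. i < j \<and> j < k}"

definition before :: "'a list \<Rightarrow> 'a \<Rightarrow> 'a \<Rightarrow> bool" where
  "before w a b = (\<exists>i j. i < j \<and> j < length w \<and> w ! i = a \<and> w ! j = b)"

definition adj :: "'a share \<Rightarrow> 'a \<Rightarrow> 'a \<Rightarrow> bool" where
  "adj I a b = (a \<in> chords I \<and> b \<in> chords I \<and> a \<noteq> b \<and>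
     ((arch_on (fst I) a \<and> nbetween (fst I) a b = 1) \<or>
      (arch_on (snd I) a \<and> nbetween (snd I) a b = 1) \<or>
      (arch_on (fst I) b \<and> nbetween (fst I) b a = 1) \<or>
      (arch_on (snd I) b \<and> nbetween (snd I) b a = 1) \<or>
      (is_bridge I a \<and> is_bridge I b \<and>
        before (fst I) a b \<noteq> before (snd I) a b)))"

definition coloured_graph_iso :: "'a share \<Rightarrow> 'a share \<Rightarrow> ('a \<Rightarrow> 'a) \<Rightarrow> bool" where
  "coloured_graph_iso I1 I2 f = (bij_betw f (chords I1) (chords I2) \<and>
     (\<forall>c \<in> chords I1. is_arch I2 (f c) = is_arch I1 c) \<and>
     (\<forall>a \<in> chords I1. \<forall>b \<in> chords I1. adj I2 (f a) (f b) = adj I1 a b))"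

end

theory Submission
  imports Defs "HOL-Library.Function_Algebras" "HOL-Library.Multiset"
begin

text \<open>
  The value \<open>w D\<close> is invariant under the mutation reversing both strands of a share inside the
  diagram: a linear functional on the tensor algebra that vanishes on the ideal turns the two
  strands into a function satisfying the \<open>sl2\<close> relations in each argument, and by induction on the
  number of endpoints reversal preserves sums over chords, while it negates sums over chords and
  one tripod (a vertex contracted with the structure tensor). Two diagrams with the same
  intersection graph are related by mutations: if the endpoints of some nontrivial set of chords fill
  at most two arcs of the circle, the diagram is reassembled from smaller ones; otherwise it is
  determined by its graph up to rotation and reflection. The latter is an enumeration for five
  chords; for more chords, the indecomposability passes to one of the smoothings at a suitable
  chord, and the diagram is recovered from it, if necessary after local complementation. Finally,
  closing a share by one additional chord joining the ends of its strands turns the coloured graph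
  into an ordinary intersection graph, in which the bridges are the neighbours of the new chord,
  and replacing the two ends of the new chord by the strands of \<open>H\<close> maps mutations to mutations.
\<close>

section \<open>Functionals on the tensor algebra\<close>

text \<open>Testing values with functionals that vanish on the ideal turns every algebraic step into
  an identity of finite sums of complex numbers. Reversal has to be treated for chords and tripods
  together: interchanging two endpoints costs a tripod, and pulling a leg of a tripod past an
  endpoint costs chords only, because for \<open>sl2\<close> two structure tensors contracted over
  one index are a combination of Kronecker deltas. On the combinatorial side the obstacle is that
  only the graph of the second diagram is known, so a decomposition found in the first diagram has
  to be shown to exist in the second. Indecomposability is therefore expressed by edge cuts of the
  4-regular multigraph of which the diagram is an Euler trail: local complementation changes the
  trail and keeps the multigraph, and the three smoothings at a chord are the three pairings of the
  edges at a vertex. Five chords are special because the smallest indecomposable multigraph with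
  more than three vertices is the complete graph on five vertices, and its smoothings are
  decomposable.\<close>

lemma tmul_mono: "tmul (mono u) (mono w) = mono (u @ w)"
proof
  fix v
  have "mono u (take k v) * mono w (drop k v) = (if k = length u then mono (u @ w) v else 0)"
    if "k \<le> length v" for k
  proof (cases "take k v = u \<and> drop k v = w")
    case True
    then have "v = u @ w" by (metis append_take_drop_id)
    moreover have "k = length u" using True that by (metis length_take min.absorb2)
    ultimately show ?thesis using True by (auto simp: mono_def)
  next
    case False
    then have "k = length u \<Longrightarrow> v \<noteq> u @ w" by auto
    with False show ?thesis by (auto simp: mono_def)
  qed
  then have "tmul (mono u) (mono w) v = (\<Sum>k\<le>length v. if k = length u then mono (u @ w) v else 0)"
    unfolding tmul_def by (intro sum.cong) auto
  also have "\<dots> = mono (u @ w) v"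
    by (auto simp: mono_def)
  finally show "tmul (mono u) (mono w) v = mono (u @ w) v" .
qed

lemma tmul_diff_right: "tmul p (\<lambda>v. q v - r v) = (\<lambda>v. tmul p q v - tmul p r v)"
  by (simp add: tmul_def right_diff_distrib sum_subtractf)

lemma tmul_diff_left: "tmul (\<lambda>v. q v - r v) p = (\<lambda>v. tmul q p v - tmul r p v)"
  by (simp add: tmul_def left_diff_distrib sum_subtractf)

lemma tmul_scale_right: "tmul p (\<lambda>v. z * q v) = (\<lambda>v. z * tmul p q v)"
  by (simp add: tmul_def sum_distrib_left mult.left_commute)

lemma tmul_scale_left: "tmul (\<lambda>v. z * q v) p = (\<lambda>v. z * tmul q p v)"
  by (simp add: tmul_def sum_distrib_left mult.assoc)

lemma tmul_sl2_rel: "tmul (tmul (mono u) (sl2_rel a b c)) (mono w) =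
  (\<lambda>v. mono (u @ [a, b] @ w) v - mono (u @ [b, a] @ w) v - \<i> * mono (u @ [c] @ w) v)"
  by (simp add: sl2_rel_def tmul_diff_right tmul_diff_left tmul_scale_right tmul_scale_left tmul_mono)

section \<open>The ideal as a subspace and its separating functionals\<close>

definition pscale :: "complex \<Rightarrow> ncpoly \<Rightarrow> ncpoly" where
  "pscale z p = (\<lambda>v. z * p v)"

interpretation nc: vector_space pscale
  by unfold_locales (auto simp: pscale_def fun_eq_iff algebra_simps)

interpretation ncp: vector_space_pair pscale "(*) :: complex \<Rightarrow> complex \<Rightarrow> complex"
  by unfold_locales (auto simp: algebra_simps)

lemma sl2_ideal_add:
  assumes "p \<in> sl2_ideal" "q \<in> sl2_ideal"
  shows "(\<lambda>v. p v + q v) \<in> sl2_ideal"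
  using assms(1)
proof (induction rule: sl2_ideal.induct)
  case zero
  then show ?case using assms(2) by simp
next
  case (gen a b c p z u w)
  from sl2_ideal.gen[OF gen.hyps(1) gen.IH, of z u w] show ?case
    by (simp only: add_ac)
qed

lemma sl2_ideal_scale:
  assumes "p \<in> sl2_ideal"
  shows "(\<lambda>v. z * p v) \<in> sl2_ideal"
  using assms
proof (induction rule: sl2_ideal.induct)
  case zero
  then show ?case using sl2_ideal.zero by simp
next
  case (gen a b c p y u w)
  from sl2_ideal.gen[OF gen.hyps(1) gen.IH, of "z * y" u w] show ?case
    by (simp only: distrib_left mult.assoc)
qed

lemma sl2_ideal_subspace: "nc.subspace sl2_ideal"
  unfolding nc.subspace_def pscale_def plus_fun_def zero_fun_def
  by (intro conjI ballI allI sl2_ideal.zero sl2_ideal_add sl2_ideal_scale)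

lemma sl2_ideal_rel:
  assumes "(a, b, c) \<in> {(0,1,2), (1,2,0), (2,0,1)}"
  shows "(\<lambda>v. mono (u @ [a, b] @ w) v - mono (u @ [b, a] @ w) v - \<i> * mono (u @ [c] @ w) v) \<in> sl2_ideal"
  using sl2_ideal.gen[OF assms sl2_ideal.zero, of 1 u w] by (simp add: tmul_sl2_rel)

text \<open>A basis of the ideal together with \<open>p\<close> is independent, so a functional can
  be prescribed on it: 0 on the ideal and 1 at \<open>p\<close>.\<close>

lemma separating_functional:
  assumes "p \<notin> sl2_ideal"
  obtains F where "Vector_Spaces.linear pscale (*) F" "F p = (1::complex)" "\<And>q. q \<in> sl2_ideal \<Longrightarrow> F q = 0"
proof -
  obtain B where B: "B \<subseteq> sl2_ideal" "nc.independent B" "sl2_ideal \<subseteq> nc.span B"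
    using nc.maximal_independent_subset by blast
  have sp: "nc.span B = sl2_ideal"
    using B nc.span_minimal[OF B(1) sl2_ideal_subspace] by blast
  then have "nc.independent (insert p B)"
    using B assms nc.independent_insertI by auto
  then obtain F where F: "Vector_Spaces.linear pscale (*) F" "\<forall>x\<in>insert p B. F x = (if x = p then 1 else 0::complex)"
    using ncp.linear_independent_extend[of "insert p B"  "\<lambda>x. if x = p then 1 else 0"] by blast
  have "F q = 0" if "q \<in> sl2_ideal" for q
  proof -
    have "\<And>x. x \<in> B \<Longrightarrow> F x = 0" using F(2) assms B(1) by auto
    then show ?thesis
      by (metis that sp ncp.linear_eq_0_on_span[OF F(1), of B q])
  qed
  with F that show thesis by auto
qed

text \<open>The relations read \<open>x\<^sub>a x\<^sub>b - x\<^sub>b x\<^sub>a = \<i> \<Sum>\<^sub>c eps a b c x\<^sub>c\<close>.\<close>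

definition eps :: "nat \<Rightarrow> nat \<Rightarrow> nat \<Rightarrow> complex" where
  "eps a b c = (if (a, b, c) \<in> {(0,1,2), (1,2,0), (2,0,1)} then 1
     else if (a, b, c) \<in> {(1,0,2), (2,1,0), (0,2,1)} then - 1 else 0)"

text \<open>What the values on monomials of a functional vanishing on the ideal satisfy. Only the
  letters 0, 1, 2 are constrained.\<close>

definition sl2_fun :: "(nat list \<Rightarrow> complex) \<Rightarrow> bool" where
  "sl2_fun f = (\<forall>A B k l. k \<in> {0,1,2} \<longrightarrow> l \<in> {0,1,2} \<longrightarrow>
     f (A @ [k, l] @ B) - f (A @ [l, k] @ B) = \<i> * (\<Sum>m\<in>{0,1,2}. eps k l m * f (A @ [m] @ B)))"

definition wval :: "(nat list \<Rightarrow> complex) \<Rightarrow> 'c list \<Rightarrow> complex" where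
  "wval f D = (\<Sum>\<phi>\<in>set D \<rightarrow>\<^sub>E {0,1,2}. f (map \<phi> D))"

lemma sum_fun_app: "(\<Sum>x\<in>A. f x) v = (\<Sum>x\<in>A. f x v :: complex)"
  by (induction A rule: infinite_finite_induct) auto

lemma w_sl2_sum_mono: "w_sl2 D = (\<Sum>\<phi>\<in>set D \<rightarrow>\<^sub>E {0,1,2}. mono (map \<phi> D))"
proof
  fix v
  have fin: "finite (set D \<rightarrow>\<^sub>E {0,1,2::nat})" by (intro finite_PiE) auto
  have "(\<Sum>\<phi>\<in>set D \<rightarrow>\<^sub>E {0,1,2}. mono (map \<phi> D)) v
      = (\<Sum>\<phi>\<in>set D \<rightarrow>\<^sub>E {0,1,2}. if map \<phi> D = v then 1 else 0)"
    by (subst sum_fun_app) (auto simp: mono_def intro!: sum.cong)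
  also have "\<dots> = of_nat (card {\<phi> \<in> set D \<rightarrow>\<^sub>E {0, 1, 2}. map \<phi> D = v})"
    using fin by (simp add: sum.If_cases Int_def)
  finally show "w_sl2 D v = (\<Sum>\<phi>\<in>set D \<rightarrow>\<^sub>E {0,1,2}. mono (map \<phi> D)) v"
    by (simp add: w_sl2_def)
qed

text \<open>A difference outside the ideal would be detected by a separating functional. Its values
  on monomials satisfy \<open>sl2_fun\<close>, and by \<open>w_sl2_sum_mono\<close> its value at
  \<open>w_sl2 D\<close> is \<open>wval f D\<close>.\<close>

lemma eq_U_I:
  assumes "\<And>f. sl2_fun f \<Longrightarrow> wval f D = wval f E"
  shows "eq_U (w_sl2 D) (w_sl2 E)"
proof (rule ccontr)
  assume "\<not> eq_U (w_sl2 D) (w_sl2 E)"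
  then have "w_sl2 D - w_sl2 E \<notin> sl2_ideal" by (simp add: eq_U_def fun_diff_def)
  then obtain F where F: "Vector_Spaces.linear pscale (*) F" "F (w_sl2 D - w_sl2 E) = (1::complex)"
      "\<And>q. q \<in> sl2_ideal \<Longrightarrow> F q = 0"
    using separating_functional by metis
  define f where "f u = F (mono u)" for u
  note lin = ncp.linear_diff[OF F(1)] ncp.linear_sum[OF F(1)] ncp.linear_scale[OF F(1)]
  have rel: "f (u @ [a, b] @ w) - f (u @ [b, a] @ w) = \<i> * f (u @ [c] @ w)"
    if "(a, b, c) \<in> {(0,1,2), (1,2,0), (2,0,1)}" for a b c u w
  proof -
    have "mono (u @ [a, b] @ w) - mono (u @ [b, a] @ w) - pscale \<i> (mono (u @ [c] @ w)) \<in> sl2_ideal"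
      using sl2_ideal_rel[OF that] by (simp add: fun_diff_def pscale_def)
    from F(3)[OF this] have "F (mono (u @ [a, b] @ w)) - F (mono (u @ [b, a] @ w)) - \<i> * F (mono (u @ [c] @ w)) = 0"
      by (simp only: lin)
    then show ?thesis
      by (simp add: f_def)
  qed
  have "sl2_fun f"
    unfolding sl2_fun_def
  proof (intro allI impI)
    fix A B :: "nat list" and k l :: nat
    assume "k \<in> {0,1,2}" "l \<in> {0,1,2}"
    \<comment> \<open>The three defining relations settle all nine pairs \<open>(k, l)\<close>:
      reversed pairs change the sign and equal letters give 0.\<close>
    moreover have "f (A @ [0, 1] @ B) = f (A @ [1, 0] @ B) + \<i> * f (A @ [2] @ B)"
      "f (A @ [1, 2] @ B) = f (A @ [2, 1] @ B) + \<i> * f (A @ [0] @ B)"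
      "f (A @ [2, 0] @ B) = f (A @ [0, 2] @ B) + \<i> * f (A @ [1] @ B)"
      using rel[of 0 1 2 A B] rel[of 1 2 0 A B] rel[of 2 0 1 A B] by (simp_all add: diff_eq_eq)
    ultimately show "f (A @ [k, l] @ B) - f (A @ [l, k] @ B) = \<i> * (\<Sum>m\<in>{0,1,2}. eps k l m * f (A @ [m] @ B))"
      by (elim insertE emptyE) (simp_all add: eps_def)
  qed
  from assms[OF this] have "F (w_sl2 D) = F (w_sl2 E)"
    by (simp only: w_sl2_sum_mono lin wval_def f_def)
  with F(2) show False by (simp only: lin) simp
qed

section \<open>Reversal of a share\<close>

text \<open>The rest of the diagram is frozen inside \<open>F\<close>, which sees only the labels
  along the two strands of the share.\<close>

definition lie_fun2 :: "(nat list \<Rightarrow> nat list \<Rightarrow> complex) \<Rightarrow> bool" where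
  "lie_fun2 F = ((\<forall>b. sl2_fun (\<lambda>a. F a b)) \<and> (\<forall>a. sl2_fun (F a)))"

lemma lie_fun2_swap: "lie_fun2 F \<Longrightarrow> lie_fun2 (\<lambda>a b. F b a)"
  by (simp add: lie_fun2_def)

lemma lie_fun2D:
  assumes "lie_fun2 F" "k \<in> {0,1,2}" "l \<in> {0,1,2}"
  shows "F (A @ [k, l] @ B) b - F (A @ [l, k] @ B) b = \<i> * (\<Sum>m\<in>{0,1,2}. eps k l m * F (A @ [m] @ B) b)"
  using assms unfolding lie_fun2_def sl2_fun_def by blast

definition chord_sum :: "(nat list \<Rightarrow> nat list \<Rightarrow> complex) \<Rightarrow> 'c list \<Rightarrow> 'c list \<Rightarrow> complex" where
  "chord_sum F s t = (\<Sum>\<phi>\<in>set (s @ t) \<rightarrow>\<^sub>E {0,1,2}. F (map \<phi> s) (map \<phi> t))"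

text \<open>Meant for words in which the legs \<open>p\<close>, \<open>q\<close>, \<open>r\<close>
  occur once and the other letters twice, see \<open>tripodal\<close>: a trivalent vertex carrying
  the structure tensor, whose legs end on the strands.\<close>

definition tripod_sum :: "(nat list \<Rightarrow> nat list \<Rightarrow> complex) \<Rightarrow> 'c \<Rightarrow> 'c \<Rightarrow> 'c \<Rightarrow> 'c list \<Rightarrow> 'c list \<Rightarrow> complex" where
  "tripod_sum F p q r s t = (\<Sum>\<phi>\<in>set (s @ t) \<rightarrow>\<^sub>E {0,1,2}. eps (\<phi> p) (\<phi> q) (\<phi> r) * F (map \<phi> s) (map \<phi> t))"

section \<open>Commutators of endpoints\<close>

lemma sum_PiE_insert:
  fixes f :: "('c \<Rightarrow> 'd) \<Rightarrow> complex"
  assumes "finite S" "finite B" "r \<notin> S"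
  shows "(\<Sum>\<phi>\<in>insert r S \<rightarrow>\<^sub>E B. f \<phi>) = (\<Sum>\<phi>\<in>S \<rightarrow>\<^sub>E B. \<Sum>m\<in>B. f (\<phi>(r := m)))"
proof -
  have inj: "inj_on (\<lambda>(m, \<phi>). \<phi>(r := m)) (B \<times> (S \<rightarrow>\<^sub>E B))"
    using inj_combinator[OF assms(3), of "\<lambda>_. B"] by simp
  have "(\<Sum>\<phi>\<in>insert r S \<rightarrow>\<^sub>E B. f \<phi>) = (\<Sum>(m, \<phi>)\<in>B \<times> (S \<rightarrow>\<^sub>E B). f (\<phi>(r := m)))"
    unfolding PiE_insert_eq by (subst sum.reindex[OF inj]) (simp add: case_prod_beta o_def)
  also have "\<dots> = (\<Sum>m\<in>B. \<Sum>\<phi>\<in>S \<rightarrow>\<^sub>E B. f (\<phi>(r := m)))"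
    by (simp add: sum.cartesian_product)
  finally show ?thesis by (subst sum.swap)
qed

lemma map_upd_notin: "r \<notin> set X \<Longrightarrow> map (\<phi>(r := m)) X = map \<phi> X"
  by auto

lemma PiE_ran: "\<phi> \<in> S \<rightarrow>\<^sub>E B \<Longrightarrow> x \<in> S \<Longrightarrow> \<phi> x \<in> B"
  by auto

text \<open>The STU relation: the commutator of two adjacent letters replaces them by one new
  endpoint \<open>r\<close>, joined by a vertex to the remaining endpoints of \<open>p\<close> and
  \<open>q\<close>.\<close>

lemma chord_sum_swap:
  assumes F: "lie_fun2 F" and "p \<in> set (X @ Y @ t)" "q \<in> set (X @ Y @ t)" "r \<notin> set (X @ Y @ t)"
  shows "chord_sum F (X @ [p, q] @ Y) t - chord_sum F (X @ [q, p] @ Y) t = \<i> * tripod_sum F p q r (X @ [r] @ Y) t"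
proof -
  let ?S = "set (X @ Y @ t)" and ?B = "{0,1,2::nat}"
  have S: "set ((X @ [p, q] @ Y) @ t) = ?S" "set ((X @ [q, p] @ Y) @ t) = ?S"
    "set ((X @ [r] @ Y) @ t) = insert r ?S"
    using assms by auto
  have "chord_sum F (X @ [p, q] @ Y) t - chord_sum F (X @ [q, p] @ Y) t =
    (\<Sum>\<phi>\<in>?S \<rightarrow>\<^sub>E ?B. F (map \<phi> X @ [\<phi> p, \<phi> q] @ map \<phi> Y) (map \<phi> t) - F (map \<phi> X @ [\<phi> q, \<phi> p] @ map \<phi> Y) (map \<phi> t))"
    unfolding chord_sum_def S by (simp add: sum_subtractf)
  also have "\<dots> = (\<Sum>\<phi>\<in>?S \<rightarrow>\<^sub>E ?B. \<i> * (\<Sum>m\<in>?B. eps (\<phi> p) (\<phi> q) m * F (map \<phi> X @ [m] @ map \<phi> Y) (map \<phi> t)))"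
    by (rule sum.cong[OF refl], rule lie_fun2D[OF F]) (erule PiE_ran, rule assms)+
  also have "\<dots> = \<i> * (\<Sum>\<phi>\<in>?S \<rightarrow>\<^sub>E ?B. \<Sum>m\<in>?B. eps (\<phi> p) (\<phi> q) m * F (map \<phi> X @ [m] @ map \<phi> Y) (map \<phi> t))"
    by (simp only: sum_distrib_left)
  also have "(\<Sum>\<phi>\<in>?S \<rightarrow>\<^sub>E ?B. \<Sum>m\<in>?B. eps (\<phi> p) (\<phi> q) m * F (map \<phi> X @ [m] @ map \<phi> Y) (map \<phi> t))
     = tripod_sum F p q r (X @ [r] @ Y) t"
    unfolding tripod_sum_def S using assms
    by (subst sum_PiE_insert) (auto simp: map_upd_notin intro!: sum.cong)
  finally show ?thesis .
qed

lemma eps_range: "(\<Sum>k\<in>{0,1,2::nat}. f k) = f 0 + f 1 + (f 2 :: complex)"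
  by (simp add: add.assoc)

text \<open>The bubble: \<open>eps k l r * eps k l m\<close> summed over \<open>k\<close> and
  \<open>l\<close> is twice the Kronecker delta of \<open>r\<close> and \<open>m\<close>. The 2 is
  the value of the Casimir element in the adjoint representation.\<close>

lemma eps_contract2:
  assumes "r \<in> {0,1,2}"
  shows "(\<Sum>k\<in>{0,1,2}. \<Sum>l\<in>{0,1,2}. eps k l r * (\<i> * (\<Sum>m\<in>{0,1,2}. eps k l m * g m))) = 2 * \<i> * g r"
  using assms unfolding eps_range by (elim insertE emptyE) (simp_all add: eps_def)

text \<open>Two vertices contracted along one edge give a difference of two products of Kronecker
  deltas. This is special to \<open>sl2\<close> and lets a tripod pass an endpoint at the cost of
  chords only.\<close>

lemma eps_contract1:
  assumes "q \<in> {0,1,2}" "r \<in> {0,1,2}" "x \<in> {0,1,2}"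
  shows "(\<Sum>k\<in>{0,1,2}. eps k q r * (\<i> * (\<Sum>m\<in>{0,1,2}. eps k x m * g m))) =
    \<i> * ((if q = x then g r else 0) - (if r = x then g q else 0))"
  using assms unfolding eps_range by (elim insertE emptyE) (simp_all add: eps_def)

lemma eps_flip: "eps k l r = - eps l k r"
  by (auto simp: eps_def)

lemma eps_cycle: "eps k l r = eps l r k"
  by (auto simp: eps_def)

lemma tripod_sum_flip: "tripod_sum F q p r s t = - tripod_sum F p q r s t"
  unfolding tripod_sum_def sum_negf[symmetric]
  by (intro sum.cong refl) (subst eps_flip, simp)

lemma tripod_sum_cycle: "tripod_sum F p q r s t = tripod_sum F q r p s t"
  unfolding tripod_sum_def by (intro sum.cong refl) (subst eps_cycle, simp)

text \<open>Interchanging the two adjacent legs changes the sign, so the sum is half a commutator;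
  the new vertex closes a bubble, which \<open>eps_contract2\<close> evaluates.\<close>

lemma tripod_sum_adjacent:
  assumes F: "lie_fun2 F" and pq: "p \<noteq> q" "p \<notin> set (X @ Y @ t)" "q \<notin> set (X @ Y @ t)" "r \<in> set (X @ Y @ t)"
  shows "tripod_sum F p q r (X @ [p, q] @ Y) t = \<i> * chord_sum F (X @ [r] @ Y) t"
proof -
  let ?S = "set (X @ Y @ t)" and ?B = "{0,1,2::nat}"
  have S: "set ((X @ [p, q] @ Y) @ t) = insert q (insert p ?S)" "set ((X @ [q, p] @ Y) @ t) = insert q (insert p ?S)"
    "set ((X @ [r] @ Y) @ t) = ?S"
    using assms by auto
  have rp: "r \<noteq> p" "r \<noteq> q" using pq by auto
  let ?G = "\<lambda>\<phi> k l. F (map \<phi> X @ [k, l] @ map \<phi> Y) (map \<phi> t)"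
  have m: "map (\<phi>(p := k, q := l)) Z = map \<phi> Z" if "set Z \<subseteq> ?S" for \<phi> :: "'a \<Rightarrow> nat" and k l Z
    using that pq by auto
  have e1: "tripod_sum F p q r (X @ [p, q] @ Y) t = (\<Sum>\<phi>\<in>?S \<rightarrow>\<^sub>E ?B. \<Sum>k\<in>?B. \<Sum>l\<in>?B. eps k l (\<phi> r) * ?G \<phi> k l)"
    unfolding tripod_sum_def S using pq rp
    apply (subst sum_PiE_insert, simp, simp, simp)
    apply (subst sum_PiE_insert, simp, simp, simp)
    apply (intro sum.cong refl)
    apply (simp add: m)
    done
  have e2: "tripod_sum F p q r (X @ [q, p] @ Y) t = (\<Sum>\<phi>\<in>?S \<rightarrow>\<^sub>E ?B. \<Sum>k\<in>?B. \<Sum>l\<in>?B. eps k l (\<phi> r) * ?G \<phi> l k)"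
    unfolding tripod_sum_def S using pq rp
    apply (subst sum_PiE_insert, simp, simp, simp)
    apply (subst sum_PiE_insert, simp, simp, simp)
    apply (intro sum.cong refl)
    apply (simp add: m)
    done
  have "tripod_sum F p q r (X @ [q, p] @ Y) t = (\<Sum>\<phi>\<in>?S \<rightarrow>\<^sub>E ?B. \<Sum>k\<in>?B. \<Sum>l\<in>?B. - (eps k l (\<phi> r) * ?G \<phi> k l))"
    unfolding e2 by (subst (2) sum.swap, intro sum.cong refl, subst eps_flip) simp
  then have neg: "tripod_sum F p q r (X @ [q, p] @ Y) t = - tripod_sum F p q r (X @ [p, q] @ Y) t"
    unfolding e1 by (simp only: sum_negf)
  have "tripod_sum F p q r (X @ [p, q] @ Y) t - tripod_sum F p q r (X @ [q, p] @ Y) t =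
     (\<Sum>\<phi>\<in>?S \<rightarrow>\<^sub>E ?B. \<Sum>k\<in>?B. \<Sum>l\<in>?B. eps k l (\<phi> r) * (?G \<phi> k l - ?G \<phi> l k))"
    unfolding e1 e2 by (simp only: sum_subtractf right_diff_distrib)
  also have "\<dots> = (\<Sum>\<phi>\<in>?S \<rightarrow>\<^sub>E ?B. \<Sum>k\<in>?B. \<Sum>l\<in>?B. eps k l (\<phi> r) * (\<i> * (\<Sum>m\<in>?B. eps k l m * F (map \<phi> X @ [m] @ map \<phi> Y) (map \<phi> t))))"
    by (rule sum.cong[OF refl], rule sum.cong[OF refl], rule sum.cong[OF refl], rule arg_cong2[of _ _ _ _ "(*)", OF refl], rule lie_fun2D[OF F])
  also have "\<dots> = (\<Sum>\<phi>\<in>?S \<rightarrow>\<^sub>E ?B. 2 * \<i> * F (map \<phi> X @ [\<phi> r] @ map \<phi> Y) (map \<phi> t))"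
    by (rule sum.cong[OF refl], rule eps_contract2) (erule PiE_ran, rule pq)
  also have "\<dots> = 2 * \<i> * chord_sum F (X @ [r] @ Y) t"
    unfolding chord_sum_def S by (simp add: sum_distrib_left)
  finally show ?thesis using neg by simp
qed

text \<open>A Kronecker delta glues two letters: the labellings that survive are those that factor
  through \<open>id(q := x)\<close>.\<close>

lemma chord_sum_identify:
  assumes "q \<noteq> x" "x \<in> set (s @ t)" "q \<in> set (s @ t)"
  shows "(\<Sum>\<phi>\<in>set (s @ t) \<rightarrow>\<^sub>E {0,1,2}. if \<phi> q = \<phi> x then F (map \<phi> s) (map \<phi> t) else 0) =
    chord_sum F (map (id(q := x)) s) (map (id(q := x)) t)"
proof -
  let ?S = "set (s @ t) - {q}" and ?B = "{0,1,2::nat}"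
  have S: "set (s @ t) = insert q ?S" "set (map (id(q := x)) s @ map (id(q := x)) t) = ?S"
    using assms by auto
  have m: "map (\<phi>(q := \<phi> x)) Z = map \<phi> (map (id(q := x)) Z)" for \<phi> :: "'a \<Rightarrow> nat" and Z
    by auto
  have "(\<Sum>\<phi>\<in>set (s @ t) \<rightarrow>\<^sub>E ?B. if \<phi> q = \<phi> x then F (map \<phi> s) (map \<phi> t) else 0) =
     (\<Sum>\<phi>\<in>?S \<rightarrow>\<^sub>E ?B. \<Sum>k\<in>?B. if k = \<phi> x then F (map (\<phi>(q := k)) s) (map (\<phi>(q := k)) t) else 0)"
    using assms by (subst S(1), subst sum_PiE_insert) auto
  also have "\<dots> = (\<Sum>\<phi>\<in>?S \<rightarrow>\<^sub>E ?B. F (map (\<phi>(q := \<phi> x)) s) (map (\<phi>(q := \<phi> x)) t))"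
  proof (intro sum.cong refl)
    fix \<phi> assume \<phi>: "\<phi> \<in> ?S \<rightarrow>\<^sub>E ?B"
    have "\<phi> x \<in> ?B" using assms by (intro PiE_ran[OF \<phi>]) auto
    then show "(\<Sum>k\<in>?B. if k = \<phi> x then F (map (\<phi>(q := k)) s) (map (\<phi>(q := k)) t) else 0) =
      F (map (\<phi>(q := \<phi> x)) s) (map (\<phi>(q := \<phi> x)) t)" by (subst sum.delta) auto
  qed
  finally show ?thesis unfolding chord_sum_def S(2) m .
qed

text \<open>Pulling the leg \<open>p\<close> over \<open>x\<close> creates a second vertex on that
  leg. By \<open>eps_contract1\<close> the two vertices resolve into gluings: one of the legs
  \<open>q\<close>, \<open>r\<close> is identified with \<open>x\<close>, and the other receives the
  new endpoint.\<close>

lemma tripod_sum_swap: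
  assumes F: "lie_fun2 F" and p: "p \<notin> set (X @ W @ t)"
    and q: "q \<in> set (X @ W @ t)" and r: "r \<in> set (X @ W @ t)" and x: "x \<in> set (X @ W @ t)"
    and ne: "q \<noteq> x" "r \<noteq> x"
  shows "tripod_sum F p q r (X @ [p, x] @ W) t - tripod_sum F p q r (X @ [x, p] @ W) t =
    \<i> * (chord_sum F (map (id(q := x)) (X @ [r] @ W)) (map (id(q := x)) t)
       - chord_sum F (map (id(r := x)) (X @ [q] @ W)) (map (id(r := x)) t))"
proof -
  let ?S = "set (X @ W @ t)" and ?B = "{0,1,2::nat}"
  have S: "set ((X @ [p, x] @ W) @ t) = insert p ?S" "set ((X @ [x, p] @ W) @ t) = insert p ?S"
    "set ((X @ [r] @ W) @ t) = ?S" "set ((X @ [q] @ W) @ t) = ?S"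
    using assms by auto
  have nep: "q \<noteq> p" "r \<noteq> p" "x \<noteq> p" using assms by auto
  have m: "map (\<phi>(p := l)) Z = map \<phi> Z" if "set Z \<subseteq> ?S" for \<phi> :: "'a \<Rightarrow> nat" and l Z
    using that p by auto
  let ?G = "\<lambda>\<phi> k l. F (map \<phi> X @ [k, l] @ map \<phi> W) (map \<phi> t)"
  have e: "tripod_sum F p q r (X @ [p, x] @ W) t = (\<Sum>\<phi>\<in>?S \<rightarrow>\<^sub>E ?B. \<Sum>k\<in>?B. eps k (\<phi> q) (\<phi> r) * ?G \<phi> k (\<phi> x))"
    "tripod_sum F p q r (X @ [x, p] @ W) t = (\<Sum>\<phi>\<in>?S \<rightarrow>\<^sub>E ?B. \<Sum>k\<in>?B. eps k (\<phi> q) (\<phi> r) * ?G \<phi> (\<phi> x) k)"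
    unfolding tripod_sum_def S using p nep
    by (subst sum_PiE_insert, simp, simp, simp, intro sum.cong refl, simp add: m)+
  have "tripod_sum F p q r (X @ [p, x] @ W) t - tripod_sum F p q r (X @ [x, p] @ W) t =
     (\<Sum>\<phi>\<in>?S \<rightarrow>\<^sub>E ?B. \<Sum>k\<in>?B. eps k (\<phi> q) (\<phi> r) * (?G \<phi> k (\<phi> x) - ?G \<phi> (\<phi> x) k))"
    unfolding e by (simp only: sum_subtractf right_diff_distrib)
  also have "\<dots> = (\<Sum>\<phi>\<in>?S \<rightarrow>\<^sub>E ?B. \<Sum>k\<in>?B. eps k (\<phi> q) (\<phi> r) * (\<i> * (\<Sum>m\<in>?B. eps k (\<phi> x) m * F (map \<phi> X @ [m] @ map \<phi> W) (map \<phi> t))))"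
    by (rule sum.cong[OF refl], rule sum.cong[OF refl], rule arg_cong2[of _ _ _ _ "(*)", OF refl], rule lie_fun2D[OF F])
      (assumption | erule PiE_ran, rule x)+
  also have "\<dots> = (\<Sum>\<phi>\<in>?S \<rightarrow>\<^sub>E ?B. \<i> * ((if \<phi> q = \<phi> x then F (map \<phi> X @ [\<phi> r] @ map \<phi> W) (map \<phi> t) else 0)
      - (if \<phi> r = \<phi> x then F (map \<phi> X @ [\<phi> q] @ map \<phi> W) (map \<phi> t) else 0)))"
    by (rule sum.cong[OF refl], rule eps_contract1) (erule PiE_ran, rule q r x)+
  also have "\<dots> = \<i> * ((\<Sum>\<phi>\<in>?S \<rightarrow>\<^sub>E ?B. if \<phi> q = \<phi> x then F (map \<phi> (X @ [r] @ W)) (map \<phi> t) else 0)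
      - (\<Sum>\<phi>\<in>?S \<rightarrow>\<^sub>E ?B. if \<phi> r = \<phi> x then F (map \<phi> (X @ [q] @ W)) (map \<phi> t) else 0))"
    by (simp only: sum_distrib_left[symmetric] sum_subtractf map_append list.map)
  also have "(\<Sum>\<phi>\<in>?S \<rightarrow>\<^sub>E ?B. if \<phi> q = \<phi> x then F (map \<phi> (X @ [r] @ W)) (map \<phi> t) else 0) =
      chord_sum F (map (id(q := x)) (X @ [r] @ W)) (map (id(q := x)) t)"
    using chord_sum_identify[of q x "X @ [r] @ W" t F] ne q x unfolding S by auto
  also have "(\<Sum>\<phi>\<in>?S \<rightarrow>\<^sub>E ?B. if \<phi> r = \<phi> x then F (map \<phi> (X @ [q] @ W)) (map \<phi> t) else 0) =
      chord_sum F (map (id(r := x)) (X @ [q] @ W)) (map (id(r := x)) t)"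
    using chord_sum_identify[of r x "X @ [q] @ W" t F] ne r x unfolding S by auto
  finally show ?thesis .
qed

section \<open>Induction on the number of endpoints\<close>

definition chordal :: "'c list \<Rightarrow> 'c list \<Rightarrow> bool" where
  "chordal s t = (\<forall>c\<in>set (s @ t). count_list (s @ t) c = 2)"

definition tripodal :: "'c \<Rightarrow> 'c \<Rightarrow> 'c \<Rightarrow> 'c list \<Rightarrow> 'c list \<Rightarrow> bool" where
  "tripodal p q r s t = (p \<noteq> q \<and> q \<noteq> r \<and> p \<noteq> r \<and> (\<forall>c\<in>{p, q, r}. count_list (s @ t) c = 1) \<and>
     (\<forall>c\<in>set (s @ t) - {p, q, r}. count_list (s @ t) c = 2))"

lemma chord_sum_commute: "chord_sum F s t = chord_sum (\<lambda>a b. F b a) t s"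
  by (simp add: chord_sum_def Un_commute)

lemma tripod_sum_commute: "tripod_sum F p q r s t = tripod_sum (\<lambda>a b. F b a) p q r t s"
  by (simp add: tripod_sum_def Un_commute)

lemma chordal_commute: "chordal s t = chordal t s"
  by (auto simp: chordal_def add.commute)

lemma chordal_mset:
  assumes "mset s = mset s'"
  shows "chordal s t = chordal s' t"
proof -
  have "set s = set s'" "\<And>c. count_list s c = count_list s' c"
    using assms by (metis mset_eq_setD, metis count_mset)
  then show ?thesis by (simp add: chordal_def)
qed

lemma tripodal_mset:
  assumes "mset s = mset s'"
  shows "tripodal p q r s t = tripodal p q r s' t"
proof -
  have "set s = set s'" "\<And>c. count_list s c = count_list s' c"
    using assms by (metis mset_eq_setD, metis count_mset)
  then show ?thesis by (simp add: tripodal_def)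
qed

lemma tripodal_commute: "tripodal p q r s t = tripodal p q r t s"
  by (auto simp: tripodal_def add.commute)

lemma count_list_1_in: "count_list L c = 1 \<Longrightarrow> c \<in> set L"
  by (metis count_list_0_iff zero_neq_one)

lemma move_to_front:
  assumes "\<And>X p q Y. mset (X @ [p, q] @ Y) = M \<Longrightarrow> g (X @ [p, q] @ Y) = g (X @ [q, p] @ Y)"
    and "mset (zs @ A @ y # B) = M"
  shows "g (zs @ A @ y # B) = g (zs @ y # A @ B)"
  using assms(2)
proof (induction A arbitrary: B rule: rev_induct)
  case (snoc a A)
  have "g ((zs @ A) @ [a, y] @ B) = g ((zs @ A) @ [y, a] @ B)"
    using snoc.prems by (intro assms(1)) auto
  moreover have "g (zs @ A @ y # (a # B)) = g (zs @ y # A @ (a # B))"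
    using snoc.prems by (intro snoc.IH) auto
  ultimately show ?case by simp
qed simp

text \<open>Every rearrangement is a composite of interchanges of neighbours; \<open>zs\<close> is
  the part that is already in its final order.\<close>

lemma swap_invariant:
  assumes "\<And>X p q Y. mset (X @ [p, q] @ Y) = M \<Longrightarrow> g (X @ [p, q] @ Y) = g (X @ [q, p] @ Y)"
    and "mset (zs @ ys) = M" "mset ys = mset ys'"
  shows "g (zs @ ys) = g (zs @ ys')"
  using assms(2,3)
proof (induction ys' arbitrary: zs ys)
  case (Cons y ys')
  then have "y \<in> set ys" by (metis list.set_intros(1) mset_eq_setD)
  then obtain A B where ys: "ys = A @ y # B" by (meson split_list)
  have "g (zs @ ys) = g (zs @ y # A @ B)"
    unfolding ys using Cons.prems ys by (intro move_to_front[of M] assms(1)) auto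
  also have "\<dots> = g ((zs @ [y]) @ A @ B)" by simp
  also have "\<dots> = g ((zs @ [y]) @ ys')"
    using Cons.prems ys by (intro Cons.IH) auto
  finally show ?case by simp
qed simp

text \<open>The defect \<open>f\<close>, the chord sum minus that of the reversed words, does not
  change when neighbours are interchanged, hence depends only on the multisets of the two words.
  Reversing both words keeps the multisets and negates the defect, which therefore vanishes.\<close>

lemma chord_sum_rev_step:
  fixes s t :: "nat list"
  assumes odd: "\<And>F p q r s t. lie_fun2 F \<Longrightarrow> tripodal p q r s t \<Longrightarrow> Suc (length (s @ t)) = d \<Longrightarrow>
      tripod_sum F p q r s t = - tripod_sum F p q r (rev s) (rev (t :: nat list))"
    and F: "lie_fun2 F" and ch: "chordal s t" and d: "length (s @ t) = d"
  shows "chord_sum F s t = chord_sum F (rev s) (rev t)"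
proof -
  define f where "f F s t = chord_sum F s t - chord_sum F (rev s) (rev t)" for F and s t :: "nat list"
  have step: "f F (X @ [p, q] @ Y) t = f F (X @ [q, p] @ Y) t"
    if F: "lie_fun2 F" and ch: "chordal (X @ [p, q] @ Y) t" and d: "length ((X @ [p, q] @ Y) @ t) = d"
    for F X p q Y t
  proof (cases "p = q")
    case False
    obtain r where r: "r \<notin> set (p # q # X @ Y @ t)"
      using ex_new_if_finite[OF infinite_UNIV_nat finite_set] by blast
    have cp: "count_list (X @ Y @ t) p = 1" "count_list (X @ Y @ t) q = 1"
      using ch False unfolding chordal_def by (auto dest!: bspec[of _ _ p] bspec[of _ _ q])
    then have pq: "p \<in> set (X @ Y @ t)" "q \<in> set (X @ Y @ t)"
      by (metis count_list_0_iff zero_neq_one)+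
    have tr: "tripodal p q r (X @ [r] @ Y) t"
      using ch False r cp unfolding chordal_def tripodal_def
      by (auto simp: count_list_0_iff split: if_splits)
    have 1: "chord_sum F (X @ [p, q] @ Y) t - chord_sum F (X @ [q, p] @ Y) t = \<i> * tripod_sum F p q r (X @ [r] @ Y) t"
      using r by (intro chord_sum_swap F pq) auto
    \<comment> \<open>In the reversed word the two letters come in the opposite order, which flips
      the tripod; together with the sign in \<open>odd\<close> this makes both commutators
      equal.\<close>
    have "chord_sum F (rev Y @ [q, p] @ rev X) (rev t) - chord_sum F (rev Y @ [p, q] @ rev X) (rev t)
      = \<i> * tripod_sum F q p r (rev Y @ [r] @ rev X) (rev t)"
      using r pq by (intro chord_sum_swap F) auto
    also have "\<dots> = \<i> * tripod_sum F p q r (X @ [r] @ Y) t"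
      using odd[OF F tr] d tripod_sum_flip[of F q p r "rev Y @ [r] @ rev X" "rev t"] by simp
    finally show ?thesis using 1 by (simp add: f_def algebra_simps)
  qed simp
  have inv: "f F s t = f F (rev s) t"
    if F: "lie_fun2 F" and ch: "chordal s t" and d: "length (s @ t) = d" for F s t
  proof -
    have "f F ([] @ s) t = f F ([] @ rev s) t"
    proof (rule swap_invariant[where g = "\<lambda>s. f F s t" and M = "mset s"])
      fix X p q Y assume m: "mset (X @ [p, q] @ Y) = mset s"
      then have "chordal (X @ [p, q] @ Y) t" "length (X @ [p, q] @ Y) = length s"
        using chordal_mset[OF m] ch mset_eq_length[OF m] by auto
      then show "f F (X @ [p, q] @ Y) t = f F (X @ [q, p] @ Y) t"
        using d by (intro step F) auto
    qed auto
    then show ?thesis by simp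
  qed
  have fc: "f F s t = f (\<lambda>a b. F b a) t s" for F s t
    by (simp add: f_def chord_sum_commute[of F])
  have "f F s t = f F (rev s) t" by (rule inv[OF F ch d])
  also have "\<dots> = f (\<lambda>a b. F b a) t (rev s)" by (rule fc)
  also have "\<dots> = f (\<lambda>a b. F b a) (rev t) (rev s)"
    using ch d chordal_mset[of "rev s" s t] by (intro inv[OF lie_fun2_swap[OF F]]) (simp_all add: chordal_commute[of t] add.commute)
  also have "\<dots> = f F (rev s) (rev t)" by (rule fc[symmetric])
  also have "\<dots> = - f F s t" by (simp add: f_def)
  finally show ?thesis by (simp add: f_def)
qed

text \<open>Induction on the number of endpoints between the legs \<open>p\<close> and
  \<open>q\<close>. Each step of \<open>p\<close> towards \<open>q\<close> costs chord sums, which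
  reversal preserves by \<open>even\<close>. Adjacent legs reduce the tripod to a chord sum, and the
  sign comes from their order.\<close>

lemma tripod_sum_rev_core:
  fixes X Y Z t :: "nat list"
  assumes even: "\<And>F s t. lie_fun2 F \<Longrightarrow> chordal s t \<Longrightarrow> Suc (length (s @ t)) = d \<Longrightarrow>
      chord_sum F s t = chord_sum F (rev s) (rev (t :: nat list))"
    and F: "lie_fun2 F" and "tripodal p q r (X @ p # Z @ q # Y) t" and "length ((X @ p # Z @ q # Y) @ t) = d"
    and "r \<notin> set Z"
  shows "tripod_sum F p q r (X @ p # Z @ q # Y) t + tripod_sum F p q r (rev (X @ p # Z @ q # Y)) (rev t) = 0"
  using assms(3-)
proof (induction Z arbitrary: X)
  case Nil
  then have ne: "p \<noteq> q" "q \<noteq> r" "p \<noteq> r"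
    and c: "count_list (X @ p # q # Y @ t) p = 1" "count_list (X @ p # q # Y @ t) q = 1"
      "count_list (X @ p # q # Y @ t) r = 1"
    and two: "\<And>c. c \<in> set (X @ p # q # Y @ t) - {p, q, r} \<Longrightarrow> count_list (X @ p # q # Y @ t) c = 2"
    unfolding tripodal_def by auto
  have r1: "count_list (X @ Y @ t) r = 1" using c ne by simp
  have t: "p \<noteq> q" "p \<notin> set (X @ Y @ t)" "q \<notin> set (X @ Y @ t)" "r \<in> set (X @ Y @ t)"
    using ne c count_list_1_in[OF r1] by (simp_all add: count_list_0_iff)
  have "count_list ((X @ [r] @ Y) @ t) d = 2" if "d \<in> set ((X @ [r] @ Y) @ t)" for d
  proof (cases "d = r")
    case True
    then show ?thesis using r1 by simp
  next
    case False
    with that t have "d \<in> set (X @ Y @ t)" "d \<noteq> p" "d \<noteq> q" by auto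
    then show ?thesis using two[of d] False by simp
  qed
  then have ch: "chordal (X @ [r] @ Y) t"
    unfolding chordal_def by blast
  have 1: "tripod_sum F p q r (X @ [p, q] @ Y) t = \<i> * chord_sum F (X @ [r] @ Y) t"
    by (rule tripod_sum_adjacent[OF F t])
  have "tripod_sum F q p r (rev Y @ [q, p] @ rev X) (rev t) = \<i> * chord_sum F (rev Y @ [r] @ rev X) (rev t)"
    using t by (intro tripod_sum_adjacent[OF F]) auto
  also have "\<dots> = \<i> * chord_sum F (X @ [r] @ Y) t"
    using even[OF F ch] Nil.prems(2) by simp
  finally show ?case
    using 1 tripod_sum_flip[of F q p r "rev Y @ [q, p] @ rev X" "rev t"] by simp
next
  case (Cons x Z)
  let ?W = "Z @ q # Y"
  have tr: "p \<noteq> q" "q \<noteq> r" "p \<noteq> r" "count_list (X @ p # x # ?W @ t) p = 1" "count_list (X @ p # x # ?W @ t) q = 1"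
    "count_list (X @ p # x # ?W @ t) r = 1" 
    and two: "\<And>c. c \<in> set (X @ p # x # ?W @ t) \<Longrightarrow> c \<notin> {p, q, r} \<Longrightarrow> count_list (X @ p # x # ?W @ t) c = 2"
    using Cons.prems(1) unfolding tripodal_def by auto
  have xne: "x \<noteq> p" "x \<noteq> q" "x \<noteq> r" using tr Cons.prems(3) by (auto split: if_splits)
  have p: "p \<notin> set (X @ ?W @ t)" using tr xne by (auto simp: count_list_0_iff)
  have x1: "count_list (X @ ?W @ t) x = 1" using two[of x] xne by simp
  then have x: "x \<in> set (X @ ?W @ t)" by (metis count_list_0_iff zero_neq_one)
  have r1: "count_list (X @ ?W @ t) r = 1" using tr xne by simp
  then have r: "r \<in> set (X @ ?W @ t)" by (metis count_list_0_iff zero_neq_one)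
  have q1: "count_list (X @ ?W @ t) q = 1" and q: "q \<in> set (X @ ?W @ t)" using tr xne by auto
  \<comment> \<open>Gluing turns the leg \<open>u\<close> into the missing second endpoint of
    \<open>x\<close>, and the new endpoint completes the leg \<open>v\<close> to a chord.\<close>
  have ch: "chordal (map (id(u := x)) (X @ [v] @ ?W)) (map (id(u := x)) t)"
    if uv: "(u, v) \<in> {(q, r), (r, q)}" for u v
  proof -
    have cm: "count_list (map (id(u := x)) L) c = (if c = u then 0 else count_list L c + (if c = x then count_list L u else 0))"
      for L c using uv xne by (induction L) auto
    have "count_list (X @ ?W @ t) c = 2" if "c \<in> set (X @ ?W @ t)" "c \<notin> {q, r, x}" for c
      using two[of c] that xne p by (auto split: if_splits)
    then have 1: "count_list (X @ [v] @ ?W @ t) c + (if c = x then count_list (X @ [v] @ ?W @ t) u else 0) = 2"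
      if "c \<in> set (X @ [v] @ ?W @ t)" "c \<noteq> u" for c
      using that uv x1 r1 q1 xne tr(2) q r by (cases "c \<in> {q, r, x}") auto
    have 2: "set (map (id(u := x)) (X @ [v] @ ?W @ t)) \<subseteq> set (X @ [v] @ ?W @ t) - {u}"
      using x xne uv by auto
    have "count_list (map (id(u := x)) (X @ [v] @ ?W @ t)) c = 2"
      if "c \<in> set (map (id(u := x)) (X @ [v] @ ?W @ t))" for c
    proof -
      have "c \<in> set (X @ [v] @ ?W @ t)" "c \<noteq> u" using 2 that by blast+
      from 1[OF this] \<open>c \<noteq> u\<close> show ?thesis unfolding cm by presburger
    qed
    then show ?thesis
      unfolding chordal_def map_append[symmetric] append_assoc by blast
  qed
  have sw: "tripod_sum F p q r (X @ [p, x] @ ?W) t - tripod_sum F p q r (X @ [x, p] @ ?W) t =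
    \<i> * (chord_sum F (map (id(q := x)) (X @ [r] @ ?W)) (map (id(q := x)) t)
       - chord_sum F (map (id(r := x)) (X @ [q] @ ?W)) (map (id(r := x)) t))"
    using p q r x xne by (intro tripod_sum_swap F) auto
  have swr: "tripod_sum F p q r (rev ?W @ [p, x] @ rev X) (rev t) - tripod_sum F p q r (rev ?W @ [x, p] @ rev X) (rev t) =
    \<i> * (chord_sum F (map (id(q := x)) (rev ?W @ [r] @ rev X)) (map (id(q := x)) (rev t))
       - chord_sum F (map (id(r := x)) (rev ?W @ [q] @ rev X)) (map (id(r := x)) (rev t)))"
    using p q r x xne by (intro tripod_sum_swap F) auto
  have len: "Suc (length (map (id(u := x)) (X @ [v] @ ?W) @ map (id(u := x)) t)) = d" for u v
    using Cons.prems(2) by simp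
  have ev: "chord_sum F (map (id(u := x)) (X @ [v] @ ?W)) (map (id(u := x)) t) =
     chord_sum F (map (id(u := x)) (rev ?W @ [v] @ rev X)) (map (id(u := x)) (rev t))"
    if "(u, v) \<in> {(q, r), (r, q)}" for u v
    using even[OF F ch[OF that] len] by (simp add: rev_map)
  have IH: "tripod_sum F p q r ((X @ [x]) @ p # Z @ q # Y) t + tripod_sum F p q r (rev ((X @ [x]) @ p # Z @ q # Y)) (rev t) = 0"
  proof (rule Cons.IH)
    show "tripodal p q r ((X @ [x]) @ p # Z @ q # Y) t"
      using Cons.prems(1) tripodal_mset[of "(X @ [x]) @ p # Z @ q # Y" "X @ p # (x # Z) @ q # Y"] by simp
  qed (use Cons.prems in simp_all)
  have w: "X @ p # (x # Z) @ q # Y = X @ [p, x] @ ?W" "(X @ [x]) @ p # Z @ q # Y = X @ [x, p] @ ?W"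
    "rev (X @ [p, x] @ ?W) = rev ?W @ [x, p] @ rev X" "rev (X @ [x, p] @ ?W) = rev ?W @ [p, x] @ rev X"
    by simp_all
  have alg: "T1 + R1 = 0"
    if "T1 - T2 = z * (A - B)" "R2 - R1 = z * (A' - B')" "A = A'" "B = B'" "T2 + R2 = 0"
    for T1 T2 R1 R2 z A B A' B' :: complex
    using that by algebra
  show ?case
    unfolding w(1,3) by (rule alg[OF sw swr ev ev IH[unfolded w(2,4)]]) simp_all
qed

lemma filter_two_split:
  assumes "length (filter P s) \<ge> 2"
  obtains X a Z b Y where "s = X @ a # Z @ b # Y" "P a" "P b" "\<forall>z\<in>set Z. \<not> P z"
proof -
  obtain a L where L: "filter P s = a # L" "L \<noteq> []" using assms
    by (cases "filter P s") (auto simp: Suc_le_eq)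
  from L(1) obtain X W where s: "s = X @ a # W" "P a" "filter P W = L"
    by (auto simp: filter_eq_Cons_iff)
  obtain b L' where "filter P W = b # L'" using s L(2) by (cases L) auto
  then obtain Z Y where "W = Z @ b # Y" "P b" "\<forall>z\<in>set Z. \<not> P z"
    by (auto simp: filter_eq_Cons_iff)
  with s that show thesis by auto
qed

text \<open>Two of the three legs share a strand, which may be taken to be the first one. If they
  are chosen consecutive, no leg lies between them, as \<open>tripod_sum_rev_core\<close> requires;
  permuting the legs changes the sum only by the sign of the permutation.\<close>

lemma tripod_sum_rev_step:
  fixes s t :: "nat list"
  assumes even: "\<And>F s t. lie_fun2 F \<Longrightarrow> chordal s t \<Longrightarrow> Suc (length (s @ t)) = d \<Longrightarrow>
      chord_sum F s t = chord_sum F (rev s) (rev (t :: nat list))"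
    and "lie_fun2 F" and "tripodal p q r s t" and "length (s @ t) = d"
  shows "tripod_sum F p q r s t = - tripod_sum F p q r (rev s) (rev t)"
proof -
  have main: "tripod_sum F p q r s t = - tripod_sum F p q r (rev s) (rev t)"
    if F: "lie_fun2 F" and tr: "tripodal p q r s t" and d: "length (s @ t) = d"
      and two: "length (filter (\<lambda>c. c \<in> {p, q, r}) s) \<ge> 2" for F s t
  proof -
    from filter_two_split[OF two] obtain X a Z b Y where
      s: "s = X @ a # Z @ b # Y" "a \<in> {p, q, r}" "b \<in> {p, q, r}" "\<forall>z\<in>set Z. z \<notin> {p, q, r}"
      by metis
    have "a \<noteq> b"
    proof
      assume "a = b"
      then have "count_list (s @ t) a \<ge> 2" using s by simp
      with tr s(2) show False by (auto simp: tripodal_def add.commute)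
    qed
    then obtain c where c: "{a, b, c} = {p, q, r}" "a \<noteq> c" "b \<noteq> c" using s(2,3) tr
      unfolding tripodal_def by (elim insertE emptyE) auto
    have tr': "tripodal a b c (X @ a # Z @ b # Y) t"
      using tr c \<open>a \<noteq> b\<close> unfolding s(1) tripodal_def c(1) by auto
    have z: "tripod_sum F a b c s t + tripod_sum F a b c (rev s) (rev t) = 0"
      unfolding s(1) using s c by (intro tripod_sum_rev_core[OF even F tr' ]) (use d s in auto)
    have "c \<in> {p, q, r}" using c(1) by blast
    then have "(a, b, c) \<in> {(p, q, r), (q, r, p), (r, p, q), (q, p, r), (p, r, q), (r, q, p)}"
      using s(2,3) c(2,3) \<open>a \<noteq> b\<close> by auto
    moreover have "tripod_sum F q r p s t = tripod_sum F p q r s t" "tripod_sum F r p q s t = tripod_sum F p q r s t"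
      "tripod_sum F q p r s t = - tripod_sum F p q r s t" "tripod_sum F p r q s t = - tripod_sum F p q r s t"
      "tripod_sum F r q p s t = - tripod_sum F p q r s t" for s t
      using tripod_sum_cycle[of F p q r s t] tripod_sum_cycle[of F q r p s t] tripod_sum_flip[of F q p r s t]
        tripod_sum_flip[of F p r q s t] tripod_sum_cycle[of F r p q s t] tripod_sum_flip[of F r q p s t] by simp_all
    ultimately have "(\<forall>s t. tripod_sum F a b c s t = tripod_sum F p q r s t) \<or> (\<forall>s t. tripod_sum F a b c s t = - tripod_sum F p q r s t)"
      by (elim insertE emptyE) simp_all
    then show ?thesis
    proof
      assume "\<forall>s t. tripod_sum F a b c s t = tripod_sum F p q r s t"
      with z show ?thesis by (simp add: eq_neg_iff_add_eq_0)
    next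
      assume "\<forall>s t. tripod_sum F a b c s t = - tripod_sum F p q r s t"
      with z have "- tripod_sum F p q r s t + - tripod_sum F p q r (rev s) (rev t) = 0" by simp
      then show ?thesis by algebra
    qed
  qed
  let ?P = "\<lambda>c. c \<in> {p, q, r}"
  have tr: "p \<noteq> q" "q \<noteq> r" "p \<noteq> r" "count_list (s @ t) p = 1" "count_list (s @ t) q = 1" "count_list (s @ t) r = 1"
    using assms(3) unfolding tripodal_def by blast+
  have "length (filter ?P L) = count_list L p + count_list L q + count_list L r" for L
    using tr(1-3) by (induction L) auto
  from this[of "s @ t"] have "length (filter ?P (s @ t)) = 3"
    using tr by simp
  then consider "length (filter ?P s) \<ge> 2" | "length (filter ?P t) \<ge> 2"
    unfolding filter_append length_append by linarith
  then show ?thesis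
  proof cases
    case 1
    then show ?thesis using main[OF assms(2-4)] by blast
  next
    case 2
    show ?thesis
      unfolding tripod_sum_commute[of F p q r s t] tripod_sum_commute[of F p q r "rev s" "rev t"] using assms 2
      by (intro main[OF lie_fun2_swap[OF assms(2)]]) (simp_all add: tripodal_commute[of p q r s t] add.commute)
  qed
qed

text \<open>Each claim for \<open>Suc d\<close> endpoints rests on the other one for
  \<open>d\<close>, since every commutator replaces two endpoints by one.\<close>

lemma chord_sum_tripod_sum_rev:
  fixes s t :: "nat list"
  shows "lie_fun2 F \<Longrightarrow> chordal s t \<Longrightarrow> length (s @ t) = d \<Longrightarrow> chord_sum F s t = chord_sum F (rev s) (rev t)"
    and "lie_fun2 F \<Longrightarrow> tripodal p q r s t \<Longrightarrow> length (s @ t) = d \<Longrightarrow>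
      tripod_sum F p q r s t = - tripod_sum F p q r (rev s) (rev t)"
proof (induction d arbitrary: F p q r s t)
  case 0
  {
    case 1
    then show ?case by simp
  next
    case 2
    then show ?case by (simp add: tripodal_def)
  }
next
  case (Suc d)
  {
    case 1
    show ?case
      by (rule chord_sum_rev_step[where d = "Suc d"]) (use 1 Suc.IH(2) in auto)
  next
    case 2
    show ?case
      by (rule tripod_sum_rev_step[where d = "Suc d"]) (use 2 Suc.IH(1) in auto)
  }
qed

section \<open>Relabelling, and shares inside a diagram\<close>

lemma chord_sum_map:
  assumes "inj_on g (set (s @ t))"
  shows "chord_sum F (map g s) (map g t) = chord_sum F s t"
proof -
  let ?S = "set (s @ t)" and ?B = "{0,1,2::nat}"
  have S: "set (map g s @ map g t) = g ` ?S" by auto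
  note inv = inv_into_f_f[OF assms]
  show ?thesis
    unfolding chord_sum_def S
  proof (rule sum.reindex_bij_witness[where j = "\<lambda>\<phi>. restrict (\<lambda>c. \<phi> (g c)) ?S"
        and i = "\<lambda>\<psi>. restrict (\<lambda>c. \<psi> (inv_into ?S g c)) (g ` ?S)"])
    fix \<phi> assume \<phi>: "\<phi> \<in> g ` ?S \<rightarrow>\<^sub>E ?B"
    show "restrict (\<lambda>c. restrict (\<lambda>c. \<phi> (g c)) ?S (inv_into ?S g c)) (g ` ?S) = \<phi>"
    proof
      fix c
      show "restrict (\<lambda>c. restrict (\<lambda>c. \<phi> (g c)) ?S (inv_into ?S g c)) (g ` ?S) c = \<phi> c"
        using PiE_arb[OF \<phi>, of c] inv by (cases "c \<in> g ` ?S") auto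
    qed
    show "restrict (\<lambda>c. \<phi> (g c)) ?S \<in> ?S \<rightarrow>\<^sub>E ?B"
      unfolding restrict_PiE_iff using PiE_mem[OF \<phi>] by blast
    have "map (restrict (\<lambda>c. \<phi> (g c)) ?S) s = map \<phi> (map g s)"
      "map (restrict (\<lambda>c. \<phi> (g c)) ?S) t = map \<phi> (map g t)" by auto
    then show "F (map (restrict (\<lambda>c. \<phi> (g c)) ?S) s) (map (restrict (\<lambda>c. \<phi> (g c)) ?S) t) =
      F (map \<phi> (map g s)) (map \<phi> (map g t))" by (simp only:)
  next
    fix \<psi> assume \<psi>: "\<psi> \<in> ?S \<rightarrow>\<^sub>E ?B"
    show "restrict (\<lambda>c. \<psi> (inv_into ?S g c)) (g ` ?S) \<in> g ` ?S \<rightarrow>\<^sub>E ?B"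
      unfolding restrict_PiE_iff using PiE_mem[OF \<psi>] inv by simp
    show "restrict (\<lambda>c. restrict (\<lambda>c. \<psi> (inv_into ?S g c)) (g ` ?S) (g c)) ?S = \<psi>"
    proof
      fix c
      show "restrict (\<lambda>c. restrict (\<lambda>c. \<psi> (inv_into ?S g c)) (g ` ?S) (g c)) ?S c = \<psi> c"
        using PiE_arb[OF \<psi>, of c] inv by (cases "c \<in> ?S") auto
    qed
  qed
qed

text \<open>The labels are moved to \<open>nat\<close>, where a fresh letter for the endpoint of a
  new tripod always exists.\<close>

lemma chord_sum_rev:
  assumes F: "lie_fun2 F" and ch: "chordal s t"
  shows "chord_sum F (rev s) (rev t) = chord_sum F s t"
proof -
  obtain g :: "'a \<Rightarrow> nat" where g: "inj_on g (set (s @ t))"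
    using finite_imp_inj_to_nat_seg[of "set (s @ t)"] by auto
  have cl: "count_list (map g (s @ t)) (g c) = count_list (s @ t) c" if "c \<in> set (s @ t)" for c
    using count_list_inj_map[OF g, of c] that by auto
  have "chordal (map g s) (map g t)"
    unfolding chordal_def map_append[symmetric] set_map
  proof
    fix d assume "d \<in> g ` set (s @ t)"
    then obtain c where "c \<in> set (s @ t)" "d = g c" by blast
    then show "count_list (map g (s @ t)) d = 2"
      using ch cl unfolding chordal_def by simp
  qed
  from chord_sum_tripod_sum_rev(1)[OF F this refl]
  have "chord_sum F (map g s) (map g t) = chord_sum F (map g (rev s)) (map g (rev t))"
    by (simp add: rev_map)
  then show ?thesis
    using chord_sum_map[OF g, of F] chord_sum_map[of g "rev s" "rev t" F] g by simp
qed

lemma wval_chord_sum: "wval f D = chord_sum (\<lambda>a b. f a) D []"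
  by (simp add: wval_def chord_sum_def)

lemma wval_map:
  assumes "inj_on g (set D)"
  shows "wval f (map g D) = wval f D"
  using chord_sum_map[of g D "[]" "\<lambda>a b. f a"] assms by (simp add: wval_chord_sum)

lemma sum_PiE_disjoint:
  fixes g :: "('c \<Rightarrow> nat) \<Rightarrow> complex"
  assumes disj: "S \<inter> U = {}"
  shows "(\<Sum>\<chi>\<in>S \<union> U \<rightarrow>\<^sub>E B. g \<chi>) = (\<Sum>\<phi>\<in>U \<rightarrow>\<^sub>E B. \<Sum>\<psi>\<in>S \<rightarrow>\<^sub>E B. g (\<lambda>x. if x \<in> S then \<psi> x else \<phi> x))"
proof -
  have "(\<Sum>\<chi>\<in>S \<union> U \<rightarrow>\<^sub>E B. g \<chi>) =
    (\<Sum>(\<phi>, \<psi>)\<in>(U \<rightarrow>\<^sub>E B) \<times> (S \<rightarrow>\<^sub>E B). g (\<lambda>x. if x \<in> S then \<psi> x else \<phi> x))"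
  proof (rule sum.reindex_bij_witness[where j = "\<lambda>\<chi>. (restrict \<chi> U, restrict \<chi> S)"
        and i = "\<lambda>(\<phi>, \<psi>) x. if x \<in> S then \<psi> x else \<phi> x"])
    fix \<chi> assume \<chi>: "\<chi> \<in> S \<union> U \<rightarrow>\<^sub>E B"
    have eq: "(\<lambda>x. if x \<in> S then restrict \<chi> S x else restrict \<chi> U x) = \<chi>"
    proof
      fix x
      show "(if x \<in> S then restrict \<chi> S x else restrict \<chi> U x) = \<chi> x"
        using PiE_arb[OF \<chi>, of x] by auto
    qed
    then show "(case (restrict \<chi> U, restrict \<chi> S) of (\<phi>, \<psi>) \<Rightarrow> \<lambda>x. if x \<in> S then \<psi> x else \<phi> x) = \<chi>"
      by simp
    show "(restrict \<chi> U, restrict \<chi> S) \<in> (U \<rightarrow>\<^sub>E B) \<times> (S \<rightarrow>\<^sub>E B)" using \<chi> by auto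
    show "(case (restrict \<chi> U, restrict \<chi> S) of (\<phi>, \<psi>) \<Rightarrow> g (\<lambda>x. if x \<in> S then \<psi> x else \<phi> x)) = g \<chi>"
      using eq by simp
  next
    fix b assume b: "b \<in> (U \<rightarrow>\<^sub>E B) \<times> (S \<rightarrow>\<^sub>E B)"
    obtain \<phi> \<psi> where [simp]: "b = (\<phi>, \<psi>)" by (cases b)
    have \<phi>: "\<phi> \<in> U \<rightarrow>\<^sub>E B" and \<psi>: "\<psi> \<in> S \<rightarrow>\<^sub>E B" using b by auto
    show "(case b of (\<phi>, \<psi>) \<Rightarrow> \<lambda>x. if x \<in> S then \<psi> x else \<phi> x) \<in> S \<union> U \<rightarrow>\<^sub>E B"
      using \<phi> \<psi> by (auto simp: PiE_arb[OF \<phi>])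
    have "restrict (\<lambda>x. if x \<in> S then \<psi> x else \<phi> x) U = \<phi>"
    proof
      fix x
      show "restrict (\<lambda>x. if x \<in> S then \<psi> x else \<phi> x) U x = \<phi> x"
        using PiE_arb[OF \<phi>, of x] disj by auto
    qed
    moreover have "restrict (\<lambda>x. if x \<in> S then \<psi> x else \<phi> x) S = \<psi>"
    proof
      fix x
      show "restrict (\<lambda>x. if x \<in> S then \<psi> x else \<phi> x) S x = \<psi> x"
        using PiE_arb[OF \<psi>, of x] by auto
    qed
    ultimately show "(restrict (case b of (\<phi>, \<psi>) \<Rightarrow> \<lambda>x. if x \<in> S then \<psi> x else \<phi> x) U,
        restrict (case b of (\<phi>, \<psi>) \<Rightarrow> \<lambda>x. if x \<in> S then \<psi> x else \<phi> x) S) = b"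
      by simp
  qed
  then show ?thesis by (simp add: sum.cartesian_product)
qed

lemma wval_context:
  assumes "set (s @ t) \<inter> set (u0 @ u1 @ u2) = {}"
  shows "wval f (u0 @ s @ u1 @ t @ u2) = (\<Sum>\<phi>\<in>set (u0 @ u1 @ u2) \<rightarrow>\<^sub>E {0,1,2}.
    chord_sum (\<lambda>a b. f (map \<phi> u0 @ a @ map \<phi> u1 @ b @ map \<phi> u2)) s t)"
proof -
  let ?S = "set (s @ t)" and ?U = "set (u0 @ u1 @ u2)"
  have S: "set (u0 @ s @ u1 @ t @ u2) = ?S \<union> ?U" by auto
  have m: "map (\<lambda>x. if x \<in> ?S then \<psi> x else \<phi> x) u = map \<phi> u" if "set u \<subseteq> ?U"
    for \<phi> \<psi> :: "'a \<Rightarrow> nat" and u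
    using that assms by (auto intro!: map_cong)
  have m': "map (\<lambda>x. if x \<in> ?S then \<psi> x else \<phi> x) u = map \<psi> u" if "set u \<subseteq> ?S"
    for \<phi> \<psi> :: "'a \<Rightarrow> nat" and u
    using that by (auto intro!: map_cong)
  have ms: "map (\<lambda>x. if x \<in> ?S then \<psi> x else \<phi> x) u0 = map \<phi> u0"
    "map (\<lambda>x. if x \<in> ?S then \<psi> x else \<phi> x) u1 = map \<phi> u1"
    "map (\<lambda>x. if x \<in> ?S then \<psi> x else \<phi> x) u2 = map \<phi> u2"
    "map (\<lambda>x. if x \<in> ?S then \<psi> x else \<phi> x) s = map \<psi> s"
    "map (\<lambda>x. if x \<in> ?S then \<psi> x else \<phi> x) t = map \<psi> t" for \<phi> \<psi> :: "'a \<Rightarrow> nat"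
    by (rule m, force, rule m, force, rule m, force, rule m', force, rule m', force)
  show ?thesis
    unfolding wval_def S chord_sum_def
    by (subst sum_PiE_disjoint[OF assms], intro sum.cong refl) (simp only: map_append ms)
qed

text \<open>Once the labels of the chords outside the share are fixed, what remains is a chord sum
  over its two strands.\<close>

lemma wval_rev_share:
  assumes f: "sl2_fun f" and disj: "set (s @ t) \<inter> set (u0 @ u1 @ u2) = {}"
    and ch: "\<forall>c\<in>set (s @ t). count_list (s @ t) c = 2"
  shows "wval f (u0 @ rev s @ u1 @ rev t @ u2) = wval f (u0 @ s @ u1 @ t @ u2)"
proof -
  have lie: "lie_fun2 (\<lambda>a b. f (v0 @ a @ v1 @ b @ v2))" for v0 v1 v2
    unfolding lie_fun2_def sl2_fun_def
  proof (intro conjI allI impI)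
    fix b A B :: "nat list" and k l :: nat
    assume "k \<in> {0,1,2}" "l \<in> {0,1,2}"
    then show "f (v0 @ (A @ [k, l] @ B) @ v1 @ b @ v2) - f (v0 @ (A @ [l, k] @ B) @ v1 @ b @ v2)
      = \<i> * (\<Sum>m\<in>{0,1,2}. eps k l m * f (v0 @ (A @ [m] @ B) @ v1 @ b @ v2))"
      using f[unfolded sl2_fun_def, rule_format, of k l "v0 @ A" "B @ v1 @ b @ v2"] by simp
  next
    fix a A B :: "nat list" and k l :: nat
    assume "k \<in> {0,1,2}" "l \<in> {0,1,2}"
    then show "f (v0 @ a @ v1 @ (A @ [k, l] @ B) @ v2) - f (v0 @ a @ v1 @ (A @ [l, k] @ B) @ v2)
      = \<i> * (\<Sum>m\<in>{0,1,2}. eps k l m * f (v0 @ a @ v1 @ (A @ [m] @ B) @ v2))"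
      using f[unfolded sl2_fun_def, rule_format, of k l "v0 @ a @ v1 @ A" "B @ v2"] by simp
  qed
  have ch': "chordal s t" using ch by (simp add: chordal_def)
  have disj': "set (rev s @ rev t) \<inter> set (u0 @ u1 @ u2) = {}" using disj by simp
  show ?thesis
    unfolding wval_context[OF disj] wval_context[OF disj']
    by (intro sum.cong refl chord_sum_rev[OF lie ch'])
qed

section \<open>Mutations and intersection graphs\<close>

text \<open>A double occurrence word, that is, a chord diagram with a cut point.\<close>

definition dow :: "'a list \<Rightarrow> bool" where
  "dow D = (\<forall>x\<in>set D. count_list D x = 2)"

text \<open>Disjointness says that no chord leaves the share with strands \<open>s\<close> and
  \<open>t\<close>. Change of the cut point, reflection of the circle and exchange of the strands
  are special cases or composites of this one move.\<close>

inductive mutation :: "'a list \<Rightarrow> 'a list \<Rightarrow> bool" where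
  mutationI: "set (s @ t) \<inter> set (u0 @ u1 @ u2) = {} \<Longrightarrow>
     mutation (u0 @ s @ u1 @ t @ u2) (u0 @ rev s @ u1 @ rev t @ u2)"

definition meq :: "'a list \<Rightarrow> 'a list \<Rightarrow> bool" where
  "meq = mutation\<^sup>*\<^sup>*"

lemma meq_refl [simp]: "meq D D"
  by (simp add: meq_def)

lemma meq_trans [trans]: "meq D E \<Longrightarrow> meq E F \<Longrightarrow> meq D F"
  by (simp add: meq_def)

lemma mutation_sym: "mutation D E \<Longrightarrow> mutation E D"
proof (induction rule: mutation.induct)
  case (mutationI s t u0 u1 u2)
  then show ?case using mutation.intros[of "rev s" "rev t" u0 u1 u2] by simp
qed

lemma meq_sym: "meq D E \<Longrightarrow> meq E D"
  unfolding meq_def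
  by (induction rule: rtranclp_induct) (auto intro: mutation_sym converse_rtranclp_into_rtranclp)

lemma meq_rev_share:
  "set (s @ t) \<inter> set (u0 @ u1 @ u2) = {} \<Longrightarrow> meq (u0 @ s @ u1 @ t @ u2) (u0 @ rev s @ u1 @ rev t @ u2)"
  unfolding meq_def by (rule r_into_rtranclp) (rule mutationI)

lemma meq_rev: "meq D (rev D)"
  using meq_rev_share[of D "[]" "[]" "[]" "[]"] by simp

text \<open>The whole circle is a share with strands \<open>X\<close> and \<open>Y\<close>:
  reversing each strand and then the whole word restores the directions and exchanges the
  order.\<close>

lemma meq_rot: "meq (X @ Y) (Y @ X)"
proof -
  have "meq (X @ Y) (rev X @ rev Y)"
    using meq_rev_share[of X Y "[]" "[]" "[]"] by simp
  also have "meq \<dots> (rev (rev X @ rev Y))" by (rule meq_rev)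
  finally show ?thesis by simp
qed

text \<open>The complement of a share is a share as well: reverse it, reflect the circle, and
  reverse the strands \<open>s\<close> and \<open>t\<close> back.\<close>

lemma meq_swap_share:
  assumes "set (s @ t) \<inter> set (u0 @ u1 @ u2) = {}"
  shows "meq (u0 @ s @ u1 @ t @ u2) (u0 @ t @ u1 @ s @ u2)"
proof -
  have "meq (u0 @ s @ u1 @ t @ u2) (s @ u1 @ t @ (u2 @ u0))"
    using meq_rot[of u0 "s @ u1 @ t @ u2"] by simp
  also have "meq \<dots> (s @ rev u1 @ t @ rev (u2 @ u0))"
    using meq_rev_share[of u1 "u2 @ u0" s t "[]"] assms by auto
  also have "meq \<dots> ((u2 @ u0) @ rev t @ u1 @ rev s @ [])"
    using meq_rev[of "s @ rev u1 @ t @ rev (u2 @ u0)"] by simp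
  also have "meq \<dots> ((u2 @ u0) @ t @ u1 @ s @ [])"
    using meq_rev_share[of "rev t" "rev s" "u2 @ u0" u1 "[]"] assms by auto
  also have "meq \<dots> (u0 @ t @ u1 @ s @ u2)"
    using meq_rot[of u2 "u0 @ t @ u1 @ s"] by simp
  finally show ?thesis .
qed

lemma meq_mset: "meq D E \<Longrightarrow> mset D = mset E"
  unfolding meq_def
proof (induction rule: rtranclp_induct)
  case (step E F)
  from step(2) have "mset E = mset F" by cases simp
  with step.IH show ?case by simp
qed simp

lemma mset_count_list: "mset D = mset E \<Longrightarrow> count_list D x = count_list E x"
  by (metis count_mset)

lemma mset_dow:
  assumes "mset D = mset E"
  shows "dow D = dow E"
  unfolding dow_def mset_count_list[OF assms] mset_eq_setD[OF assms] ..

definition crosses :: "'a list \<Rightarrow> 'a \<Rightarrow> 'a \<Rightarrow> bool" where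
  "crosses D x y = (filter (\<lambda>z. z = x \<or> z = y) D \<in> {[x, y, x, y], [y, x, y, x]})"

lemma crosses_commute: "crosses D x y = crosses D y x"
  unfolding crosses_def by (auto simp: disj_commute)

lemma alternating_rev:
  "P @ Q \<in> {[x, y, x, y], [y, x, y, x]} \<Longrightarrow> rev P @ rev Q \<in> {[x, y, x, y], [y, x, y, x]}"
  by (auto simp: append_eq_Cons_conv)

lemma filter_const_rev:
  assumes "\<And>z. z \<in> set s \<Longrightarrow> P z \<Longrightarrow> z = x"
  shows "filter P (rev s) = filter P s"
proof -
  have "filter P s = replicate (length (filter P s)) x"
    using assms by (intro replicate_eqI) auto
  then show ?thesis by (metis rev_filter rev_replicate)
qed

text \<open>If both chords belong to the share, alternation survives the reversal of the two parts.
  Otherwise a strand contains at most one of the two letters, and its reversal is invisible.\<close>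

lemma crosses_mutation: 
  assumes "mutation D E" "crosses D x y" 
  shows "crosses E x y"
  using assms(1)
proof cases
  case (mutationI s t u0 u1 u2)
  let ?P = "\<lambda>z. z = x \<or> z = y"
  let ?S = "set (s @ t)"
  consider "x \<in> ?S" "y \<in> ?S" | "x \<notin> ?S" | "y \<notin> ?S" by blast
  then show ?thesis
  proof cases
    case 1
    then have u: "filter ?P u0 = []" "filter ?P u1 = []" "filter ?P u2 = []"
      using mutationI(3) by (auto simp: filter_empty_conv)
    show ?thesis
      using assms(2) alternating_rev[of "filter ?P s" "filter ?P t" x y]
      unfolding crosses_def mutationI(1,2) by (simp add: u rev_filter[symmetric])
  next
    case 2
    then have "filter ?P (rev s) = filter ?P s" "filter ?P (rev t) = filter ?P t"
      by (auto intro!: filter_const_rev)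
    then show ?thesis using assms(2) unfolding crosses_def mutationI(1,2) by simp
  next
    case 3
    then have "filter ?P (rev s) = filter ?P s" "filter ?P (rev t) = filter ?P t"
      by (auto intro!: filter_const_rev)
    then show ?thesis using assms(2) unfolding crosses_def mutationI(1,2) by simp
  qed
qed

lemma crosses_meq: "meq D E \<Longrightarrow> crosses D x y = crosses E x y"
  unfolding meq_def by (induction rule: rtranclp_induct) (auto intro: crosses_mutation mutation_sym)

lemma crosses_filter:
  assumes "P x" "P y"
  shows "crosses (filter P D) x y = crosses D x y"
proof -
  have "filter (\<lambda>z. z = x \<or> z = y) (filter P D) = filter (\<lambda>z. z = x \<or> z = y) D"
    unfolding filter_filter using assms by (intro filter_cong) auto
  then show ?thesis by (simp add: crosses_def)
qed

lemma count_list_filter_if: "count_list (filter P D) x = (if P x then count_list D x else 0)"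
  by (induction D) auto

lemma dow_filter: "dow D \<Longrightarrow> dow (filter P D)"
  by (simp add: dow_def count_list_filter_if)

text \<open>Successive occurrences of \<open>v\<close> are replaced by the words in the list \<open>hs\<close>; excess occurrences are deleted.\<close>

fun sub :: "'a \<Rightarrow> 'a list list \<Rightarrow> 'a list \<Rightarrow> 'a list" where
  "sub v hs [] = []"
| "sub v hs (x # xs) = (if x = v then concat (take 1 hs) @ sub v (drop 1 hs) xs else x # sub v hs xs)"

section \<open>Substitution for the two ends of a chord\<close>

lemma sub_append: "sub v hs (xs @ ys) = sub v hs xs @ sub v (drop (count_list xs v) hs) ys"
  by (induction xs arbitrary: hs) auto

lemma sub_notin: "v \<notin> set xs \<Longrightarrow> sub v hs xs = xs"
  by (induction xs) auto

lemma set_sub: "set (sub v hs xs) \<subseteq> (set xs - {v}) \<union> (\<Union>h\<in>set hs. set h)"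
proof (induction xs arbitrary: hs)
  case (Cons x xs)
  show ?case
  proof (cases "x = v")
    case True
    have "set (take 1 hs) \<subseteq> set hs" "set (drop 1 hs) \<subseteq> set hs"
      by (rule set_take_subset, rule set_drop_subset)
    then show ?thesis using True Cons.IH[of "drop 1 hs"] by fastforce
  qed (use Cons.IH[of hs] in auto)
qed simp

lemma count_list_2_split:
  assumes "count_list s v = 2"
  obtains a b c where "s = a @ [v] @ b @ [v] @ c" "v \<notin> set a" "v \<notin> set b" "v \<notin> set c"
proof -
  obtain a r where s: "s = a @ v # r" "v \<notin> set a" using assms split_list_first[of v s]
    by (metis count_notin zero_neq_numeral)
  then have "count_list r v = 1" using assms by (simp add: count_notin)
  then obtain b c where r: "r = b @ v # c" "v \<notin> set b" using split_list_first[of v r]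
    by (metis count_notin zero_neq_one)
  then have "v \<notin> set c" using \<open>count_list r v = 1\<close> by (simp add: count_list_0_iff)
  with s r that[of a b c] show thesis by simp
qed

lemma count_list_1_split:
  assumes "count_list s v = 1"
  obtains a b where "s = a @ [v] @ b" "v \<notin> set a" "v \<notin> set b"
proof -
  obtain a b where s: "s = a @ v # b" "v \<notin> set a" using assms split_list_first[of v s]
    by (metis count_notin zero_neq_one)
  moreover have "v \<notin> set b" using s assms by (simp add: count_list_0_iff)
  ultimately show thesis using that[of a b] by simp
qed

text \<open>If \<open>v\<close> lies outside the share, the same mutation applies after the
  substitution. If \<open>v\<close> belongs to the share, the reversal also reverses
  \<open>g\<close> and \<open>h\<close>, and their order when both ends of \<open>v\<close> are on
  one strand; mutating the share with strands \<open>g\<close> and \<open>h\<close>, and exchanging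
  these if necessary, repairs this.\<close>

lemma sub_mutation:
  assumes "mutation D E" and c: "count_list D v = 2" and h: "(set g \<union> set h) \<inter> (set D - {v}) = {}"
  shows "meq (sub v [g, h] D) (sub v [g, h] E)"
  using assms(1)
proof cases
  case (mutationI s t u0 u1 u2)
  note D = mutationI(1) and E = mutationI(2) and disj = mutationI(3)
  show ?thesis
  proof (cases "v \<in> set (s @ t)")
    case False
    let ?c = "count_list u0 v"
    have n: "v \<notin> set s" "v \<notin> set t" "v \<notin> set (rev s)" "v \<notin> set (rev t)" using False by auto
    have cl: "count_list s v = 0" "count_list t v = 0" using n by simp_all
    have DE: "sub v [g, h] D = sub v [g, h] u0 @ s @ sub v (drop ?c [g, h]) u1 @ t @ sub v (drop (count_list u1 v) (drop ?c [g, h])) u2"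
      "sub v [g, h] E = sub v [g, h] u0 @ rev s @ sub v (drop ?c [g, h]) u1 @ rev t @ sub v (drop (count_list u1 v) (drop ?c [g, h])) u2"
      unfolding D E sub_append sub_notin[OF n(1)] sub_notin[OF n(2)] sub_notin[OF n(3)] sub_notin[OF n(4)]
      using n by (simp_all add: cl)
    have gh: "\<Union> (set ` set (drop k (drop l [g, h]))) \<subseteq> set g \<union> set h" for k l
      using set_drop_subset[of k "drop l [g, h]"] set_drop_subset[of l "[g, h]"] by auto
    have st: "set (s @ t) \<inter> (set g \<union> set h) = {}"
      using h n D by auto
    have n: "set (s @ t) \<inter> set (sub v (drop k (drop l [g, h])) u) = {}" if "set u \<subseteq> set (u0 @ u1 @ u2)" for u k l
      using set_sub[of v "drop k (drop l [g, h])" u] gh[of k l] st that disj by blast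
    have "set (s @ t) \<inter> set (sub v [g, h] u0) = {}"
      "set (s @ t) \<inter> set (sub v (drop ?c [g, h]) u1) = {}"
      "set (s @ t) \<inter> set (sub v (drop (count_list u1 v) (drop ?c [g, h])) u2) = {}"
      using n[of u0 0 0] n[of u1 0 ?c] n[of u2 "count_list u1 v" ?c] by auto
    then show ?thesis unfolding DE by (intro meq_rev_share) (simp only: set_append Int_Un_distrib, simp)
  next
    case True
    then have u: "v \<notin> set u0" "v \<notin> set u1" "v \<notin> set u2" using disj by auto
    then have cu: "count_list u0 v = 0" "count_list u1 v = 0" by simp_all
    have cst: "count_list s v + count_list t v = 2" using c D u by simp
    have ghu: "(set g \<union> set h) \<inter> set (u0 @ u1 @ u2) = {}" "(set g \<union> set h) \<inter> (set (s @ t) - {v}) = {}"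
      using h D u by auto
    have "count_list s v = 1 \<and> count_list t v = 1 \<or> count_list s v = 2 \<and> count_list t v = 0
        \<or> count_list s v = 0 \<and> count_list t v = 2"
      using cst by linarith
    then show ?thesis
    proof (elim disjE conjE)
      assume 1: "count_list s v = 1" "count_list t v = 1"
      obtain a b where s: "s = a @ [v] @ b" "v \<notin> set a" "v \<notin> set b" by (rule count_list_1_split[OF 1(1)])
      obtain a' b' where t: "t = a' @ [v] @ b'" "v \<notin> set a'" "v \<notin> set b'" by (rule count_list_1_split[OF 1(2)])
      have DE: "sub v [g, h] D = u0 @ (a @ g @ b) @ u1 @ (a' @ h @ b') @ u2"
        "sub v [g, h] E = (u0 @ rev b) @ g @ (rev a @ u1 @ rev b') @ h @ (rev a' @ u2)"
        unfolding D E s t using u s t by (simp_all add: sub_append sub_notin)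
      have "meq (sub v [g, h] D) (u0 @ rev (a @ g @ b) @ u1 @ rev (a' @ h @ b') @ u2)"
        unfolding DE using disj ghu s t by (intro meq_rev_share) auto
      also have "u0 @ rev (a @ g @ b) @ u1 @ rev (a' @ h @ b') @ u2 =
         (u0 @ rev b) @ rev g @ (rev a @ u1 @ rev b') @ rev h @ (rev a' @ u2)" by simp
      also have "meq \<dots> (sub v [g, h] E)"
        unfolding DE using meq_rev_share[of "rev g" "rev h" "u0 @ rev b" "rev a @ u1 @ rev b'" "rev a' @ u2"] ghu s t
        by auto
      finally show ?thesis .
    next
      assume 1: "count_list s v = 2" "count_list t v = 0"
      obtain a b c where s: "s = a @ [v] @ b @ [v] @ c" "v \<notin> set a" "v \<notin> set b" "v \<notin> set c"
        by (rule count_list_2_split[OF 1(1)])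
      have t: "v \<notin> set t" using 1(2) by (simp add: count_list_0_iff)
      have DE: "sub v [g, h] D = u0 @ (a @ g @ b @ h @ c) @ u1 @ t @ u2"
        "sub v [g, h] E = (u0 @ rev c) @ g @ rev b @ h @ (rev a @ u1 @ rev t @ u2)"
        unfolding D E s t using u s t by (simp_all add: sub_append sub_notin)
      have "meq (sub v [g, h] D) (u0 @ rev (a @ g @ b @ h @ c) @ u1 @ rev t @ u2)"
        unfolding DE using disj ghu s t by (intro meq_rev_share) auto
      also have "u0 @ rev (a @ g @ b @ h @ c) @ u1 @ rev t @ u2 =
         (u0 @ rev c) @ rev h @ rev b @ rev g @ (rev a @ u1 @ rev t @ u2)" by simp
      also have "meq \<dots> ((u0 @ rev c) @ h @ rev b @ g @ (rev a @ u1 @ rev t @ u2))"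
        using meq_rev_share[of "rev h" "rev g" "u0 @ rev c" "rev b" "rev a @ u1 @ rev t @ u2"] ghu s t
        by auto
      also have "meq \<dots> (sub v [g, h] E)"
        unfolding DE using ghu s t by (intro meq_swap_share) auto
      finally show ?thesis .
    next
      assume 1: "count_list s v = 0" "count_list t v = 2"
      obtain a b c where t: "t = a @ [v] @ b @ [v] @ c" "v \<notin> set a" "v \<notin> set b" "v \<notin> set c"
        by (rule count_list_2_split[OF 1(2)])
      have s: "v \<notin> set s" using 1(1) by (simp add: count_list_0_iff)
      have DE: "sub v [g, h] D = u0 @ s @ u1 @ (a @ g @ b @ h @ c) @ u2"
        "sub v [g, h] E = (u0 @ rev s @ u1 @ rev c) @ g @ rev b @ h @ (rev a @ u2)"
        unfolding D E s t using u s t by (simp_all add: sub_append sub_notin)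
      have "meq (sub v [g, h] D) (u0 @ rev s @ u1 @ rev (a @ g @ b @ h @ c) @ u2)"
        unfolding DE using disj ghu s t by (intro meq_rev_share) auto
      also have "u0 @ rev s @ u1 @ rev (a @ g @ b @ h @ c) @ u2 =
         (u0 @ rev s @ u1 @ rev c) @ rev h @ rev b @ rev g @ (rev a @ u2)" by simp
      also have "meq \<dots> ((u0 @ rev s @ u1 @ rev c) @ h @ rev b @ g @ (rev a @ u2))"
        using meq_rev_share[of "rev h" "rev g" "u0 @ rev s @ u1 @ rev c" "rev b" "rev a @ u2"] ghu s t
        by auto
      also have "meq \<dots> (sub v [g, h] E)"
        unfolding DE using ghu s t by (intro meq_swap_share) auto
      finally show ?thesis .
    qed
  qed
qed

lemma sub_meq:
  assumes "meq D E" and c: "count_list D v = 2" and h: "(set g \<union> set h) \<inter> (set D - {v}) = {}"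
  shows "meq (sub v [g, h] D) (sub v [g, h] E)"
  using assms(1) unfolding meq_def
proof (induction rule: rtranclp_induct)
  case (step E F)
  have m: "mset D = mset E" using step(1) meq_mset unfolding meq_def by blast
  have "meq (sub v [g, h] E) (sub v [g, h] F)"
    using sub_mutation[OF step(2)] c h mset_count_list[OF m, of v] mset_eq_setD[OF m] by auto
  with step.IH show ?case unfolding meq_def by simp
qed simp

lemma sub_two:
  assumes "v \<notin> set a" "v \<notin> set b" "v \<notin> set c"
  shows "sub v [g, h] (a @ [v] @ b @ [v] @ c) = a @ g @ b @ h @ c"
  using assms by (simp add: sub_append sub_notin)

section \<open>Intersection graphs and the symmetries of the circle\<close>

definition same_graph :: "'a list \<Rightarrow> 'a list \<Rightarrow> bool" where
  "same_graph D E = (dow D \<and> dow E \<and> set D = set E \<and> (\<forall>x y. crosses D x y = crosses E x y))"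

definition dihedral :: "'a list \<Rightarrow> 'a list \<Rightarrow> bool" where
  "dihedral D E = (\<exists>n. E = rotate n D \<or> E = rotate n (rev D))"

lemma same_graph_sym: "same_graph D E \<Longrightarrow> same_graph E D"
  by (auto simp: same_graph_def)

lemma same_graph_trans: "same_graph D E \<Longrightarrow> same_graph E F \<Longrightarrow> same_graph D F"
  by (simp add: same_graph_def)

lemma meq_same_graph: "dow D \<Longrightarrow> meq D E \<Longrightarrow> same_graph D E"
  unfolding same_graph_def using meq_mset[of D E] mset_dow[of D E] mset_eq_setD[of D E] crosses_meq[of D E]
  by blast

lemma crosses_in: "crosses D x y \<Longrightarrow> x \<in> set D \<and> y \<in> set D"
proof -
  assume "crosses D x y"
  then have "{x, y} \<subseteq> set (filter (\<lambda>z. z = x \<or> z = y) D)"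
    unfolding crosses_def by (auto simp del: set_filter)
  then show ?thesis by auto
qed

lemma crosses_neq: "dow D \<Longrightarrow> crosses D x y \<Longrightarrow> x \<noteq> y"
proof
  assume D: "dow D" "crosses D x y" and "x = y"
  then have "count_list (filter (\<lambda>z. z = x) D) x = 4" by (auto simp: crosses_def)
  then show False using D \<open>x = y\<close> crosses_in[of D x y] by (auto simp: count_list_filter_if dow_def)
qed

lemma same_graph_filter:
  assumes "same_graph D E"
  shows "same_graph (filter P D) (filter P E)"
proof -
  have "crosses (filter P D) x y = crosses (filter P E) x y" for x y
  proof (cases "P x \<and> P y")
    case True
    then show ?thesis using assms by (simp add: crosses_filter same_graph_def)
  next
    case False
    then show ?thesis using crosses_in[of "filter P D" x y] crosses_in[of "filter P E" x y] by auto
  qed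
  then show ?thesis using assms by (auto simp: same_graph_def dow_filter)
qed

lemma filter_pair_replicate:
  "v \<notin> set A \<Longrightarrow> filter (\<lambda>z. z = v \<or> z = x) A = replicate (count_list A x) x"
  by (induction A) auto

lemma crosses_chord:
  assumes "dow D" and D: "D = A @ [v] @ B @ [v] @ C" and n: "v \<notin> set A" "v \<notin> set B" "v \<notin> set C" and "x \<noteq> v"
  shows "crosses D v x \<longleftrightarrow> count_list B x = 1"
proof -
  have f: "filter (\<lambda>z. z = v \<or> z = x) D =
     replicate (count_list A x) x @ [v] @ replicate (count_list B x) x @ [v] @ replicate (count_list C x) x"
    using filter_pair_replicate[OF n(1), of x] filter_pair_replicate[OF n(2), of x] filter_pair_replicate[OF n(3), of x]
    by (simp add: D)
  have "count_list D x \<in> {0, 2}" using assms(1) count_list_0_iff[of D x] by (auto simp: dow_def)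
  then have "count_list A x + count_list B x + count_list C x \<in> {0, 2}"
    using D assms(6) by (simp add: add.assoc)
  moreover from this have "count_list A x \<in> {0, 1, 2}" "count_list B x \<in> {0, 1, 2}" "count_list C x \<in> {0, 1, 2}"
    by auto
  ultimately show ?thesis
    using assms(6) unfolding crosses_def f by (elim insertE emptyE) (simp_all add: numeral_2_eq_2)
qed

lemma dow_split:
  assumes "dow D" "v \<in> set D"
  obtains A B C where "D = A @ [v] @ B @ [v] @ C" "v \<notin> set A" "v \<notin> set B" "v \<notin> set C"
proof -
  have "count_list D v = 2" using assms by (simp add: dow_def)
  from count_list_2_split[OF this] show thesis using that by metis
qed

lemma rotate_split: "\<exists>A B. D = A @ B \<and> rotate n D = B @ A"
  using rotate_drop_take[of n D] append_take_drop_id[of "n mod length D" D, symmetric] by blast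

lemma dihedral_rot: "dihedral (A @ B) (B @ A)"
  unfolding dihedral_def using rotate_append by metis

lemma dihedral_refl [simp]: "dihedral D D"
  using dihedral_rot[of D "[]"] by simp

lemma dihedral_rev: "dihedral D (rev D)"
  unfolding dihedral_def by (intro exI[of _ 0]) simp

lemma dihedral_meq: "dihedral D E \<Longrightarrow> meq D E"
proof -
  have "meq D (rotate n D)" for n and D :: "'a list"
    using rotate_split[of D n] meq_rot by metis
  then show "dihedral D E \<Longrightarrow> meq D E"
    unfolding dihedral_def using meq_rev[of D] meq_trans by metis
qed

lemma rev_rotate_ex: "\<exists>m. rev (rotate n D) = rotate m (rev D)"
proof -
  obtain A B where "D = A @ B" "rotate n D = B @ A" using rotate_split by metis
  then show ?thesis using rotate_append[of "rev B" "rev A"] by (metis rev_append)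
qed

lemma dihedral_trans [trans]: "dihedral D E \<Longrightarrow> dihedral E F \<Longrightarrow> dihedral D F"
  unfolding dihedral_def by (metis rotate_rotate rev_rotate_ex rev_rev_ident)

lemma dihedral_sym: "dihedral D E \<Longrightarrow> dihedral E D"
proof -
  have r: "dihedral (rotate n D) D" for n and D :: "'a list"
    using rotate_split[of D n] dihedral_rot by metis
  assume "dihedral D E"
  then consider n where "E = rotate n D" | n where "E = rotate n (rev D)"
    unfolding dihedral_def by blast
  then show "dihedral E D"
  proof cases
    case 2
    then show ?thesis using r[of n "rev D"] dihedral_rev[of "rev D"] dihedral_trans by (metis rev_rev_ident)
  qed (use r in simp)
qed

lemma filter_append_split:
  "filter P D = A @ B \<Longrightarrow> \<exists>U V. D = U @ V \<and> filter P U = A \<and> filter P V = B"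
proof (induction D arbitrary: A)
  case (Cons x D)
  show ?case
  proof (cases A)
    case Nil
    then show ?thesis using Cons.prems by (intro exI[of _ "[]"] exI[of _ "x # D"]) simp
  next
    case (Cons a A')
    show ?thesis
    proof (cases "P x")
      case True
      with Cons Cons.prems have "a = x" "filter P D = A' @ B" by auto
      with Cons.IH[of A'] True Cons show ?thesis by (metis append_Cons filter.simps(2))
    next
      case False
      with Cons.prems Cons.IH[of A] show ?thesis by (metis append_Cons filter.simps(2))
    qed
  qed
qed simp

text \<open>A cut point of the shorter circle can also be chosen as a cut point of the larger one,
  so symmetries lift through a deletion.\<close>

lemma dihedral_filter:
  assumes "dihedral (filter P D) W"
  shows "\<exists>D'. dihedral D D' \<and> filter P D' = W"
proof -
  have rot: "\<exists>D'. dihedral D D' \<and> filter P D' = rotate n (filter P D)" for n and D :: "'a list"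
  proof -
    obtain A B where AB: "filter P D = A @ B" "rotate n (filter P D) = B @ A"
      using rotate_split by metis
    then obtain U V where "D = U @ V" "filter P U = A" "filter P V = B"
      using filter_append_split by blast
    then show ?thesis using AB dihedral_rot[of U V] by (metis filter_append)
  qed
  from assms consider n where "W = rotate n (filter P D)" | n where "W = rotate n (filter P (rev D))"
    unfolding dihedral_def rev_filter by blast
  then show ?thesis
  proof cases
    case 2
    then show ?thesis using rot[of "rev D" n] dihedral_rev[of D] dihedral_trans by metis
  qed (use rot[of D] in metis)
qed

section \<open>Reinserting a deleted chord\<close>

lemma dihedral_mset: "dihedral D E \<Longrightarrow> mset D = mset E"
  by (rule meq_mset[OF dihedral_meq])

text \<open>A common letter has at least one occurrence on each side and at most two in all, hence
  exactly one on each side. \<open>R\<close> takes up the letters outside \<open>P\<close> and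
  \<open>Q\<close>.\<close>

lemma closed_from_counts:
  assumes "dow D" "mset D = mset (P @ Q) + R"
    and "\<And>x. count_list P x = 1 \<Longrightarrow> count_list Q x = 1 \<Longrightarrow> False"
  shows "set P \<inter> set Q = {}"
proof (rule ccontr)
  assume "set P \<inter> set Q \<noteq> {}"
  then obtain x where x: "x \<in> set P" "x \<in> set Q" by blast
  have "count_list D x = count_list P x + count_list Q x + count R x"
    unfolding count_mset[symmetric] assms(2) by simp
  moreover have "x \<in> set D" using x assms(2) by (metis UnCI set_append set_mset_mset set_mset_union)
  ultimately have "count_list P x + count_list Q x \<le> 2" using assms(1) by (simp add: dow_def)
  moreover have "count_list P x \<noteq> 0" "count_list Q x \<noteq> 0" using x by (simp_all add: count_list_0_iff)
  ultimately show False using assms(3)[of x] by linarith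
qed

text \<open>Here the two positions of the chord \<open>v\<close> do not alternate. A chord with one
  end in \<open>P @ W\<close> and one in \<open>Q @ Y\<close> would cross \<open>v\<close> in
  exactly one of the two words, so \<open>P @ W\<close> is closed and can be mutated.\<close>

lemma reinsert_core1:
  assumes same: "same_graph ([v] @ (P @ Q @ W) @ [v] @ Y) (P @ [v] @ Q @ [v] @ W @ Y)"
    and v: "v \<notin> set (P @ Q @ W @ Y)"
  shows "set (P @ W) \<inter> set (Q @ Y) = {}"
    "meq ([v] @ (P @ Q @ W) @ [v] @ Y) (P @ [v] @ Q @ [v] @ W @ Y)"
proof -
  let ?D = "[v] @ (P @ Q @ W) @ [v] @ Y" and ?E = "P @ [v] @ Q @ [v] @ W @ Y"
  have D: "dow ?D" and E: "dow ?E" using same by (auto simp: same_graph_def)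
  have i: "count_list (P @ Q @ W) x = 1 \<longleftrightarrow> count_list Q x = 1" if "x \<noteq> v" for x
  proof -
    have "crosses ?D v x \<longleftrightarrow> count_list (P @ Q @ W) x = 1"
      using v that by (intro crosses_chord[OF D, of "[]"]) auto
    moreover have "crosses ?E v x \<longleftrightarrow> count_list Q x = 1"
      using v that by (intro crosses_chord[OF E, of P]) auto
    ultimately show ?thesis using same by (simp add: same_graph_def)
  qed
  show c: "set (P @ W) \<inter> set (Q @ Y) = {}"
  proof (rule closed_from_counts[OF D])
    show "mset ?D = mset ((P @ W) @ Q @ Y) + {#v, v#}" by simp
    fix x assume x: "count_list (P @ W) x = 1" "count_list (Q @ Y) x = 1"
    then have "x \<in> set (P @ W)" by (metis count_list_0_iff zero_neq_one)
    then have "x \<noteq> v" using v by auto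
    from i[OF this] x show False by auto
  qed
  \<comment> \<open>Reversing the share formed by \<open>P\<close>, \<open>W\<close> and
    \<open>v\<close>, and then \<open>P\<close> and \<open>W\<close> without \<open>v\<close>, moves
    both ends of \<open>v\<close> and leaves the rest in place.\<close>
  have "meq ([] @ (v # P) @ Q @ (W @ [v]) @ Y) ([] @ rev (v # P) @ Q @ rev (W @ [v]) @ Y)"
    using c v by (intro meq_rev_share) auto
  also have "[] @ rev (v # P) @ Q @ rev (W @ [v]) @ Y = [] @ rev P @ ([v] @ Q @ [v]) @ rev W @ Y" by simp
  also have "meq \<dots> ([] @ rev (rev P) @ ([v] @ Q @ [v]) @ rev (rev W) @ Y)"
    using c v by (intro meq_rev_share) auto
  finally show "meq ?D ?E" by simp
qed

text \<open>The same argument for alternating positions of \<open>v\<close>; the closed part is now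
  \<open>P @ R\<close>.\<close>

lemma reinsert_core2:
  assumes same: "same_graph ([v] @ (P @ Q) @ [v] @ R @ S) (P @ [v] @ (Q @ R) @ [v] @ S)"
    and v: "v \<notin> set (P @ Q @ R @ S)"
  shows "set (P @ R) \<inter> set (Q @ S) = {}"
    "meq ([v] @ (P @ Q) @ [v] @ R @ S) (P @ [v] @ (Q @ R) @ [v] @ S)"
proof -
  let ?D = "[v] @ (P @ Q) @ [v] @ R @ S" and ?E = "P @ [v] @ (Q @ R) @ [v] @ S"
  have D: "dow ?D" and E: "dow ?E" using same by (auto simp: same_graph_def)
  have i: "count_list (P @ Q) x = 1 \<longleftrightarrow> count_list (Q @ R) x = 1" if "x \<noteq> v" for x
  proof -
    have "crosses ?D v x \<longleftrightarrow> count_list (P @ Q) x = 1"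
      using v that by (intro crosses_chord[OF D, of "[]"]) auto
    moreover have "crosses ?E v x \<longleftrightarrow> count_list (Q @ R) x = 1"
      using v that by (intro crosses_chord[OF E, of P]) auto
    ultimately show ?thesis using same by (simp add: same_graph_def)
  qed
  show c: "set (P @ R) \<inter> set (Q @ S) = {}"
  proof (rule closed_from_counts[OF D])
    show "mset ?D = mset ((P @ R) @ Q @ S) + {#v, v#}" by simp
    fix x assume x: "count_list (P @ R) x = 1" "count_list (Q @ S) x = 1"
    then have "x \<in> set (P @ R)" by (metis count_list_0_iff zero_neq_one)
    then have "x \<noteq> v" using v by auto
    from i[OF this] x show False by (auto simp: add_is_1)
  qed
  have "meq ([] @ (v # P) @ Q @ (v # R) @ S) ([] @ rev (v # P) @ Q @ rev (v # R) @ S)"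
    using c v by (intro meq_rev_share) auto
  also have "[] @ rev (v # P) @ Q @ rev (v # R) @ S = [] @ rev P @ ([v] @ Q) @ rev R @ ([v] @ S)" by simp
  also have "meq \<dots> ([] @ rev (rev P) @ ([v] @ Q) @ rev (rev R) @ ([v] @ S))"
    using c v by (intro meq_rev_share) auto
  finally show "meq ?D ?E" by simp
qed

lemma reinsert_core:
  assumes same: "same_graph ([v] @ X @ [v] @ Y) (P @ [v] @ Q @ [v] @ R)"
    and eq: "P @ Q @ R = X @ Y" and v: "v \<notin> set (X @ Y)"
  shows "meq ([v] @ X @ [v] @ Y) (P @ [v] @ Q @ [v] @ R)"
proof -
  from eq consider B where "P = X @ B" "Y = B @ Q @ R" | B where "X = P @ B" "Q @ R = B @ Y"
    by (auto simp: append_eq_append_conv2)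
  then show ?thesis
  proof cases
    case 1
    have r: "meq ([v] @ (B @ Q @ R) @ [v] @ X) ([v] @ X @ [v] @ B @ Q @ R)"
      "meq (B @ [v] @ Q @ [v] @ R @ X) (X @ B @ [v] @ Q @ [v] @ R)"
      using meq_rot[of "[v] @ B @ Q @ R" "[v] @ X"] meq_rot[of "B @ [v] @ Q @ [v] @ R" X] by simp_all
    have s: "same_graph ([v] @ X @ [v] @ B @ Q @ R) (X @ B @ [v] @ Q @ [v] @ R)"
      using same 1 by simp
    have d: "dow ([v] @ (B @ Q @ R) @ [v] @ X)" "dow (B @ [v] @ Q @ [v] @ R @ X)"
      using s mset_dow[OF meq_mset[OF r(1)]] mset_dow[OF meq_mset[OF r(2)]] by (auto simp: same_graph_def)
    have "same_graph ([v] @ (B @ Q @ R) @ [v] @ X) (B @ [v] @ Q @ [v] @ R @ X)"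
      using meq_same_graph[OF d(1) r(1)] s same_graph_sym[OF meq_same_graph[OF d(2) r(2)]] same_graph_trans by blast
    from reinsert_core1(2)[OF this] have "meq ([v] @ (B @ Q @ R) @ [v] @ X) (B @ [v] @ Q @ [v] @ R @ X)"
      using v 1 by auto
    from meq_trans[OF meq_trans[OF meq_sym[OF r(1)] this] r(2)] show ?thesis using 1 by simp
  next
    case 2
    then consider C where "Q = B @ C" "Y = C @ R" | C where "B = Q @ C" "R = C @ Y"
      by (auto simp: append_eq_append_conv2)
    then show ?thesis
    proof cases
      case 1
      then show ?thesis using reinsert_core2(2)[of v P B C R] same v 2 by simp
    next
      case 2
      then show ?thesis using reinsert_core1(2)[of v P Q C Y] same v \<open>X = P @ B\<close> by simp
    qed
  qed
qed

text \<open>Without \<open>v\<close> both diagrams are the same circle, so they differ only in the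
  position of \<open>v\<close>; the chords crossed by \<open>v\<close> determine this position up to
  mutation.\<close>

lemma reinsert:
  assumes same: "same_graph D E" and v: "v \<in> set D"
    and dihedral: "dihedral (filter (\<lambda>x. x \<noteq> v) D) (filter (\<lambda>x. x \<noteq> v) E)"
  shows "meq D E"
proof -
  have dD: "dow D" and dE: "dow E" "v \<in> set E" using same v by (auto simp: same_graph_def)
  obtain A B C where D: "D = A @ [v] @ B @ [v] @ C" and n: "v \<notin> set A" "v \<notin> set B" "v \<notin> set C"
    using dow_split[OF dD v] by metis
  have fl: "filter (\<lambda>x. x \<noteq> v) Z = Z" if "v \<notin> set Z" for Z
    using that by (induction Z) auto
  have r: "meq D ([v] @ B @ [v] @ (C @ A))" unfolding D using meq_rot[of A "[v] @ B @ [v] @ C"] by simp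
  have "dihedral (filter (\<lambda>x. x \<noteq> v) E) (B @ C @ A)"
    using dihedral_sym[OF dihedral] dihedral_rot[of A "B @ C"] dihedral_trans n by (auto simp: D fl)
  from dihedral_filter[OF this] obtain E' where E': "dihedral E E'" "filter (\<lambda>x. x \<noteq> v) E' = B @ C @ A" by blast
  have "dow E'" "v \<in> set E'"
    using dE mset_dow[OF dihedral_mset[OF E'(1)]] mset_eq_setD[OF dihedral_mset[OF E'(1)]] by auto
  then obtain P Q R where E'': "E' = P @ [v] @ Q @ [v] @ R" and m: "v \<notin> set P" "v \<notin> set Q" "v \<notin> set R"
    using dow_split by metis
  have "same_graph D E'" using same meq_same_graph[OF dE(1) dihedral_meq[OF E'(1)]] same_graph_trans by blast
  then have "same_graph ([v] @ B @ [v] @ (C @ A)) (P @ [v] @ Q @ [v] @ R)"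
    using same_graph_trans[OF same_graph_sym[OF meq_same_graph[OF dD r]]] E'' by simp
  then have "meq ([v] @ B @ [v] @ (C @ A)) (P @ [v] @ Q @ [v] @ R)"
  proof (rule reinsert_core)
    show "P @ Q @ R = B @ C @ A" using E'(2) m by (simp add: E'' fl)
  qed (use n in auto)
  from meq_trans[OF meq_trans[OF r this[folded E'']] meq_sym[OF dihedral_meq[OF E'(1)]]] show ?thesis .
qed

section \<open>Cuts and connectivity\<close>

fun wt :: "('a \<Rightarrow> 'a \<Rightarrow> nat) \<Rightarrow> 'a list \<Rightarrow> nat" where
  "wt f (x # y # r) = f x y + wt f (y # r)"
| "wt f _ = 0"

definition cyc :: "('a \<Rightarrow> 'a \<Rightarrow> nat) \<Rightarrow> 'a list \<Rightarrow> nat" where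
  "cyc f D = wt f (D @ take 1 D)"

text \<open>Each arc occupied by endpoints of \<open>A\<close> has two boundaries, so for a proper
  nonempty set of letters the value 2 means one arc and the value 4 means two arcs, that is, a
  share.\<close>

definition cut :: "'a list \<Rightarrow> 'a set \<Rightarrow> nat" where
  "cut D A = cyc (\<lambda>x y. of_bool ((x \<in> A) \<noteq> (y \<in> A))) D"

lemma wt_append: "xs \<noteq> [] \<Longrightarrow> ys \<noteq> [] \<Longrightarrow> wt f (xs @ ys) = wt f xs + f (last xs) (hd ys) + wt f ys"
proof (induction xs)
  case (Cons x xs)
  then show ?case by (cases xs; cases ys) auto
qed simp

lemma wt_rev:
  assumes "\<And>x y. f x y = f y x"
  shows "wt f (rev xs) = wt f xs"
proof (induction xs)
  case (Cons x xs)
  show ?case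
  proof (cases xs)
    case (Cons y ys)
    then show ?thesis using Cons.IH wt_append[of "rev xs" "[x]" f] assms[of x y] by (simp add: last_rev)
  qed simp
qed simp

lemma cyc_eq: "D \<noteq> [] \<Longrightarrow> cyc f D = wt f D + f (last D) (hd D)"
  using wt_append[of D "[hd D]" f] by (cases D) (auto simp: cyc_def)

lemma cyc_append: "X \<noteq> [] \<Longrightarrow> Y \<noteq> [] \<Longrightarrow>
  cyc f (X @ Y) = wt f X + wt f Y + f (last X) (hd Y) + f (last Y) (hd X)"
  by (simp add: cyc_eq wt_append)

lemma cyc_rot: "cyc f (X @ Y) = cyc f (Y @ X)"
  by (cases "X = []"; cases "Y = []") (simp_all add: cyc_append)

lemma cyc_rev:
  assumes "\<And>x y. f x y = f y x"
  shows "cyc f (rev D) = cyc f D"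
  using assms by (cases "D = []") (simp_all add: cyc_eq wt_rev last_rev hd_rev)

lemma cyc_dihedral:
  assumes "dihedral D E" "\<And>x y. f x y = f y x"
  shows "cyc f E = cyc f D"
proof -
  have r: "cyc f (rotate n D) = cyc f D" for n D
    using rotate_split[of D n] cyc_rot[of f] by metis
  from assms(1) show ?thesis
    unfolding dihedral_def using r cyc_rev[of f D] assms(2) by metis
qed

lemma cut_dihedral: "dihedral D E \<Longrightarrow> cut E A = cut D A"
  unfolding cut_def by (rule cyc_dihedral) auto

lemma cut_rot: "cut (X @ Y) A = cut (Y @ X) A"
  unfolding cut_def by (rule cyc_rot)

lemma wt_cong:
  "(\<And>x y. x \<in> set xs \<Longrightarrow> y \<in> set xs \<Longrightarrow> f x y = g x y) \<Longrightarrow> wt f xs = wt g xs"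
  by (induction f xs rule: wt.induct) auto

lemma cyc_cong:
  assumes "\<And>x y. x \<in> set D \<Longrightarrow> y \<in> set D \<Longrightarrow> f x y = g x y"
  shows "cyc f D = cyc g D"
proof -
  have "set (D @ take 1 D) = set D" by (auto dest: in_set_takeD)
  then show ?thesis unfolding cyc_def using assms by (intro wt_cong) simp
qed

lemma cut_compl:
  assumes "B = set D - A"
  shows "cut D B = cut D A"
  unfolding cut_def by (rule cyc_cong) (auto simp: assms)

lemma wt_0: "(\<And>x y. x \<in> set xs \<Longrightarrow> y \<in> set xs \<Longrightarrow> f x y = 0) \<Longrightarrow> wt f xs = 0"
  by (induction f xs rule: wt.induct) auto

lemma wt_append_le:
  assumes "\<And>x y. f x y \<le> 1"
  shows "wt f (xs @ ys) \<le> wt f xs + 1 + wt f ys"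
  using assms wt_append[of xs ys f] by (cases "xs = []"; cases "ys = []") auto

lemma wt_cut_append_le:
  "wt (\<lambda>x y. of_bool ((x \<in> A) \<noteq> (y \<in> A))) (xs @ ys) \<le>
     wt (\<lambda>x y. of_bool ((x \<in> A) \<noteq> (y \<in> A))) xs + 1 + wt (\<lambda>x y. of_bool ((x \<in> A) \<noteq> (y \<in> A))) ys"
  by (rule wt_append_le) simp

lemma cut_four_blocks:
  assumes "set (P @ R) \<subseteq> A" "set (Q @ S) \<inter> A = {}"
  shows "cut (P @ Q @ R @ S) A \<le> 4"
proof -
  let ?f = "\<lambda>x y. of_bool ((x \<in> A) \<noteq> (y \<in> A)) :: nat"
  let ?h = "take 1 (P @ Q @ R @ S)"
  have z: "wt ?f P = 0" "wt ?f Q = 0" "wt ?f R = 0" "wt ?f S = 0"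
    using assms by (auto intro!: wt_0)
  have "wt ?f ?h = 0"
    by (cases "P @ Q @ R @ S") auto
  then have "wt ?f (P @ Q @ R @ S @ ?h) \<le> 4"
    using wt_cut_append_le[of A P "Q @ R @ S @ ?h"] wt_cut_append_le[of A Q "R @ S @ ?h"]
      wt_cut_append_le[of A R "S @ ?h"] wt_cut_append_le[of A S ?h] z by linarith
  then show ?thesis unfolding cut_def cyc_def append_assoc .
qed

lemma cut_two_blocks:
  assumes "set P \<subseteq> A" "set Q \<inter> A = {}"
  shows "cut (P @ Q) A \<le> 2"
proof -
  let ?f = "\<lambda>x y. of_bool ((x \<in> A) \<noteq> (y \<in> A)) :: nat"
  let ?h = "take 1 (P @ Q)"
  have z: "wt ?f P = 0" "wt ?f Q = 0"
    using assms by (auto intro!: wt_0)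
  have "wt ?f ?h = 0"
    by (cases "P @ Q") auto
  then have "wt ?f (P @ Q @ ?h) \<le> 2"
    using wt_cut_append_le[of A P "Q @ ?h"] wt_cut_append_le[of A Q ?h] z by linarith
  then show ?thesis unfolding cut_def cyc_def append_assoc .
qed

lemma even_cut: "even (cut D A)"
proof (cases "D = []")
  case False
  let ?f = "\<lambda>x y. of_bool ((x \<in> A) \<noteq> (y \<in> A)) :: nat"
  have "odd (wt ?f xs) \<longleftrightarrow> (hd xs \<in> A) \<noteq> (last xs \<in> A)" if "xs \<noteq> []" for xs
    using that by (induction ?f xs rule: wt.induct) auto
  from this[OF False] show ?thesis using False by (auto simp: cut_def cyc_eq)
qed (simp add: cut_def cyc_def)

lemma first_blocks:
  assumes "L \<noteq> []" "hd L \<in> A" "last L \<notin> A"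
  shows "\<exists>A1 B1 L'. L = A1 @ B1 @ L' \<and> A1 \<noteq> [] \<and> B1 \<noteq> [] \<and> set A1 \<subseteq> A \<and> set B1 \<inter> A = {} \<and>
    (L' = [] \<or> hd L' \<in> A \<and> last L' \<notin> A) \<and>
    wt (\<lambda>x y. of_bool ((x \<in> A) \<noteq> (y \<in> A))) L =
      (if L' = [] then 1 else 2 + wt (\<lambda>x y. of_bool ((x \<in> A) \<noteq> (y \<in> A))) L')"
proof -
  let ?f = "\<lambda>x y. of_bool ((x \<in> A) \<noteq> (y \<in> A)) :: nat"
  define A1 where "A1 = takeWhile (\<lambda>x. x \<in> A) L"
  define R where "R = dropWhile (\<lambda>x. x \<in> A) L"
  define B1 where "B1 = takeWhile (\<lambda>x. x \<notin> A) R"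
  define L' where "L' = dropWhile (\<lambda>x. x \<notin> A) R"
  have L: "L = A1 @ R" "R = B1 @ L'" by (simp_all add: A1_def R_def B1_def L'_def)
  have A1: "A1 \<noteq> []" "set A1 \<subseteq> A" using assms unfolding A1_def by (cases L; auto dest: set_takeWhileD)+
  have R: "R \<noteq> []"
    using assms L(1) A1 by (metis append_Nil2 last_in_set subsetD)
  then have hR: "hd R \<notin> A" unfolding R_def by (metis hd_dropWhile)
  then have B1: "B1 \<noteq> []" "set B1 \<inter> A = {}"
    using R unfolding B1_def by (cases R; auto dest: set_takeWhileD)+
  have L': "L' = [] \<or> hd L' \<in> A \<and> last L' \<notin> A"
    using assms(3) L hd_dropWhile[of "\<lambda>x. x \<notin> A" R] unfolding L'_def[symmetric] by auto
  have hl: "last A1 \<in> A" "hd B1 \<notin> A" "last B1 \<notin> A"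
    using A1 B1 by (auto dest: last_in_set hd_in_set)
  have z: "wt ?f A1 = 0" "wt ?f B1 = 0"
    using A1 B1 by (auto intro!: wt_0)
  have "wt ?f L = (if L' = [] then 1 else 2 + wt ?f L')"
    using wt_append[of A1 "B1 @ L'" ?f] wt_append[of B1 L' ?f] z A1 B1 hl L'
    unfolding L by (cases "L' = []") auto
  with L A1 B1 L' show ?thesis by blast
qed

lemma rot_boundary:
  assumes "x \<in> set D" "x \<in> A" "y \<in> set D" "y \<notin> A"
  shows "\<exists>E. dihedral D E \<and> E \<noteq> [] \<and> hd E \<in> A \<and> last E \<notin> A"
proof -
  obtain P Q where D: "D = P @ y # Q" using split_list[OF assms(3)] by blast
  have "\<exists>z\<in>set (Q @ P). z \<in> A" using assms D by auto
  then obtain R1 z R2 where R: "Q @ P = R1 @ z # R2" "z \<in> A" "\<forall>w\<in>set R1. w \<notin> A"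
    using split_list_first_prop[of "Q @ P" "\<lambda>z. z \<in> A"] by blast
  have "dihedral D (y # R1 @ z # R2)" using dihedral_rot[of P "y # Q"] D R by simp
  also have "dihedral (y # R1 @ z # R2) ((z # R2) @ y # R1)" using dihedral_rot[of "y # R1" "z # R2"] by simp
  finally have "dihedral D ((z # R2) @ y # R1)" .
  moreover have "last ((z # R2) @ y # R1) \<notin> A" using R assms last_in_set[of R1] by auto
  ultimately show ?thesis using R by (intro exI[of _ "(z # R2) @ y # R1"]) simp
qed

text \<open>The circle is cut at a boundary of \<open>A\<close>, and runs inside and outside
  \<open>A\<close> are peeled off in pairs, each pair accounting for two boundaries.\<close>

lemma blocks:
  assumes "x \<in> set D" "x \<in> A" "y \<in> set D" "y \<notin> A" "cut D A \<le> 4"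
  obtains A1 B1 A2 B2 where "dihedral D (A1 @ B1 @ A2 @ B2)" "A1 \<noteq> []" "B1 \<noteq> []"
    "set (A1 @ A2) \<subseteq> A" "set (B1 @ B2) \<inter> A = {}"
    "A2 = [] \<and> B2 = [] \<and> cut D A = 2 \<or> A2 \<noteq> [] \<and> B2 \<noteq> [] \<and> cut D A = 4"
proof -
  let ?f = "\<lambda>x y. of_bool ((x \<in> A) \<noteq> (y \<in> A)) :: nat"
  obtain E where E: "dihedral D E" "E \<noteq> []" "hd E \<in> A" "last E \<notin> A"
    using rot_boundary[OF assms(1-4)] by blast
  have cE: "cut D A = wt ?f E + 1"
    using cut_dihedral[OF E(1), of A] E(2-4) by (simp add: cut_def cyc_eq)
  obtain A1 B1 L where 1: "E = A1 @ B1 @ L" "A1 \<noteq> []" "B1 \<noteq> []" "set A1 \<subseteq> A" "set B1 \<inter> A = {}"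
     "L = [] \<or> hd L \<in> A \<and> last L \<notin> A" "wt ?f E = (if L = [] then 1 else 2 + wt ?f L)"
    using first_blocks[OF E(2-4)] by blast
  show thesis
  proof (cases "L = []")
    case True
    then show ?thesis using that[of A1 B1 "[]" "[]"] 1 E(1) cE by auto
  next
    case False
    then obtain A2 B2 L' where 2: "L = A2 @ B2 @ L'" "A2 \<noteq> []" "B2 \<noteq> []" "set A2 \<subseteq> A" "set B2 \<inter> A = {}"
     "L' = [] \<or> hd L' \<in> A \<and> last L' \<notin> A" "wt ?f L = (if L' = [] then 1 else 2 + wt ?f L')"
      using first_blocks[of L A] 1 by blast
    have "L' = []" using 2(7) 1(7) False cE assms(5) by (auto split: if_splits)
    then show ?thesis using that[of A1 B1 A2 B2] 1 2 E(1) cE False by auto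
  qed
qed

section \<open>Connected and disconnected intersection graphs\<close>

definition conn :: "'a list \<Rightarrow> bool" where
  "conn D = (\<forall>C. C \<subseteq> set D \<longrightarrow> C \<noteq> {} \<longrightarrow> C \<noteq> set D \<longrightarrow> (\<exists>x\<in>C. \<exists>y\<in>set D - C. crosses D x y))"

lemma same_graph_conn: "same_graph D E \<Longrightarrow> conn D = conn E"
  by (simp add: same_graph_def conn_def)

lemma conn_dihedral:
  assumes "dihedral D E"
  shows "conn D = conn E"
  using crosses_meq[OF dihedral_meq[OF assms]] mset_eq_setD[OF dihedral_mset[OF assms]]
  by (simp add: conn_def)

lemma crosses_append_closed:
  assumes "set X \<inter> set Y = {}" "x \<in> set X" "y \<in> set Y"
  shows "\<not> crosses (X @ Y) x y"
proof
  let ?P = "\<lambda>z. z = x \<or> z = y"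
  assume "crosses (X @ Y) x y"
  then have i: "filter ?P X @ filter ?P Y \<in> {[x, y, x, y], [y, x, y, x]}" by (simp add: crosses_def)
  have "x \<in> set (filter ?P X)" "y \<notin> set (filter ?P X)" "y \<in> set (filter ?P Y)" "x \<notin> set (filter ?P Y)"
    using assms by auto
  moreover have "x \<noteq> y" using assms by auto
  ultimately show False using i by (auto simp: append_eq_Cons_conv simp del: set_filter)
qed

lemma closed_not_conn:
  assumes "dihedral D (X @ Y)" "set X \<inter> set Y = {}" "X \<noteq> []" "Y \<noteq> []"
  shows "\<not> conn D"
proof
  assume "conn D"
  then have "conn (X @ Y)" using conn_dihedral[OF assms(1)] by simp
  moreover have "hd Y \<in> set (X @ Y)" "hd Y \<notin> set X" using assms(2,4) hd_in_set[of Y] by auto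
  then have "set X \<noteq> set (X @ Y)" by blast
  moreover have "set X \<subseteq> set (X @ Y)" "set X \<noteq> {}" using assms(3) by auto
  ultimately obtain x y where xy: "x \<in> set X" "y \<in> set (X @ Y) - set X" "crosses (X @ Y) x y"
    unfolding conn_def by blast
  then show False using crosses_append_closed[OF assms(2), of x y] by auto
qed

text \<open>If \<open>A\<close> filled a single arc, this arc would be closed under chords, against
  connectedness; hence there are exactly two arcs.\<close>

lemma conn_blocks:
  assumes "conn D" "x \<in> set D" "x \<in> A" "y \<in> set D" "y \<notin> A" "cut D A \<le> 4"
  obtains A1 B1 A2 B2 where "dihedral D (A1 @ B1 @ A2 @ B2)" "A1 \<noteq> []" "B1 \<noteq> []" "A2 \<noteq> []" "B2 \<noteq> []"
    "set (A1 @ A2) \<subseteq> A" "set (B1 @ B2) \<inter> A = {}" "cut D A = 4"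
proof -
  obtain A1 B1 A2 B2 where b: "dihedral D (A1 @ B1 @ A2 @ B2)" "A1 \<noteq> []" "B1 \<noteq> []"
    "set (A1 @ A2) \<subseteq> A" "set (B1 @ B2) \<inter> A = {}"
    "A2 = [] \<and> B2 = [] \<and> cut D A = 2 \<or> A2 \<noteq> [] \<and> B2 \<noteq> [] \<and> cut D A = 4"
    by (rule blocks[OF assms(2-6)])
  have "set A1 \<inter> set B1 = {}" using b(4,5) by auto
  then have "\<not> (A2 = [] \<and> B2 = [])"
    using closed_not_conn[of D A1 B1] assms(1) b(1-3) by auto
  with b that show thesis by blast
qed

lemma conn_cut:
  assumes "conn D" "A \<subseteq> set D" "A \<noteq> {}" "A \<noteq> set D"
  shows "cut D A \<ge> 4"
proof (rule ccontr)
  assume "\<not> cut D A \<ge> 4"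
  moreover obtain x y where "x \<in> set D" "x \<in> A" "y \<in> set D" "y \<notin> A" using assms by auto
  ultimately show False using conn_blocks[OF assms(1), of x A y] by (metis nat_le_linear)
qed

lemma mutation_prefix: "mutation D E \<Longrightarrow> set J \<inter> set D = {} \<Longrightarrow> mutation (J @ D) (J @ E)"
proof (induction rule: mutation.induct)
  case (mutationI s t u0 u1 u2)
  then show ?case using mutation.mutationI[of s t "J @ u0" u1 u2] by auto
qed

lemma meq_prefix:
  assumes "meq D E" "set J \<inter> set D = {}"
  shows "meq (J @ D) (J @ E)"
  using assms(1) unfolding meq_def
proof (induction rule: rtranclp_induct)
  case (step E F)
  have "set E = set D" using step(1) meq_mset mset_eq_setD unfolding meq_def by metis
  with step assms(2) show ?case using mutation_prefix[of E F J] by auto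
qed simp

lemma meq_append:
  assumes "meq K K'" "meq L L'" "set K \<inter> set L = {}"
  shows "meq (K @ L) (K' @ L')"
proof -
  have s: "set K = set K'" using assms meq_mset mset_eq_setD by metis
  have "meq (K @ L) (K @ L')" using assms by (intro meq_prefix) auto
  also have "meq \<dots> (L' @ K)" by (rule meq_rot)
  also have "meq \<dots> (L' @ K')"
    using assms mset_eq_setD[OF meq_mset[OF assms(2)]] by (intro meq_prefix) auto
  also have "meq \<dots> (K' @ L')" by (rule meq_rot)
  finally show ?thesis .
qed

definition noncross :: "'a list \<Rightarrow> 'a set \<Rightarrow> bool" where
  "noncross D C = (\<forall>x\<in>set D. \<forall>y\<in>set D. x \<in> C \<longrightarrow> y \<notin> C \<longrightarrow> \<not> crosses D x y)"

text \<open>If no chord encloses a letter of the other side, the first run is closed. Otherwise a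
  shortest segment between the ends of a chord \<open>z\<close> that contains a letter of the other
  side also contains a closed run: its chords cannot leave the segment, as they do not cross
  \<open>z\<close>, and cannot return after an interruption, by minimality.\<close>

lemma closed_run:
  assumes D: "dow D" and nc: "noncross D C" and "x \<in> set D" "x \<in> C" "y \<in> set D" "y \<notin> C"
  shows "\<exists>X J Y. D = X @ J @ Y \<and> J \<noteq> [] \<and> set J \<inter> set (X @ Y) = {} \<and> (set J \<subseteq> C \<or> set J \<inter> C = {})"
proof -
  define bad where "bad Q = (\<exists>P z R w. D = P @ [z] @ Q @ [z] @ R \<and> w \<in> set Q \<and> (w \<in> C) \<noteq> (z \<in> C))" for Q
  show ?thesis
  proof (cases "\<exists>Q. bad Q")
    case False
    define same where "same z = ((z \<in> C) = (hd D \<in> C))" for z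
    let ?J = "takeWhile same D" and ?Y = "dropWhile same D"
    have ne: "D \<noteq> []" using assms by auto
    have J: "?J \<noteq> []" "\<And>z. z \<in> set ?J \<Longrightarrow> same z"
      using ne by (cases D; auto simp: same_def dest: set_takeWhileD)+
    have "\<not> same x \<or> \<not> same y" using assms by (auto simp: same_def)
    then have Y: "?Y \<noteq> []" using assms by (auto simp: dropWhile_eq_Nil_conv)
    then obtain h Y' where hY: "?Y = h # Y'" "\<not> same h"
      by (metis hd_dropWhile list.collapse)
    have "set ?J \<inter> set ?Y = {}"
    proof (rule ccontr)
      assume "set ?J \<inter> set ?Y \<noteq> {}"
      then obtain z where z: "z \<in> set ?J" "z \<in> set ?Y" by blast
      then have "z \<in> set Y'" using hY J(2)[of z] by auto
      then obtain Y1 Y2 where Y12: "Y' = Y1 @ z # Y2" using split_list by metis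
      obtain J1 J2 where J12: "?J = J1 @ z # J2" using split_list[OF z(1)] by blast
      have "D = ?J @ ?Y" by simp
      also have "\<dots> = J1 @ [z] @ (J2 @ h # Y1) @ [z] @ Y2" using J12 hY(1) Y12 by simp
      finally have "bad (J2 @ h # Y1)"
        using hY(2) J(2)[OF z(1)] unfolding bad_def same_def by (intro exI[of _ J1] exI[of _ z] exI[of _ Y2] exI[of _ h]) auto
      then show False using False by blast
    qed
    moreover have "D = [] @ ?J @ ?Y" by simp
    moreover have "set ?J \<subseteq> C \<or> set ?J \<inter> C = {}" using J(2) unfolding same_def by blast
    ultimately show ?thesis using J(1) by (metis append_Nil)
  next
    case True
    then obtain Q where Q: "bad Q" "\<And>Q'. bad Q' \<Longrightarrow> length Q \<le> length Q'"
      using ex_has_least_nat[of bad _ length] by metis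
    then obtain P z R w where D': "D = P @ [z] @ Q @ [z] @ R" and w: "w \<in> set Q" "(w \<in> C) \<noteq> (z \<in> C)"
      unfolding bad_def by blast
    define same where "same u = ((u \<in> C) = (w \<in> C))" for u
    obtain Q1 h Q' where Q1: "Q = Q1 @ h # Q'" "same h" "\<forall>u\<in>set Q1. \<not> same u"
      using split_list_first_prop[of Q same] w(1) unfolding same_def by blast
    let ?J = "takeWhile same (h # Q')" and ?Q3 = "dropWhile same (h # Q')"
    have QJ: "Q = Q1 @ ?J @ ?Q3" using Q1(1) by simp
    have Jne: "?J \<noteq> []" using Q1(2) by simp
    have Js: "same u" if "u \<in> set ?J" for u using that set_takeWhileD by metis
    have cz: "count_list D z = 2" using D D' by (simp add: dow_def)
    then have zn: "z \<notin> set P" "z \<notin> set Q" "z \<notin> set R" unfolding D' by (auto simp: count_list_0_iff)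
    have "u \<notin> set ((P @ [z] @ Q1) @ (?Q3 @ [z] @ R))" if u: "u \<in> set ?J" for u
    proof
      assume u': "u \<in> set ((P @ [z] @ Q1) @ (?Q3 @ [z] @ R))"
      have uQ: "u \<in> set Q" using set_takeWhileD[OF u] Q1(1) by auto
      have uz: "u \<noteq> z" using uQ zn by auto
      have "u \<in> set D" "z \<in> set D" using uQ D' by auto
      moreover have "(u \<in> C) \<noteq> (z \<in> C)" using Js[OF u] w(2) by (auto simp: same_def)
      ultimately have "\<not> crosses D z u" using nc crosses_commute[of D] unfolding noncross_def by metis
      then have "count_list Q u \<noteq> 1" using crosses_chord[OF D D' zn uz] by simp
      moreover have "count_list Q u \<noteq> 0" using uQ by (simp add: count_list_0_iff)
      moreover have "count_list D u = 2" using D \<open>u \<in> set D\<close> by (simp add: dow_def)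
      ultimately have "count_list P u = 0" "count_list R u = 0" unfolding D' using uz by auto
      then have "u \<notin> set P" "u \<notin> set R" by (simp_all add: count_list_0_iff)
      moreover have "u \<notin> set Q1" using Q1(3) Js[OF u] by auto
      ultimately have "u \<in> set ?Q3" using u' uz by auto
      then have ne: "?Q3 \<noteq> []" by (metis empty_iff list.set(1))
      then obtain k Q4 where k: "?Q3 = k # Q4" "\<not> same k" by (metis hd_dropWhile list.collapse)
      then have "u \<in> set Q4" using \<open>u \<in> set ?Q3\<close> Js[OF u] by auto
      then obtain Q5 Q6 where Q5: "Q4 = Q5 @ u # Q6" using split_list by metis
      obtain J1 J2 where J12: "?J = J1 @ u # J2" using split_list[OF u] by blast
      have Q': "Q = Q1 @ (J1 @ u # J2) @ k # Q5 @ u # Q6" using QJ J12 k(1) Q5 by metis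
      then have "D = (P @ [z] @ Q1 @ J1) @ [u] @ (J2 @ k # Q5) @ [u] @ (Q6 @ [z] @ R)" using D' by simp
      then have "bad (J2 @ k # Q5)"
        using k(2) Js[OF u] unfolding bad_def same_def by (metis in_set_conv_decomp)
      from Q(2)[OF this] show False using Q' by simp
    qed
    then have "set ?J \<inter> set ((P @ [z] @ Q1) @ (?Q3 @ [z] @ R)) = {}" by blast
    moreover have "D = (P @ [z] @ Q1) @ ?J @ (?Q3 @ [z] @ R)"
      using D' QJ by (metis append.assoc)
    moreover have "set ?J \<subseteq> C \<or> set ?J \<inter> C = {}" using Js unfolding same_def by blast
    ultimately show ?thesis using Jne by blast
  qed
qed

text \<open>Closed runs are removed one at a time, and each is put back at the front or at the back
  according to its side.\<close>

lemma noncross_split: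
  assumes "dow D" "noncross D C"
  shows "\<exists>K L. meq D (K @ L) \<and> set K \<subseteq> C \<and> set L \<inter> C = {}"
  using assms
proof (induction "length D" arbitrary: D rule: less_induct)
  case less
  show ?case
  proof (cases "set D \<subseteq> C \<or> set D \<inter> C = {}")
    case True
    then show ?thesis
    proof
      assume "set D \<subseteq> C"
      then show ?thesis by (intro exI[of _ D] exI[of _ "[]"]) simp
    next
      assume "set D \<inter> C = {}"
      then show ?thesis by (intro exI[of _ "[]"] exI[of _ D]) simp
    qed
  next
    case False
    then obtain x y where "x \<in> set D" "x \<in> C" "y \<in> set D" "y \<notin> C" by blast
    from closed_run[OF less.prems this] obtain X J Y where
      J: "D = X @ J @ Y" "J \<noteq> []" "set J \<inter> set (X @ Y) = {}" "set J \<subseteq> C \<or> set J \<inter> C = {}" by blast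
    have "filter (\<lambda>u. u \<notin> set J) J = []" by (simp add: filter_empty_conv)
    moreover have "filter (\<lambda>u. u \<notin> set J) (X @ Y) = X @ Y" using J(3) by (intro filter_True) auto
    ultimately have XY: "X @ Y = filter (\<lambda>u. u \<notin> set J) D" unfolding J(1) by simp
    have "dow (X @ Y)" unfolding XY using less.prems(1) by (rule dow_filter)
    moreover have "noncross (X @ Y) C"
      using less.prems(2) crosses_filter[of "\<lambda>u. u \<notin> set J" _ _ D] unfolding noncross_def XY by auto
    moreover have "length (X @ Y) < length D" using J by simp
    ultimately obtain K L where KL: "meq (X @ Y) (K @ L)" "set K \<subseteq> C" "set L \<inter> C = {}"
      using less.hyps by blast
    have sKL: "set (K @ L) = set (X @ Y)" using mset_eq_setD[OF meq_mset[OF KL(1)]] by simp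
    have "meq D (J @ Y @ X)" using meq_rot[of X "J @ Y"] J(1) by simp
    \<comment> \<open>With \<open>J\<close> in front, the remaining word can be rotated by itself;
      this slides the closed run along the circle.\<close>
    also have "meq \<dots> (J @ X @ Y)" using J(3) by (intro meq_prefix meq_rot) auto
    also have "meq \<dots> (J @ K @ L)" using J(3) KL by (intro meq_prefix) auto
    finally have 1: "meq D ((J @ K) @ L)" by simp
    also have "meq \<dots> (K @ L @ J)" using meq_rot[of J "K @ L"] by simp
    finally have 2: "meq D (K @ L @ J)" .
    show ?thesis
      using J(4)
    proof
      assume "set J \<subseteq> C"
      then show ?thesis using 1 KL by (intro exI[of _ "J @ K"] exI[of _ L]) auto
    next
      assume "set J \<inter> C = {}"
      then show ?thesis using 2 KL by (intro exI[of _ K] exI[of _ "L @ J"]) auto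
    qed
  qed
qed

text \<open>Viewed as a closed Euler trail, a word gives a \<open>4\<close>-regular multigraph on its letters in which
  \<open>cut D A\<close> is the size of an edge cut; tightness says that the nontrivial cuts have at least
  six edges.\<close>

definition tight :: "'a list \<Rightarrow> bool" where
  "tight D = (dow D \<and> (\<forall>A. A \<subseteq> set D \<longrightarrow> A \<noteq> {} \<longrightarrow> A \<noteq> set D \<longrightarrow> cut D A \<ge> 4) \<and>
     (\<forall>A. A \<subseteq> set D \<longrightarrow> card A \<ge> 2 \<longrightarrow> card (set D - A) \<ge> 2 \<longrightarrow> cut D A \<ge> 6))"

lemma tightD1: "tight D \<Longrightarrow> A \<subseteq> set D \<Longrightarrow> A \<noteq> {} \<Longrightarrow> A \<noteq> set D \<Longrightarrow> 4 \<le> cut D A"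
  by (simp add: tight_def)

lemma tightD2: "tight D \<Longrightarrow> A \<subseteq> set D \<Longrightarrow> 2 \<le> card A \<Longrightarrow> 2 \<le> card (set D - A) \<Longrightarrow> 6 \<le> cut D A"
  by (simp add: tight_def)

lemma tight_dihedral:
  assumes "dihedral D E" "tight D"
  shows "tight E"
  using assms(2) cut_dihedral[OF assms(1)] mset_eq_setD[OF dihedral_mset[OF assms(1)]] mset_dow[OF dihedral_mset[OF assms(1)]]
  unfolding tight_def by simp

lemma dihedral_same_graph: "dow D \<Longrightarrow> dihedral D E \<Longrightarrow> same_graph D E"
  by (rule meq_same_graph[OF _ dihedral_meq])

section \<open>Mutations of tight diagrams\<close>

lemma rev_const: "set s \<subseteq> {x} \<Longrightarrow> rev s = s"
proof -
  assume "set s \<subseteq> {x}"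
  then have "s = replicate (length s) x" by (intro replicate_eqI) auto
  then show ?thesis by (metis rev_replicate)
qed

lemma card_le_1_subset:
  assumes "finite A" "card A < 2"
  obtains x where "A \<subseteq> {x}"
proof -
  have "A = {} \<or> (\<exists>x. A = {x})" using assms by (auto simp: less_2_cases_iff card_1_singleton_iff)
  then show thesis using that by blast
qed

text \<open>A share fills at most two arcs, so tightness leaves at most one chord in the share or at
  most one outside. In the first case the reversal does nothing; in the second it amounts to a
  reflection of the circle.\<close>

lemma tight_mutation_dihedral:
  assumes t: "tight D" and m: "mutation D E"
  shows "dihedral D E"
  using m
proof cases
  case (mutationI s t u0 u1 u2)
  let ?S = "set (s @ t)" and ?U = "set (u0 @ u1 @ u2)"
  have D: "dow D" using t by (simp add: tight_def)
  have r: "dihedral D (s @ u1 @ t @ (u2 @ u0))" using dihedral_rot[of u0 "s @ u1 @ t @ u2"] mutationI by simp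
  have "cut (s @ u1 @ t @ (u2 @ u0)) ?S \<le> 4"
    using mutationI(3) by (intro cut_four_blocks) auto
  then have c4: "cut D ?S \<le> 4" using cut_dihedral[OF r] by simp
  have U: "set D - ?S = ?U" "?S \<subseteq> set D" using mutationI by auto
  have "\<not> (card ?S \<ge> 2 \<and> card ?U \<ge> 2)"
    using tightD2[OF t U(2), unfolded U(1)] c4 by linarith
  then consider "card ?S < 2" | "card ?U < 2" by linarith
  then show ?thesis
  proof cases
    case 1
    then obtain x where "?S \<subseteq> {x}" using card_le_1_subset[of ?S] by auto
    then have "rev s = s" "rev t = t" using rev_const[of s x] rev_const[of t x] by auto
    then show ?thesis using mutationI by simp
  next
    case 2
    then obtain x where x: "?U \<subseteq> {x}" using card_le_1_subset[of ?U] by auto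
    have rE: "dihedral E (rev s @ u1 @ rev t @ (u2 @ u0))"
      using dihedral_rot[of u0 "rev s @ u1 @ rev t @ u2"] mutationI by simp
    have ru: "rev u1 = u1" "rev (u2 @ u0) = u2 @ u0"
      using x rev_const[of u1 x] rev_const[of "u2 @ u0" x] by auto
    have "dihedral (rev s @ u1 @ rev t @ (u2 @ u0)) (rev (rev s @ u1 @ rev t @ (u2 @ u0)))" by (rule dihedral_rev)
    also have "rev (rev s @ u1 @ rev t @ (u2 @ u0)) = (u2 @ u0) @ t @ u1 @ s" using ru by simp
    also have "dihedral \<dots> (s @ (u2 @ u0) @ t @ u1)" using dihedral_rot[of "(u2 @ u0) @ t @ u1" s] by simp
    finally have rE': "dihedral E (s @ (u2 @ u0) @ t @ u1)" using rE dihedral_trans by blast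
    show ?thesis
    proof (cases "u1 = u2 @ u0")
      case True
      then have "dihedral D (s @ (u2 @ u0) @ t @ u1)" using r by simp
      from dihedral_trans[OF this dihedral_sym[OF rE']] show ?thesis .
    next
      case False
      then have xU: "x \<in> ?U" using x by (cases u1; cases u0; cases u2) auto
      then have xD: "x \<in> set D" using mutationI(1) by auto
      have "x \<notin> ?S" using xU mutationI(3) by blast
      then have "count_list s x = 0" "count_list t x = 0" by (simp_all add: count_list_0_iff)
      moreover have "count_list D x = 2" using D xD by (simp add: dow_def)
      ultimately have cx: "count_list u1 x + count_list (u2 @ u0) x = 2"
        using mutationI(1) by simp
      have rep: "u = replicate (length u) x" "count_list u x = length u" if "set u \<subseteq> {x}" for u
      proof -
        show *: "u = replicate (length u) x" using that by (intro replicate_eqI) auto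
        show "count_list u x = length u" using that by (induction u) auto
      qed
      have su: "set u1 \<subseteq> {x}" "set (u2 @ u0) \<subseteq> {x}" using x by auto
      have "length u1 \<noteq> length (u2 @ u0)" using False rep(1)[OF su(1)] rep(1)[OF su(2)] by metis
      moreover have "length u1 + length (u2 @ u0) = 2" using cx rep(2)[OF su(1)] rep(2)[OF su(2)] by simp
      ultimately have "length u1 = 0 \<or> length (u2 @ u0) = 0" by linarith
      then have e: "u1 = [] \<or> u2 @ u0 = []" by simp
      show ?thesis
      proof (cases "?S = {}")
        case True
        then show ?thesis using mutationI by simp
      next
        case False
        \<comment> \<open>Both ends of \<open>x\<close> lie in the same gap between the strands, so
          the share fills a single arc.\<close>
        have "cut D ?S \<le> 2"
        proof (cases "u1 = []")
          case True
          then have "dihedral D ((s @ t) @ (u2 @ u0))" using r by simp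
          from cut_dihedral[OF this] show ?thesis using cut_two_blocks[of "s @ t" ?S "u2 @ u0"] mutationI(3) by auto
        next
          case False
          then have "dihedral D (s @ u1 @ t)" using r e by simp
          then have "dihedral D ((t @ s) @ u1)" using dihedral_rot[of "s @ u1" t] dihedral_trans by fastforce
          from cut_dihedral[OF this] show ?thesis using cut_two_blocks[of "t @ s" ?S "u1"] mutationI(3) by auto
        qed
        moreover have "?S \<noteq> set D" using xD \<open>x \<notin> ?S\<close> by blast
        ultimately show ?thesis using tightD1[OF t U(2) False] by linarith
      qed
    qed
  qed
qed

lemma tight_meq_dihedral:
  assumes "tight D" "meq D E"
  shows "dihedral D E"
  using assms(2) unfolding meq_def
proof (induction rule: rtranclp_induct)
  case (step E F)
  then show ?case using tight_mutation_dihedral[of E F] tight_dihedral[of D E] assms(1) dihedral_trans by blast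
qed simp

lemma dihedral_filter_both:
  assumes "dihedral D E"
  shows "dihedral (filter P D) (filter P E)"
proof -
  have r: "dihedral (filter P D) (filter P (rotate n D))" for n D
  proof -
    obtain A B where "D = A @ B" "rotate n D = B @ A" using rotate_split by metis
    then show ?thesis using dihedral_rot[of "filter P A" "filter P B"] by (simp only: filter_append)
  qed
  from assms consider n where "E = rotate n D" | n where "E = rotate n (rev D)"
    unfolding dihedral_def by blast
  then show ?thesis
  proof cases
    case 2
    have "dihedral (filter P D) (filter P (rev D))" using dihedral_rev[of "filter P D"] by (simp add: rev_filter)
    then show ?thesis using 2 r[of "rev D" n] dihedral_trans by metis
  qed (use r in metis)
qed

section \<open>Disconnected graphs, and pairs of chords on two arcs\<close>

lemma filter_blocks:
  assumes "set K \<subseteq> C" "set L \<inter> C = {}"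
  shows "filter (\<lambda>x. x \<in> C) (K @ L) = K" "filter (\<lambda>x. x \<notin> C) (K @ L) = L"
proof -
  have "filter (\<lambda>x. x \<in> C) K = K" "filter (\<lambda>x. x \<notin> C) K = []"
    "filter (\<lambda>x. x \<in> C) L = []" "filter (\<lambda>x. x \<notin> C) L = L"
    using assms by (auto intro!: filter_True filter_False)
  then show "filter (\<lambda>x. x \<in> C) (K @ L) = K" "filter (\<lambda>x. x \<notin> C) (K @ L) = L" by simp_all
qed

text \<open>Both diagrams are split up to mutation along the same union of components; the two parts
  are shorter and are compared by induction.\<close>

lemma not_conn_meq:
  fixes D E :: "'a list"
  assumes IH: "\<And>D' E' :: 'a list. length D' < length D \<Longrightarrow> same_graph D' E' \<Longrightarrow> meq D' E'"
    and same: "same_graph D E" and "\<not> conn D"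
  shows "meq D E"
proof -
  have d: "dow D" "dow E" "set D = set E" and i: "\<And>x y. crosses D x y = crosses E x y"
    using same by (auto simp: same_graph_def)
  obtain C where C: "C \<subseteq> set D" "C \<noteq> {}" "C \<noteq> set D" "\<And>x y. x \<in> C \<Longrightarrow> y \<in> set D - C \<Longrightarrow> \<not> crosses D x y"
    using assms(3) unfolding conn_def by blast
  have "noncross D C" "noncross E C" using C(4) i d(3) by (auto simp: noncross_def)
  then obtain K L K' L' where KL: "meq D (K @ L)" "set K \<subseteq> C" "set L \<inter> C = {}"
    and KL': "meq E (K' @ L')" "set K' \<subseteq> C" "set L' \<inter> C = {}"
    using noncross_split[OF d(1)] noncross_split[OF d(2)] by metis
  have s: "same_graph (K @ L) (K' @ L')"
    using same_graph_trans[OF same_graph_sym[OF meq_same_graph[OF d(1) KL(1)]]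
      same_graph_trans[OF same meq_same_graph[OF d(2) KL'(1)]]] .
  have fK: "filter (\<lambda>x. x \<in> C) (K @ L) = K" "filter (\<lambda>x. x \<in> C) (K' @ L') = K'"
    and fL: "filter (\<lambda>x. x \<notin> C) (K @ L) = L" "filter (\<lambda>x. x \<notin> C) (K' @ L') = L'"
    using filter_blocks[OF KL(2,3)] filter_blocks[OF KL'(2,3)] by simp_all
  have len: "length D = length K + length L" using meq_mset[OF KL(1)] by (metis length_append mset_eq_length)
  have setKL: "set K \<union> set L = set D" using mset_eq_setD[OF meq_mset[OF KL(1)]] by simp
  have "K \<noteq> []" "L \<noteq> []" using C KL setKL by auto
  then have "meq K K'" "meq L L'"
    using IH[of K K'] IH[of L L'] same_graph_filter[OF s, of "\<lambda>x. x \<in> C"] same_graph_filter[OF s, of "\<lambda>x. x \<notin> C"]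
    unfolding fK fL by (auto simp: len)
  then have "meq (K @ L) (K' @ L')" using KL(2,3) by (intro meq_append) auto
  then show ?thesis using KL(1) KL'(1) meq_trans meq_sym by blast
qed

text \<open>Were both ends of \<open>x\<close> on one strand, only chords of the share would lie
  between them, and \<open>x\<close> would cross nothing outside.\<close>

lemma crossing_bridge:
  assumes "dow (A1 @ B1 @ A2 @ B2)" "set (A1 @ A2) \<inter> set (B1 @ B2) = {}"
    and x: "x \<in> set (A1 @ A2)" and y: "y \<in> set (B1 @ B2)" and i: "crosses (A1 @ B1 @ A2 @ B2) x y"
  shows "count_list A1 x = 1" "count_list A2 x = 1"
proof -
  let ?D = "A1 @ B1 @ A2 @ B2"
  have c: "count_list ?D x = 2" using assms(1) x unfolding dow_def by auto
  have "x \<notin> set B1" "x \<notin> set B2" using x assms(2) by auto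
  then have z: "count_list B1 x = 0" "count_list B2 x = 0" by (simp_all add: count_list_0_iff)
  have c2: "count_list A1 x + count_list A2 x = 2" using c z by simp
  have yA: "y \<notin> set A1" "y \<notin> set A2" "y \<noteq> x" using assms(2) x y by auto
  have "count_list A1 x \<noteq> 2"
  proof
    assume a: "count_list A1 x = 2"
    obtain p q r where p: "A1 = p @ [x] @ q @ [x] @ r" "x \<notin> set p" "x \<notin> set q" "x \<notin> set r"
      by (rule count_list_2_split[OF a])
    have "x \<notin> set A2" using c2 a by (simp add: count_list_0_iff)
    then have "crosses ?D x y \<longleftrightarrow> count_list q y = 1"
      using p \<open>x \<notin> set B1\<close> \<open>x \<notin> set B2\<close> yA by (intro crosses_chord[OF assms(1), of p x q "r @ B1 @ A2 @ B2"]) auto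
    moreover have "count_list q y = 0" using yA p by (auto simp: count_list_0_iff)
    ultimately show False using i by simp
  qed
  moreover have "count_list A2 x \<noteq> 2"
  proof
    assume a: "count_list A2 x = 2"
    obtain p q r where p: "A2 = p @ [x] @ q @ [x] @ r" "x \<notin> set p" "x \<notin> set q" "x \<notin> set r"
      by (rule count_list_2_split[OF a])
    have "x \<notin> set A1" using c2 a by (simp add: count_list_0_iff)
    then have "crosses ?D x y \<longleftrightarrow> count_list q y = 1"
      using p \<open>x \<notin> set B1\<close> \<open>x \<notin> set B2\<close> yA by (intro crosses_chord[OF assms(1), of "A1 @ B1 @ p" x q "r @ B2"]) auto
    moreover have "count_list q y = 0" using yA p by (auto simp: count_list_0_iff)
    ultimately show False using i by simp
  qed
  ultimately show "count_list A1 x = 1" "count_list A2 x = 1" using c2 by linarith+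
qed

lemma filter_single:
  assumes "count_list L a = 1" "\<And>z. z \<in> set L \<Longrightarrow> P z \<longleftrightarrow> z = a"
  shows "filter P L = [a]"
proof -
  obtain p q where "L = p @ [a] @ q" "a \<notin> set p" "a \<notin> set q" by (rule count_list_1_split[OF assms(1)])
  moreover from this have "filter P p = []" "filter P q = []"
    using assms(2) by (auto simp: filter_empty_conv)
  ultimately show ?thesis using assms(2) by simp
qed

text \<open>Since \<open>a\<close> crosses a chord outside the pair, it has one end in each of the
  two arcs, and without \<open>u\<close> each arc is just an end of \<open>a\<close>. The induction
  hypothesis handles the diagrams without \<open>u\<close>. Substituting the arcs for the ends of
  \<open>a\<close> restores \<open>u\<close>, and the resulting word differs from \<open>E\<close>
  only in the position of \<open>u\<close>.\<close>

lemma pair_meq_aux: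
  fixes D E :: "'a list"
  assumes IH: "\<And>D' E' :: 'a list. length D' < length D \<Longrightarrow> same_graph D' E' \<Longrightarrow> meq D' E'"
    and same: "same_graph D E" and "conn D"
    and au: "a \<in> set D" "u \<in> set D" "a \<noteq> u" and y: "y \<in> set D" "y \<notin> {a, u}" and cut: "cut D {a, u} \<le> 4"
    and i: "crosses D a y"
  shows "meq D E"
proof -
  have d: "dow D" using same by (simp add: same_graph_def)
  obtain A1 B1 A2 B2 where b: "dihedral D (A1 @ B1 @ A2 @ B2)" "A1 \<noteq> []" "B1 \<noteq> []" "A2 \<noteq> []" "B2 \<noteq> []"
    "set (A1 @ A2) \<subseteq> {a, u}" "set (B1 @ B2) \<inter> {a, u} = {}" "cut D {a, u} = 4"
    by (rule conn_blocks[OF assms(3) au(1) _ y cut]) auto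
  let ?D = "A1 @ B1 @ A2 @ B2"
  have s: "same_graph D ?D" by (rule dihedral_same_graph[OF d b(1)])
  have dD: "dow ?D" "set ?D = set D" "crosses ?D a y" using s i by (auto simp: same_graph_def)
  have "a \<in> set (A1 @ A2)" "y \<in> set (B1 @ B2)" "u \<in> set ?D" using dD(2) au y b(6,7) by auto
  then have ca: "count_list A1 a = 1" "count_list A2 a = 1"
    using crossing_bridge[OF dD(1) _ _ _ dD(3)] b(6,7) by blast+
  let ?P = "\<lambda>x. x \<noteq> u"
  have f: "filter ?P A1 = [a]" "filter ?P A2 = [a]"
    using ca b(6) au(3) by (auto intro!: filter_single)
  have fB: "filter ?P B1 = B1" "filter ?P B2 = B2" using b(7) by (auto simp: filter_id_conv)
  have fD: "filter ?P ?D = [a] @ B1 @ [a] @ B2" by (simp add: f fB)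
  have sE: "same_graph ([a] @ B1 @ [a] @ B2) (filter ?P E)"
    using same_graph_filter[OF same_graph_trans[OF same_graph_sym[OF s] same], of ?P] fD by simp
  have "length ([a] @ B1 @ [a] @ B2) < length ?D"
    using length_filter_less[OF \<open>u \<in> set ?D\<close>, of ?P] unfolding fD by simp
  also have "length ?D = length D" using dihedral_mset[OF b(1)] by (metis mset_eq_length)
  finally have m: "meq ([a] @ B1 @ [a] @ B2) (filter ?P E)" using IH sE by blast
  have aB: "a \<notin> set B1" "a \<notin> set B2" using b(7) by auto
  have "dow (filter ?P E)" "a \<in> set (filter ?P E)"
    using sE by (auto simp: same_graph_def)
  then obtain X Y Z where E: "filter ?P E = X @ [a] @ Y @ [a] @ Z" "a \<notin> set X" "a \<notin> set Y" "a \<notin> set Z"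
    using dow_split by metis
  have XYZ: "set ([a] @ B1 @ [a] @ B2) = set (X @ [a] @ Y @ [a] @ Z)" using sE E(1) by (simp add: same_graph_def)
  have "meq (sub a [A1, A2] ([a] @ B1 @ [a] @ B2)) (sub a [A1, A2] (X @ [a] @ Y @ [a] @ Z))"
  proof (rule sub_meq)
    show "meq ([a] @ B1 @ [a] @ B2) (X @ [a] @ Y @ [a] @ Z)" using m E(1) by simp
    show "count_list ([a] @ B1 @ [a] @ B2) a = 2" using aB by (simp add: count_list_0_iff)
    show "(set A1 \<union> set A2) \<inter> (set ([a] @ B1 @ [a] @ B2) - {a}) = {}" using b(6,7) by auto
  qed
  then have m2: "meq ?D (X @ A1 @ Y @ A2 @ Z)"
    using sub_two[of a "[]" B1 B2 A1 A2] sub_two[OF E(2-4), of A1 A2] aB by simp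
  have sE2: "same_graph (X @ A1 @ Y @ A2 @ Z) E"
    using same_graph_trans[OF same_graph_sym[OF meq_same_graph[OF dD(1) m2]] same_graph_trans[OF same_graph_sym[OF s] same]] .
  have "u \<notin> set (filter ?P E)" by simp
  then have "filter ?P X = X" "filter ?P Y = Y" "filter ?P Z = Z" unfolding E(1) by (auto simp: filter_id_conv)
  then have "filter ?P (X @ A1 @ Y @ A2 @ Z) = filter ?P E" using f E(1) by simp
  moreover have "u \<in> set (X @ A1 @ Y @ A2 @ Z)"
    using mset_eq_setD[OF meq_mset[OF m2]] \<open>u \<in> set ?D\<close> by auto
  ultimately have "meq (X @ A1 @ Y @ A2 @ Z) E" using reinsert[OF sE2] by simp
  then show ?thesis using m2 dihedral_meq[OF b(1)] meq_trans by blast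
qed

lemma pair_meq:
  fixes D E :: "'a list"
  assumes IH: "\<And>D' E' :: 'a list. length D' < length D \<Longrightarrow> same_graph D' E' \<Longrightarrow> meq D' E'"
    and same: "same_graph D E" and "conn D"
    and au: "a \<in> set D" "u \<in> set D" "a \<noteq> u" and ne: "set D \<noteq> {a, u}" and cut: "cut D {a, u} \<le> 4"
  shows "meq D E"
proof -
  have "{a, u} \<subseteq> set D" "{a, u} \<noteq> {}" "{a, u} \<noteq> set D" using au ne by auto
  from assms(3)[unfolded conn_def, rule_format, OF this]
  obtain x y where "x \<in> {a, u}" "y \<in> set D - {a, u}" "crosses D x y" by blast
  moreover have "cut D {u, a} \<le> 4" using cut by (simp add: insert_commute)
  ultimately consider "crosses D a y" "y \<in> set D" "y \<notin> {a, u}" | "crosses D u y" "y \<in> set D" "y \<notin> {u, a}"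
    by blast
  then show ?thesis
  proof cases
    case 1
    show ?thesis by (rule pair_meq_aux[OF IH same assms(3) au 1(2,3) cut 1(1)])
  next
    case 2
    show ?thesis
      by (rule pair_meq_aux[OF IH same assms(3) au(2,1) au(3)[symmetric] 2(2,3) \<open>cut D {u, a} \<le> 4\<close> 2(1)])
  qed
qed

section \<open>Splits of the graph that every diagram realises\<close>

lemma tight_two_cuts:
  assumes t: "tight F" and b: "b \<in> set F" "b \<notin> T1" "b \<notin> T2" "set F - {b} = T1 \<union> T2" "T1 \<inter> T2 = {}"
    and ne: "T1 \<noteq> {}" "T2 \<noteq> {}" and c: "cut F T1 \<le> 4" "cut F (insert b T1) \<le> 4"
  shows "card (T1 \<union> T2) \<le> 2"
proof -
  have fin: "finite T1" "finite T2" using b(4) finite_subset[of _ "set F"] by (metis Un_upper1 Un_upper2 finite_Diff finite_set finite_subset)+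
  have F: "set F = insert b (T1 \<union> T2)" using b by blast
  have "set F - T1 = insert b T2" "set F - insert b T1 = T2" using F b(2,3,5) by auto
  \<comment> \<open>Neither cut reaches 6, so each has a side with fewer than two elements; as
    \<open>b\<close> joins \<open>T2\<close> in the first and \<open>T1\<close> in the second,
    \<open>T1\<close> and \<open>T2\<close> are singletons.\<close>
  then have "\<not> (2 \<le> card T1 \<and> 2 \<le> card (insert b T2))" "\<not> (2 \<le> card (insert b T1) \<and> 2 \<le> card T2)"
    using tightD2[OF t, of T1] tightD2[OF t, of "insert b T1"] c F by auto
  moreover have "card (insert b T1) = Suc (card T1)" "card (insert b T2) = Suc (card T2)" "card T1 \<noteq> 0" "card T2 \<noteq> 0"
    using b fin ne by auto
  moreover have "card (T1 \<union> T2) = card T1 + card T2" using fin b(5) by (simp add: card_Un_disjoint)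
  ultimately show ?thesis by linarith
qed

text \<open>\<open>Q\<close> is the part cut off by a further chord with both ends on the same side
  of \<open>b\<close>. If that chord crosses none of the chords other than \<open>b\<close>, then
  \<open>Q\<close> is closed and fills one arc. If it crosses the same ones as \<open>b\<close>,
  then \<open>P @ R\<close> is closed, and its cut is too small both with and without
  \<open>b\<close>.\<close>

lemma tight_no_gap1:
  assumes t: "tight F" and F: "F = [b] @ P @ Q @ R @ [b] @ S" and b: "b \<notin> set (P @ Q @ R @ S)"
    and ne: "Q \<noteq> []" "P @ R \<noteq> []" and card: "3 \<le> card (set (P @ Q @ R @ S))"
    and counts: "(\<forall>x\<in>set (P @ Q @ R @ S). count_list Q x \<noteq> 1) \<or>
      (\<forall>x\<in>set (P @ Q @ R @ S). count_list Q x = 1 \<longleftrightarrow> count_list (P @ Q @ R) x = 1)"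
  shows False
  using counts
proof
  have d: "dow F" using t by (simp add: tight_def)
  {
    assume c: "\<forall>x\<in>set (P @ Q @ R @ S). count_list Q x \<noteq> 1"
    have disj: "set Q \<inter> set (R @ S @ P) = {}"
      by (rule closed_from_counts[OF d, of _ _ "{#b, b#}"]) (use c count_list_0_iff[of Q] in \<open>auto simp: F\<close>)
    have "dihedral F (Q @ (R @ [b] @ S @ [b] @ P))" using dihedral_rot[of "[b] @ P" "Q @ R @ [b] @ S"] unfolding F by simp
    from cut_dihedral[OF this] have "cut F (set Q) \<le> 2"
      using cut_two_blocks[of Q "set Q" "R @ [b] @ S @ [b] @ P"] disj b by auto
    moreover have "b \<in> set F" "b \<notin> set Q" using b F by auto
    ultimately show False using tightD1[OF t, of "set Q"] ne F by force
  next
    assume c: "\<forall>x\<in>set (P @ Q @ R @ S). count_list Q x = 1 \<longleftrightarrow> count_list (P @ Q @ R) x = 1"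
    have disj: "set (P @ R) \<inter> set (Q @ S) = {}"
    proof (rule closed_from_counts[OF d, of _ _ "{#b, b#}"])
      fix x assume x: "count_list (P @ R) x = 1" "count_list (Q @ S) x = 1"
      then have "x \<in> set (P @ R)" by (metis count_list_0_iff zero_neq_one)
      then have "x \<in> set (P @ Q @ R @ S)" by auto
      from bspec[OF c this] x show False unfolding count_list_append by presburger
    qed (auto simp: F)
    have 1: "dihedral F (P @ Q @ R @ ([b] @ S @ [b]))" using dihedral_rot[of "[b]" "P @ Q @ R @ [b] @ S"] unfolding F by simp
    have c1: "cut F (set (P @ R)) \<le> 4"
      unfolding cut_dihedral[OF 1, symmetric] using disj b by (intro cut_four_blocks) auto
    have c2: "cut F (insert b (set (P @ R))) \<le> 4"
    proof -
      have "cut (([b] @ P) @ Q @ (R @ [b]) @ S) (insert b (set (P @ R))) \<le> 4"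
        using disj b by (intro cut_four_blocks) auto
      then show ?thesis unfolding F by simp
    qed
    have "card (set (P @ R) \<union> set (Q @ S)) \<le> 2"
      using b ne disj c1 c2 by (intro tight_two_cuts[OF t, of b]) (auto simp: F)
    moreover have "set (P @ R) \<union> set (Q @ S) = set (P @ Q @ R @ S)" by auto
    ultimately show False using card by simp
  }
qed

text \<open>The counterpart for a further chord with ends on different sides of \<open>b\<close>; it
  cuts off \<open>Q\<close>, an end of \<open>b\<close>, and \<open>R\<close>.\<close>

lemma tight_no_gap2:
  assumes t: "tight F" and F: "F = [b] @ P @ Q @ [b] @ R @ S" and b: "b \<notin> set (P @ Q @ R @ S)"
    and ne: "P \<noteq> []" "Q \<noteq> []" and card: "3 \<le> card (set (P @ Q @ R @ S))"
    and counts: "(\<forall>x\<in>set (P @ Q @ R @ S). count_list (Q @ R) x \<noteq> 1) \<or>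
      (\<forall>x\<in>set (P @ Q @ R @ S). count_list (Q @ R) x = 1 \<longleftrightarrow> count_list (P @ Q) x = 1)"
  shows False
  using counts
proof
  have d: "dow F" using t by (simp add: tight_def)
  {
    assume c: "\<forall>x\<in>set (P @ Q @ R @ S). count_list (Q @ R) x \<noteq> 1"
    have disj: "set (Q @ R) \<inter> set (P @ S) = {}"
    proof (rule closed_from_counts[OF d, of _ _ "{#b, b#}"])
      fix x assume x: "count_list (Q @ R) x = 1" "count_list (P @ S) x = 1"
      then have "x \<in> set (Q @ R)" by (metis count_list_0_iff zero_neq_one)
      then have "x \<in> set (P @ Q @ R @ S)" by auto
      from bspec[OF c this] x show False unfolding count_list_append by presburger
    qed (auto simp: F)
    have 1: "dihedral F (Q @ [b] @ R @ (S @ [b] @ P))" using dihedral_rot[of "[b] @ P" "Q @ [b] @ R @ S"] unfolding F by simp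
    have c1: "cut F (set (Q @ R)) \<le> 4"
      unfolding cut_dihedral[OF 1, symmetric] using disj b by (intro cut_four_blocks) auto
    have 2: "dihedral F ([b] @ P @ (Q @ [b] @ R) @ S)" unfolding F by simp
    have c2: "cut F (insert b (set (Q @ R))) \<le> 4"
      unfolding cut_dihedral[OF 2, symmetric] using disj b by (intro cut_four_blocks) auto
    have "card (set (Q @ R) \<union> set (P @ S)) \<le> 2"
      using b ne disj c1 c2 by (intro tight_two_cuts[OF t, of b]) (auto simp: F)
    moreover have "set (Q @ R) \<union> set (P @ S) = set (P @ Q @ R @ S)" by auto
    ultimately show False using card by simp
  next
    assume c: "\<forall>x\<in>set (P @ Q @ R @ S). count_list (Q @ R) x = 1 \<longleftrightarrow> count_list (P @ Q) x = 1"
    have disj: "set (P @ R) \<inter> set (Q @ S) = {}"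
    proof (rule closed_from_counts[OF d, of _ _ "{#b, b#}"])
      fix x assume x: "count_list (P @ R) x = 1" "count_list (Q @ S) x = 1"
      then have "x \<in> set (P @ R)" by (metis count_list_0_iff zero_neq_one)
      then have "x \<in> set (P @ Q @ R @ S)" by auto
      from bspec[OF c this] x show False unfolding count_list_append by presburger
    qed (auto simp: F)
    have 1: "dihedral F (P @ (Q @ [b]) @ R @ (S @ [b]))" using dihedral_rot[of "[b]" "P @ Q @ [b] @ R @ S"] unfolding F by simp
    have c1: "cut F (set (P @ R)) \<le> 4"
      unfolding cut_dihedral[OF 1, symmetric] using disj b by (intro cut_four_blocks) auto
    have 2: "dihedral F (([b] @ P) @ Q @ ([b] @ R) @ S)" unfolding F by simp
    have c2: "cut F (insert b (set (P @ R))) \<le> 4"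
      unfolding cut_dihedral[OF 2, symmetric] using disj b by (intro cut_four_blocks) auto
    have "card (set (P @ R) \<union> set (Q @ S)) \<le> 2"
      using b ne disj c1 c2 by (intro tight_two_cuts[OF t, of b]) (auto simp: F)
    moreover have "set (P @ R) \<union> set (Q @ S) = set (P @ Q @ R @ S)" by auto
    ultimately show False using card by simp
  }
qed

lemma list_gap:
  assumes "\<And>U J V. X = U @ J @ V \<Longrightarrow> J \<noteq> [] \<Longrightarrow> set J \<inter> A = {} \<Longrightarrow> U \<noteq> [] \<Longrightarrow> last U \<in> A \<Longrightarrow>
    V \<noteq> [] \<Longrightarrow> hd V \<in> A \<Longrightarrow> False"
  shows "\<exists>B1 X' B2. X = B1 @ X' @ B2 \<and> set X' \<subseteq> A \<and> set (B1 @ B2) \<inter> A = {}"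
proof -
  define B1 where "B1 = takeWhile (\<lambda>x. x \<notin> A) X"
  define R where "R = dropWhile (\<lambda>x. x \<notin> A) X"
  define X' where "X' = takeWhile (\<lambda>x. x \<in> A) R"
  define R' where "R' = dropWhile (\<lambda>x. x \<in> A) R"
  define J where "J = takeWhile (\<lambda>x. x \<notin> A) R'"
  define V where "V = dropWhile (\<lambda>x. x \<notin> A) R'"
  have eq: "X = B1 @ R" "R = X' @ R'" "R' = J @ V"
    by (simp_all add: B1_def R_def X'_def R'_def J_def V_def)
  have s: "set B1 \<inter> A = {}" "set X' \<subseteq> A" "set J \<inter> A = {}"
    unfolding B1_def X'_def J_def by (auto dest: set_takeWhileD)
  show ?thesis
  proof (cases "V = []")
    case True
    then show ?thesis using eq s by (intro exI[of _ B1] exI[of _ X'] exI[of _ J]) auto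
  next
    case False
    then have hV: "hd V \<in> A" unfolding V_def using hd_dropWhile by blast
    have R': "R' \<noteq> []" using eq(3) False by simp
    then have hR': "hd R' \<notin> A" unfolding R'_def using hd_dropWhile by blast
    then have J: "J \<noteq> []" using R' unfolding J_def by (cases R') auto
    have R: "R \<noteq> []" using eq R' by simp
    then have "hd R \<in> A" unfolding R_def using hd_dropWhile by blast
    then have X': "X' \<noteq> []" using R unfolding X'_def by (cases R) auto
    have "last (B1 @ X') \<in> A" using X' s(2) last_in_set[of X'] by auto
    then show ?thesis using assms[of "B1 @ X'" J V] eq J s(3) X' False hV by auto
  qed
qed

lemma count_filter_A: "x \<in> A \<Longrightarrow> count_list (filter (\<lambda>z. z \<in> A) L) x = count_list L x"
  by (simp add: count_list_filter_if)

text \<open>Suppose a gap \<open>J\<close> interrupts the letters of \<open>A\<close> on one side of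
  \<open>b\<close>. A chord with only one end in \<open>J\<close> would cross no chord of
  \<open>A\<close> or the same ones as \<open>b\<close>, which \<open>tight_no_gap1\<close> and
  \<open>tight_no_gap2\<close> exclude. So the gap is closed, against connectedness.\<close>

lemma no_gap:
  assumes conn: "conn E" and d: "dow E" and E: "E = [b] @ X @ [b] @ Y" and b: "b \<notin> set X" "b \<notin> set Y" "b \<notin> A"
    and A: "A \<subseteq> set E" "3 \<le> card A" and t: "tight (filter (\<lambda>x. x \<in> insert b A) E)"
    and nbr: "\<And>y. y \<in> set E \<Longrightarrow> y \<notin> A \<Longrightarrow> (\<forall>x\<in>A. \<not> crosses E y x) \<or> (\<forall>x\<in>A. crosses E y x = crosses E b x)"
  shows "\<exists>B1 X' B2. X = B1 @ X' @ B2 \<and> set X' \<subseteq> A \<and> set (B1 @ B2) \<inter> A = {}"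
proof (rule list_gap)
  fix U J V
  assume X: "X = U @ J @ V" and J: "J \<noteq> []" "set J \<inter> A = {}" and U: "U \<noteq> []" "last U \<in> A" and V: "V \<noteq> []" "hd V \<in> A"
  let ?f = "filter (\<lambda>z. z \<in> A)"
  let ?F = "filter (\<lambda>x. x \<in> insert b A) E"
  have fb: "filter (\<lambda>x. x \<in> insert b A) L = ?f L" if "b \<notin> set L" for L
    using that by (intro filter_cong) auto
  have fJ: "?f L = []" if "set L \<subseteq> set J" for L using that J(2) by (intro filter_False) auto
  have F: "?F = [b] @ ?f U @ ?f V @ [b] @ ?f Y"
    using fb[of X] fb[of Y] b fJ[of J] by (simp add: E X)
  have SA: "set (?f U @ ?f V @ ?f Y) = A" using A(1) b(3) J(2) unfolding E X by auto
  have bf: "b \<notin> set (?f L)" for L using b(3) by simp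
  have ib: "crosses E b x \<longleftrightarrow> count_list (?f U @ ?f V) x = 1" if "x \<in> A" for x
  proof -
    have "count_list J x = 0" using that J(2) by (auto simp: count_list_0_iff)
    moreover have "crosses E b x \<longleftrightarrow> count_list X x = 1"
      using that b by (intro crosses_chord[OF d, of "[]" b X Y]) (auto simp: E)
    ultimately show ?thesis using that by (simp add: X count_filter_A)
  qed
  have "count_list J y = 2" if y: "y \<in> set J" for y
  proof (rule ccontr)
    assume n2: "count_list J y \<noteq> 2"
    have yA: "y \<notin> A" and yb: "y \<noteq> b" and yE: "y \<in> set E" using y J(2) b X E by auto
    have cE: "count_list E y = 2" using d yE by (simp add: dow_def)
    have "count_list J y \<noteq> 0" using y by (simp add: count_list_0_iff)
    then have cJ: "count_list J y = 1" and c: "count_list U y + count_list V y + count_list Y y = 1"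
      using cE n2 yb by (auto simp: E X)
    obtain J1 J2 where J12: "J = J1 @ [y] @ J2" "y \<notin> set J1" "y \<notin> set J2" by (rule count_list_1_split[OF cJ])
    have J0: "count_list J1 x = 0" "count_list J2 x = 0" if "x \<in> A" for x
      using that J(2) J12 by (auto simp: count_list_0_iff)
    \<comment> \<open>The other end of \<open>y\<close> lies behind the gap, before the gap, or on
      the other side of \<open>b\<close>.\<close>
    from c consider "count_list V y = 1" "count_list U y = 0" "count_list Y y = 0"
      | "count_list U y = 1" "count_list V y = 0" "count_list Y y = 0"
      | "count_list Y y = 1" "count_list U y = 0" "count_list V y = 0" by linarith
    then show False
    proof cases
      case 1
      obtain V1 V2 where V12: "V = V1 @ [y] @ V2" "y \<notin> set V1" "y \<notin> set V2" by (rule count_list_1_split[OF 1(1)])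
      have V1: "V1 \<noteq> []" "hd V \<in> set V1" using V yA V12(1) by (cases V1; auto)+
      have n: "y \<notin> set U" "y \<notin> set Y" using 1 by (simp_all add: count_list_0_iff)
      have iy: "crosses E y x \<longleftrightarrow> count_list (?f V1) x = 1" if "x \<in> A" for x
      proof -
        have "crosses E y x \<longleftrightarrow> count_list (J2 @ V1) x = 1"
          using that yA yb n J12 V12 by (intro crosses_chord[OF d, of "[b] @ U @ J1" y "J2 @ V1" "V2 @ [b] @ Y"]) (auto simp: E X)
        then show ?thesis using J0[OF that] that by (simp add: count_filter_A)
      qed
      have fV: "?f V = ?f V1 @ ?f V2" using V12(1) yA by simp
      show False
      proof (rule tight_no_gap1[OF t, of b "?f U" "?f V1" "?f V2" "?f Y"])
        show "?f V1 \<noteq> []" using V1 V(2) by (auto simp: filter_empty_conv)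
        show "?f U @ ?f V2 \<noteq> []" using U last_in_set[of U] by (auto simp: filter_empty_conv)
        have S: "set (?f U @ ?f V1 @ ?f V2 @ ?f Y) = A" using SA fV by simp
        show "3 \<le> card (set (?f U @ ?f V1 @ ?f V2 @ ?f Y))" unfolding S by (rule A(2))
        show "(\<forall>x\<in>set (?f U @ ?f V1 @ ?f V2 @ ?f Y). count_list (?f V1) x \<noteq> 1) \<or>
          (\<forall>x\<in>set (?f U @ ?f V1 @ ?f V2 @ ?f Y). count_list (?f V1) x = 1 \<longleftrightarrow> count_list (?f U @ ?f V1 @ ?f V2) x = 1)"
          unfolding S using nbr[OF yE yA]
        proof (rule disj_forward)
          assume "\<forall>x\<in>A. \<not> crosses E y x"
          then show "\<forall>x\<in>A. count_list (?f V1) x \<noteq> 1" using iy by blast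
        next
          assume "\<forall>x\<in>A. crosses E y x = crosses E b x"
          then show "\<forall>x\<in>A. count_list (?f V1) x = 1 \<longleftrightarrow> count_list (?f U @ ?f V1 @ ?f V2) x = 1"
            using iy ib unfolding fV by auto
        qed
      qed (use F fV bf in auto)
    next
      case 2
      obtain U1 U2 where U12: "U = U1 @ [y] @ U2" "y \<notin> set U1" "y \<notin> set U2" by (rule count_list_1_split[OF 2(1)])
      have U2: "U2 \<noteq> []" "last U \<in> set U2" using U yA U12(1) by (cases U2; auto)+
      have n: "y \<notin> set V" "y \<notin> set Y" using 2 by (simp_all add: count_list_0_iff)
      have iy: "crosses E y x \<longleftrightarrow> count_list (?f U2) x = 1" if "x \<in> A" for x
      proof -
        have "crosses E y x \<longleftrightarrow> count_list (U2 @ J1) x = 1"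
          using that yA yb n J12 U12 by (intro crosses_chord[OF d, of "[b] @ U1" y "U2 @ J1" "J2 @ V @ [b] @ Y"]) (auto simp: E X)
        then show ?thesis using J0[OF that] that by (simp add: count_filter_A)
      qed
      have fU: "?f U = ?f U1 @ ?f U2" using U12(1) yA by simp
      show False
      proof (rule tight_no_gap1[OF t, of b "?f U1" "?f U2" "?f V" "?f Y"])
        show "?f U2 \<noteq> []" using U2 U(2) by (auto simp: filter_empty_conv)
        show "?f U1 @ ?f V \<noteq> []" using V hd_in_set[of V] by (auto simp: filter_empty_conv)
        have S: "set (?f U1 @ ?f U2 @ ?f V @ ?f Y) = A" using SA fU by simp
        show "3 \<le> card (set (?f U1 @ ?f U2 @ ?f V @ ?f Y))" unfolding S by (rule A(2))
        show "(\<forall>x\<in>set (?f U1 @ ?f U2 @ ?f V @ ?f Y). count_list (?f U2) x \<noteq> 1) \<or>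
          (\<forall>x\<in>set (?f U1 @ ?f U2 @ ?f V @ ?f Y). count_list (?f U2) x = 1 \<longleftrightarrow> count_list (?f U1 @ ?f U2 @ ?f V) x = 1)"
          unfolding S using nbr[OF yE yA]
        proof (rule disj_forward)
          assume "\<forall>x\<in>A. \<not> crosses E y x"
          then show "\<forall>x\<in>A. count_list (?f U2) x \<noteq> 1" using iy by blast
        next
          assume "\<forall>x\<in>A. crosses E y x = crosses E b x"
          then show "\<forall>x\<in>A. count_list (?f U2) x = 1 \<longleftrightarrow> count_list (?f U1 @ ?f U2 @ ?f V) x = 1"
            using iy ib unfolding fU append_assoc by auto
        qed
      qed (use F fU bf in auto)
    next
      case 3
      obtain Y1 Y2 where Y12: "Y = Y1 @ [y] @ Y2" "y \<notin> set Y1" "y \<notin> set Y2" by (rule count_list_1_split[OF 3(1)])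
      have n: "y \<notin> set U" "y \<notin> set V" using 3 by (simp_all add: count_list_0_iff)
      have iy: "crosses E y x \<longleftrightarrow> count_list (?f V @ ?f Y1) x = 1" if "x \<in> A" for x
      proof -
        have "crosses E y x \<longleftrightarrow> count_list (J2 @ V @ [b] @ Y1) x = 1"
          using that yA yb n J12 Y12 by (intro crosses_chord[OF d, of "[b] @ U @ J1" y "J2 @ V @ [b] @ Y1" Y2]) (auto simp: E X)
        moreover have "x \<noteq> b" using that b by auto
        ultimately show ?thesis using J0[OF that] that by (simp add: count_filter_A)
      qed
      have fY: "?f Y = ?f Y1 @ ?f Y2" using Y12(1) yA by simp
      show False
      proof (rule tight_no_gap2[OF t, of b "?f U" "?f V" "?f Y1" "?f Y2"])
        show "?f U \<noteq> []" using U last_in_set[of U] by (auto simp: filter_empty_conv)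
        show "?f V \<noteq> []" using V hd_in_set[of V] by (auto simp: filter_empty_conv)
        have S: "set (?f U @ ?f V @ ?f Y1 @ ?f Y2) = A" using SA fY by simp
        show "3 \<le> card (set (?f U @ ?f V @ ?f Y1 @ ?f Y2))" unfolding S by (rule A(2))
        show "(\<forall>x\<in>set (?f U @ ?f V @ ?f Y1 @ ?f Y2). count_list (?f V @ ?f Y1) x \<noteq> 1) \<or>
          (\<forall>x\<in>set (?f U @ ?f V @ ?f Y1 @ ?f Y2). count_list (?f V @ ?f Y1) x = 1 \<longleftrightarrow> count_list (?f U @ ?f V) x = 1)"
          unfolding S using nbr[OF yE yA]
        proof (rule disj_forward)
          assume "\<forall>x\<in>A. \<not> crosses E y x"
          then show "\<forall>x\<in>A. count_list (?f V @ ?f Y1) x \<noteq> 1" using iy by blast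
        next
          assume "\<forall>x\<in>A. crosses E y x = crosses E b x"
          then show "\<forall>x\<in>A. count_list (?f V @ ?f Y1) x = 1 \<longleftrightarrow> count_list (?f U @ ?f V) x = 1"
            using iy ib unfolding append_assoc by auto
        qed
      qed (use F fY bf in auto)
    qed
  qed
  then have "y \<notin> set (V @ [b] @ Y @ [b] @ U)" if "y \<in> set J" for y
  proof -
    have "y \<in> set E" using that E X by simp
    then have "count_list E y = 2" using d by (simp add: dow_def)
    moreover have "count_list J y = 2" using \<open>\<And>y. y \<in> set J \<Longrightarrow> count_list J y = 2\<close> that .
    moreover have "y \<noteq> b" using that b X by auto
    ultimately show ?thesis by (auto simp: E X count_list_0_iff)
  qed
  then have "set J \<inter> set (V @ [b] @ Y @ [b] @ U) = {}" by blast
  moreover have "dihedral E (J @ (V @ [b] @ Y @ [b] @ U))"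
    using dihedral_rot[of "[b] @ U" "J @ V @ [b] @ Y"] by (simp add: E X)
  ultimately show False using closed_not_conn conn J(1) by blast
qed

text \<open>\<open>nbr\<close> says that the chords outside \<open>A\<close> which cross
  \<open>A\<close> as \<open>b\<close> does, or not at all, are the only ones: a split in terms of
  the graph. By \<open>no_gap\<close> the letters of \<open>A\<close> form one run on each side of
  \<open>b\<close>, so \<open>A\<close> fills at most two arcs.\<close>

lemma decomposes_along:
  assumes conn: "conn E" and d: "dow E" and b: "b \<in> set E" "b \<notin> A"
    and A: "A \<subseteq> set E" "3 \<le> card A" and t: "tight (filter (\<lambda>x. x \<in> insert b A) E)"
    and nbr: "\<And>y. y \<in> set E \<Longrightarrow> y \<notin> A \<Longrightarrow> (\<forall>x\<in>A. \<not> crosses E y x) \<or> (\<forall>x\<in>A. crosses E y x = crosses E b x)"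
  shows "\<exists>A1 B1 A2 B2. dihedral E (A1 @ B1 @ A2 @ B2) \<and> set (A1 @ A2) \<subseteq> A \<and> set (B1 @ B2) \<inter> A = {}"
proof -
  obtain P X Q where E: "E = P @ [b] @ X @ [b] @ Q" "b \<notin> set P" "b \<notin> set X" "b \<notin> set Q"
    using dow_split[OF d b(1)] by metis
  have gap: "\<exists>B1 X' B2. X = B1 @ X' @ B2 \<and> set X' \<subseteq> A \<and> set (B1 @ B2) \<inter> A = {}"
    if i: "dihedral E ([b] @ X @ [b] @ Y)" and n: "b \<notin> set X" "b \<notin> set Y" for X Y
  proof -
    let ?E = "[b] @ X @ [b] @ Y"
    have s: "same_graph E ?E" by (rule dihedral_same_graph[OF d i])
    then have se: "dow ?E" "set ?E = set E" "\<And>x y. crosses ?E x y = crosses E x y" by (auto simp: same_graph_def)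
    show ?thesis
    proof (rule no_gap[OF _ se(1) refl n b(2)])
      show "conn ?E" using conn same_graph_conn[OF s] by simp
      show "A \<subseteq> set ?E" unfolding se(2) by (rule A(1))
      show "tight (filter (\<lambda>x. x \<in> insert b A) ?E)" by (rule tight_dihedral[OF dihedral_filter_both[OF i] t])
      show "(\<forall>x\<in>A. \<not> crosses ?E y x) \<or> (\<forall>x\<in>A. crosses ?E y x = crosses ?E b x)" if "y \<in> set ?E" "y \<notin> A" for y
        using nbr[of y] that unfolding se(2,3) by blast
    qed (rule A(2))
  qed
  have i1: "dihedral E ([b] @ X @ [b] @ (Q @ P))" using dihedral_rot[of P "[b] @ X @ [b] @ Q"] E(1) by simp
  have i2: "dihedral E ([b] @ (Q @ P) @ [b] @ X)" using dihedral_rot[of "P @ [b] @ X" "[b] @ Q"] E(1) by simp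
  obtain B1 X' B2 where X: "X = B1 @ X' @ B2" "set X' \<subseteq> A" "set (B1 @ B2) \<inter> A = {}"
    using gap[OF i1] E by auto
  obtain B3 Y' B4 where Y: "Q @ P = B3 @ Y' @ B4" "set Y' \<subseteq> A" "set (B3 @ B4) \<inter> A = {}"
    using gap[OF i2] E by auto
  have "dihedral E (([b] @ B1) @ (X' @ (B2 @ [b] @ B3) @ Y' @ B4))" using i1 X(1) Y(1) by simp
  also have "dihedral \<dots> (X' @ (B2 @ [b] @ B3) @ Y' @ (B4 @ [b] @ B1))"
    using dihedral_rot[of "[b] @ B1" "X' @ (B2 @ [b] @ B3) @ Y' @ B4"] by simp
  finally have "dihedral E (X' @ (B2 @ [b] @ B3) @ Y' @ (B4 @ [b] @ B1))" .
  then show ?thesis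
    using X Y b(2) by (intro exI[of _ X'] exI[of _ "B2 @ [b] @ B3"] exI[of _ Y'] exI[of _ "B4 @ [b] @ B1"]) auto
qed

section \<open>Reassembling a diagram along a split\<close>

lemma cut_replace_blocks:
  assumes "A1 \<noteq> []" "B1 \<noteq> []" "A2 \<noteq> []" "B2 \<noteq> []" "set (B1 @ B2) \<inter> C = {}" "b \<notin> C"
  shows "cut (A1 @ [b] @ A2 @ [b]) C = cut (A1 @ B1 @ A2 @ B2) C"
proof -
  let ?f = "\<lambda>x y. of_bool ((x \<in> C) \<noteq> (y \<in> C)) :: nat"
  have z: "wt ?f B1 = 0" "wt ?f B2 = 0" using assms by (auto intro!: wt_0)
  have h: "hd B1 \<notin> C" "last B1 \<notin> C" "hd B2 \<notin> C" "last B2 \<notin> C"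
    using assms by (auto dest: hd_in_set last_in_set)
  have "wt ?f (A1 @ B1 @ A2 @ B2) = wt ?f A1 + ?f (last A1) (hd B1) + ?f (last B1) (hd A2) + wt ?f A2 + ?f (last A2) (hd B2)"
    using assms z wt_append[of A1 "B1 @ A2 @ B2" ?f] wt_append[of B1 "A2 @ B2" ?f] wt_append[of A2 B2 ?f] by simp
  moreover have "wt ?f (A1 @ [b] @ A2 @ [b]) = wt ?f A1 + ?f (last A1) b + ?f b (hd A2) + wt ?f A2 + ?f (last A2) b"
    using assms wt_append[of A1 "[b] @ A2 @ [b]" ?f] wt_append[of "[b]" "A2 @ [b]" ?f] wt_append[of A2 "[b]" ?f] by simp
  ultimately show ?thesis
    using assms h unfolding cut_def by (simp add: cyc_eq)
qed

text \<open>Two substitutions: first \<open>a\<close> stands for the strands \<open>A1\<close> and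
  \<open>A2\<close> while the outside changes, then \<open>b\<close> stands for the new outside
  while the share changes.\<close>

lemma compose_meq:
  assumes d: "dow (A1 @ B1 @ A2 @ B2)" "dow (A1' @ B1' @ A2' @ B2')"
    and A: "set (A1 @ A2) \<subseteq> A" "set (A1' @ A2') \<subseteq> A"
    and B: "set (B1 @ B2) \<inter> A = {}" "set (B1' @ B2') \<inter> A = {}"
    and a: "a \<in> A" "count_list A1 a = 1" "count_list A2 a = 1"
    and b: "b \<notin> A" "count_list B1' b = 1" "count_list B2' b = 1"
    and m1: "meq ([a] @ B1 @ [a] @ B2) ([a] @ B1' @ [a] @ B2')"
    and m2: "meq (A1 @ [b] @ A2 @ [b]) (A1' @ [b] @ A2' @ [b])"
  shows "meq (A1 @ B1 @ A2 @ B2) (A1' @ B1' @ A2' @ B2')"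
proof -
  have n: "a \<notin> set B1" "a \<notin> set B2" "a \<notin> set B1'" "a \<notin> set B2'"
    "b \<notin> set A1" "b \<notin> set A2" "b \<notin> set A1'" "b \<notin> set A2'" using A B a(1) b(1) by auto
  have "meq (sub a [A1, A2] ([a] @ B1 @ [a] @ B2)) (sub a [A1, A2] ([a] @ B1' @ [a] @ B2'))"
    using n A B by (intro sub_meq[OF m1]) auto
  then have "meq (A1 @ B1 @ A2 @ B2) (A1 @ B1' @ A2 @ B2')"
    using sub_two[of a "[]" B1 B2 A1 A2] sub_two[of a "[]" B1' B2' A1 A2] n by simp
  also have "meq (sub b [B1', B2'] (A1 @ [b] @ A2 @ [b])) (sub b [B1', B2'] (A1' @ [b] @ A2' @ [b]))"
    using n A B by (intro sub_meq[OF m2]) auto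
  then have "meq (A1 @ B1' @ A2 @ B2') (A1' @ B1' @ A2' @ B2')"
    using sub_two[of b A1 A2 "[]" B1' B2'] sub_two[of b A1' A2' "[]" B1' B2'] n by simp
  finally show ?thesis .
qed

text \<open>For a smallest \<open>A\<close> the diagram with the outside contracted to one chord
  \<open>b\<close> is tight. By induction the corresponding part of \<open>E\<close> is tight as
  well, so the split is also present in \<open>E\<close>. The crossing chords \<open>a\<close> and
  \<open>b\<close> mark the two sides in the smaller diagrams.\<close>

lemma split_meq:
  fixes D E :: "'a list"
  assumes IH: "\<And>D' E' :: 'a list. length D' < length D \<Longrightarrow> same_graph D' E' \<Longrightarrow> meq D' E'"
    and same: "same_graph D E" and conn: "conn D"
    and A: "A \<subseteq> set D" "3 \<le> card A" "2 \<le> card (set D - A)" "cut D A \<le> 4"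
    and minimal: "\<And>C. C \<subseteq> set D \<Longrightarrow> 2 \<le> card C \<Longrightarrow> 2 \<le> card (set D - C) \<Longrightarrow> card C < card A \<Longrightarrow> 6 \<le> cut D C"
  shows "meq D E"
proof -
  have dD: "dow D" and dE: "dow E" and sDE: "set D = set E" using same by (auto simp: same_graph_def)
  have "A \<noteq> {}" "set D - A \<noteq> {}" using A by auto
  then have "A \<noteq> set D" by auto
  from conn[unfolded conn_def, rule_format, OF A(1) \<open>A \<noteq> {}\<close> this]
  obtain a b where ab: "a \<in> A" "b \<in> set D" "b \<notin> A" "crosses D a b" by blast
  obtain A1 B1 A2 B2 where bl: "dihedral D (A1 @ B1 @ A2 @ B2)" "A1 \<noteq> []" "B1 \<noteq> []" "A2 \<noteq> []" "B2 \<noteq> []"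
    "set (A1 @ A2) \<subseteq> A" "set (B1 @ B2) \<inter> A = {}" "cut D A = 4"
    by (rule conn_blocks[OF conn _ ab(1) ab(2,3) A(4)]) (use ab A in auto)
  let ?D = "A1 @ B1 @ A2 @ B2"
  have s: "same_graph D ?D" by (rule dihedral_same_graph[OF dD bl(1)])
  then have D: "dow ?D" "set ?D = set D" "\<And>x y. crosses ?D x y = crosses D x y" by (auto simp: same_graph_def)
  have lenD: "length ?D = length D" using dihedral_mset[OF bl(1)] by (metis mset_eq_length)
  have disj: "set (A1 @ A2) \<inter> set (B1 @ B2) = {}" using bl by blast
  have sA: "set (A1 @ A2) = A" and sB: "set (B1 @ B2) = set D - A" using D(2) bl(6,7) A(1) by auto
  have D': "dow (B1 @ A2 @ B2 @ A1)" "\<And>x y. crosses (B1 @ A2 @ B2 @ A1) x y = crosses D x y"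
    using dihedral_same_graph[OF D(1) dihedral_rot[of A1 "B1 @ A2 @ B2"]] D(3) by (auto simp: same_graph_def)
  have ca: "count_list A1 a = 1" "count_list A2 a = 1"
    using crossing_bridge[OF D(1) disj, of a b] ab D(3) sA sB by auto
  have cB: "count_list B1 y = 1" "count_list B2 y = 1" if "x \<in> A" "y \<in> set D - A" "crosses D y x" for x y
    using crossing_bridge[of B1 A2 B2 A1 y x] D' disj that sA sB by auto
  have cb: "count_list B1 b = 1" "count_list B2 b = 1"
    using cB[of a b] ab crosses_commute[of D] by auto
  let ?PA = "\<lambda>x. x \<in> insert b A" and ?PB = "\<lambda>x. x \<in> insert a (set D - A)"
  have fA: "filter ?PA ?D = A1 @ [b] @ A2 @ [b]"
  proof -
    have "filter ?PA B1 = [b]" "filter ?PA B2 = [b]" using cb bl(7) by (auto intro!: filter_single)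
    moreover have "filter ?PA A1 = A1" "filter ?PA A2 = A2" using bl(6) by (auto intro!: filter_True)
    ultimately show ?thesis by simp
  qed
  have fB: "filter ?PB ?D = [a] @ B1 @ [a] @ B2"
  proof -
    have "filter ?PB A1 = [a]" "filter ?PB A2 = [a]" using ca bl(6) ab A(1) by (auto intro!: filter_single)
    moreover have "filter ?PB B1 = B1" "filter ?PB B2 = B2" using sB by (auto intro!: filter_True)
    ultimately show ?thesis by simp
  qed
  have bA: "b \<notin> set A1" "b \<notin> set A2" using ab sA by auto
  have tight1: "tight (A1 @ [b] @ A2 @ [b])"
  proof -
    let ?E = "A1 @ [b] @ A2 @ [b]"
    have sE: "set ?E = insert b A" using sA by auto
    have dow: "dow ?E" using dow_filter[OF D(1), of ?PA] fA by simp
    have finA: "finite A" using A(1) finite_subset by blast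
    \<comment> \<open>A set inside \<open>A\<close> has the same cut in \<open>D\<close>, where the
      minimality of \<open>A\<close> applies; sets containing \<open>b\<close> are treated through
      their complements.\<close>
    have cutC: "4 \<le> cut ?E C \<and> (2 \<le> card C \<longrightarrow> 2 \<le> card (set ?E - C) \<longrightarrow> 6 \<le> cut ?E C)"
      if C: "C \<subseteq> A" "C \<noteq> {}" for C
    proof -
      have "cut ?E C = cut ?D C"
        using bl C ab by (intro cut_replace_blocks) auto
      also have "\<dots> = cut D C" by (rule cut_dihedral[OF bl(1)])
      finally have c: "cut ?E C = cut D C" .
      have CD: "C \<subseteq> set D" "C \<noteq> set D" using C A(1) \<open>A \<noteq> set D\<close> by auto
      have "6 \<le> cut D C" if c2: "2 \<le> card C" "2 \<le> card (set ?E - C)"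
      proof (rule minimal[OF CD(1) c2(1)])
        have sEC: "set ?E - C = insert b (A - C)" using sE C ab by auto
        have "A - C \<noteq> {}"
        proof
          assume e: "A - C = {}"
          have "card (set ?E - C) = 1" unfolding sEC e by simp
          with c2(2) show False by simp
        qed
        then have "C \<subset> A" using C by blast
        then show "card C < card A" using finA psubset_card_mono by blast
        have "set D - A \<subseteq> set D - C" using C by blast
        then show "2 \<le> card (set D - C)" using A(3) card_mono[of "set D - C" "set D - A"] by simp
      qed
      then show ?thesis using conn_cut[OF conn CD(1) C(2) CD(2)] c by simp
    qed
    have compl: "cut ?E (set ?E - C) = cut ?E C" for C by (rule cut_compl) simp
    show ?thesis
      unfolding tight_def
    proof (intro conjI allI impI dow)
      fix C assume C: "C \<subseteq> set ?E" "C \<noteq> {}" "C \<noteq> set ?E"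
      show "4 \<le> cut ?E C"
      proof (cases "b \<in> C")
        case True
        then have "set ?E - C \<subseteq> A" "set ?E - C \<noteq> {}" using C sE by auto
        then show ?thesis using cutC[of "set ?E - C"] compl by metis
      next
        case False
        then show ?thesis using cutC[of C] C sE by auto
      qed
    next
      fix C assume C: "C \<subseteq> set ?E" "2 \<le> card C" "2 \<le> card (set ?E - C)"
      show "6 \<le> cut ?E C"
      proof (cases "b \<in> C")
        case True
        then have 1: "set ?E - C \<subseteq> A" using sE by auto
        have 2: "set ?E - C \<noteq> {}" using C(3) by (metis card.empty not_numeral_le_zero)
        have "set ?E - (set ?E - C) = C" using C(1) by blast
        then show ?thesis using cutC[OF 1 2] C(2,3) unfolding compl by simp
      next
        case False
        then have "C \<subseteq> A" "C \<noteq> {}" using C sE by auto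
        then show ?thesis using cutC[of C] C by auto
      qed
    qed
  qed
  have sDE': "same_graph ?D E" using same_graph_trans[OF same_graph_sym[OF s] same] .
  have lenA: "length (A1 @ [b] @ A2 @ [b]) < length D"
  proof -
    have "\<not> set D - A \<subseteq> {b}" using A(3) card_mono[of "{b}" "set D - A"] by auto
    then obtain z where "z \<in> set ?D" "\<not> ?PA z" using D(2) by auto
    from length_filter_less[OF this(1), of ?PA] this(2) show ?thesis unfolding fA lenD by simp
  qed
  have lenB: "length ([a] @ B1 @ [a] @ B2) < length D"
  proof -
    have "\<not> A \<subseteq> {a}" using A(2) card_mono[of "{a}" A] by auto
    then obtain z where "z \<in> A" "z \<noteq> a" by blast
    then have "z \<in> set ?D" "\<not> ?PB z" using D(2) A(1) by auto
    from length_filter_less[OF this(1), of ?PB] this(2) show ?thesis unfolding fB lenD by simp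
  qed
  have m: "meq (A1 @ [b] @ A2 @ [b]) (filter ?PA E)"
    using IH[OF lenA] same_graph_filter[OF sDE', of ?PA] unfolding fA by blast
  have tE: "tight (filter ?PA E)" by (rule tight_dihedral[OF tight_meq_dihedral[OF tight1 m] tight1])
  \<comment> \<open>A chord outside that crosses some chord of \<open>A\<close> has an end in each
    of \<open>B1\<close> and \<open>B2\<close>, so it crosses exactly the chords of \<open>A\<close>
    with one end in \<open>A2\<close>.\<close>
  have propD: "(\<forall>x\<in>A. \<not> crosses D y x) \<or> (\<forall>x\<in>A. crosses D y x = crosses D b x)" if y: "y \<in> set D" "y \<notin> A" for y
  proof (cases "\<exists>x\<in>A. crosses D y x")
    case True
    then have c: "count_list B1 y = 1" "count_list B2 y = 1" using cB y by blast+
    have key: "crosses D z x \<longleftrightarrow> count_list A2 x = 1"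
      if z: "z \<in> set D" "z \<notin> A" "count_list B1 z = 1" "count_list B2 z = 1" and x: "x \<in> A" for z x
    proof -
      obtain p q where p: "B1 = p @ [z] @ q" "z \<notin> set p" "z \<notin> set q" by (rule count_list_1_split[OF z(3)])
      obtain r t where r: "B2 = r @ [z] @ t" "z \<notin> set r" "z \<notin> set t" by (rule count_list_1_split[OF z(4)])
      have "z \<notin> set A1" "z \<notin> set A2" "x \<noteq> z" using z x sA by auto
      then have "crosses ?D z x \<longleftrightarrow> count_list (q @ A2 @ r) x = 1"
        using p r by (intro crosses_chord[OF D(1), of "A1 @ p" z "q @ A2 @ r" t]) auto
      moreover have "count_list q x = 0" "count_list r x = 0"
        using x bl(7) p(1) r(1) by (auto simp: count_list_0_iff)
      ultimately show ?thesis using D(3) by simp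
    qed
    then show ?thesis using c cb y ab by auto
  qed auto
  have "\<exists>A1' B1' A2' B2'. dihedral E (A1' @ B1' @ A2' @ B2') \<and> set (A1' @ A2') \<subseteq> A \<and> set (B1' @ B2') \<inter> A = {}"
  proof (rule decomposes_along[OF _ dE _ ab(3) _ A(2) tE])
    show "conn E" using conn same_graph_conn[OF same] by simp
    show "b \<in> set E" "A \<subseteq> set E" using ab A sDE by auto
    show "(\<forall>x\<in>A. \<not> crosses E y x) \<or> (\<forall>x\<in>A. crosses E y x = crosses E b x)" if "y \<in> set E" "y \<notin> A" for y
      using propD[of y] that same unfolding same_graph_def by auto
  qed
  then obtain A1' B1' A2' B2' where E: "dihedral E (A1' @ B1' @ A2' @ B2')" "set (A1' @ A2') \<subseteq> A" "set (B1' @ B2') \<inter> A = {}"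
    by blast
  let ?E = "A1' @ B1' @ A2' @ B2'"
  have sE: "same_graph E ?E" by (rule dihedral_same_graph[OF dE E(1)])
  have sDE'': "same_graph ?D ?E" using same_graph_trans[OF sDE' sE] .
  then have E': "dow ?E" "set ?E = set D" "\<And>x y. crosses ?E x y = crosses D x y" using D by (auto simp: same_graph_def)
  have disj': "set (A1' @ A2') \<inter> set (B1' @ B2') = {}" using E by blast
  have sA': "set (A1' @ A2') = A" and sB': "set (B1' @ B2') = set D - A" using E'(2) E(2,3) A(1) by auto
  have E'': "dow (B1' @ A2' @ B2' @ A1')" "\<And>x y. crosses (B1' @ A2' @ B2' @ A1') x y = crosses D x y"
    using dihedral_same_graph[OF E'(1) dihedral_rot[of A1' "B1' @ A2' @ B2'"]] E'(3) by (auto simp: same_graph_def)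
  have ca': "count_list A1' a = 1" "count_list A2' a = 1"
    using crossing_bridge[OF E'(1) disj', of a b] ab E'(3) sA' sB' by auto
  have cb': "count_list B1' b = 1" "count_list B2' b = 1"
  proof -
    have 1: "set (B1' @ B2') \<inter> set (A2' @ A1') = {}" using disj' by auto
    have 2: "b \<in> set (B1' @ B2')" "a \<in> set (A2' @ A1')" using sA' sB' ab by auto
    have 3: "crosses (B1' @ A2' @ B2' @ A1') b a" using ab(4) E''(2) crosses_commute[of D] by simp
    show "count_list B1' b = 1" "count_list B2' b = 1" using crossing_bridge[OF E''(1) 1 2 3] by simp_all
  qed
  have fA': "filter ?PA ?E = A1' @ [b] @ A2' @ [b]"
  proof -
    have "filter ?PA B1' = [b]" "filter ?PA B2' = [b]" using cb' E(3) by (auto intro!: filter_single)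
    moreover have "filter ?PA A1' = A1'" "filter ?PA A2' = A2'" using E(2) by (auto intro!: filter_True)
    ultimately show ?thesis by simp
  qed
  have fB': "filter ?PB ?E = [a] @ B1' @ [a] @ B2'"
  proof -
    have "filter ?PB A1' = [a]" "filter ?PB A2' = [a]" using ca' E(2) ab A(1) by (auto intro!: filter_single)
    moreover have "filter ?PB B1' = B1'" "filter ?PB B2' = B2'" using sB' by (auto intro!: filter_True)
    ultimately show ?thesis by simp
  qed
  have m1: "meq ([a] @ B1 @ [a] @ B2) ([a] @ B1' @ [a] @ B2')"
    using IH[OF lenB] same_graph_filter[OF sDE'', of ?PB] unfolding fB fB' by blast
  have m2: "meq (A1 @ [b] @ A2 @ [b]) (A1' @ [b] @ A2' @ [b])"
    using IH[OF lenA] same_graph_filter[OF sDE'', of ?PA] unfolding fA fA' by blast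
  have "meq ?D ?E"
    by (rule compose_meq[OF D(1) E'(1) bl(6) E(2) bl(7) E(3) ab(1) ca ab(3) cb' m1 m2])
  then show ?thesis using meq_trans[OF dihedral_meq[OF bl(1)]] meq_trans meq_sym[OF dihedral_meq[OF E(1)]] by blast
qed

section \<open>Smoothings of tight diagrams\<close>

text \<open>A 4-regular multigraph without loops; \<open>d\<close> below is the size of an edge cut,
  and \<open>e\<close> counts the edges from a vertex into a set.\<close>

locale wgraph =
  fixes V :: "'a set" and m :: "'a \<Rightarrow> 'a \<Rightarrow> nat"
  assumes fin: "finite V" and sym: "m x y = m y x" and irrefl: "m x x = 0"
    and deg: "x \<in> V \<Longrightarrow> (\<Sum>y\<in>V. m x y) = 4"
begin

definition d :: "'a set \<Rightarrow> nat" where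
  "d A = (\<Sum>x\<in>V. \<Sum>y\<in>V. of_bool (x \<in> A \<and> y \<notin> A) * m x y)"

definition e :: "'a \<Rightarrow> 'a set \<Rightarrow> nat" where
  "e v A = (\<Sum>y\<in>V. of_bool (y \<in> A) * m v y)"

lemma submodular: "d (A \<inter> B) + d (A \<union> B) \<le> d A + d B"
  unfolding d_def sum.distrib[symmetric] by (intro sum_mono) auto

lemma d_compl: "B \<inter> V = V - A \<Longrightarrow> d B = d A"
proof -
  assume B: "B \<inter> V = V - A"
  have "d B = (\<Sum>x\<in>V. \<Sum>y\<in>V. of_bool (y \<in> A \<and> x \<notin> A) * m y x)"
    unfolding d_def using B by (intro sum.cong refl) (auto simp: sym)
  also have "\<dots> = d A" unfolding d_def by (rule sum.swap)
  finally show ?thesis .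
qed

text \<open>Of the four edges at \<open>v\<close>, those into \<open>A\<close> leave the cut and the
  others enter it.\<close>

lemma d_insert:
  assumes "v \<in> V" "v \<notin> A"
  shows "d (insert v A) + 2 * e v A = d A + 4"
proof -
  have "d (insert v A) + (\<Sum>x\<in>V. \<Sum>y\<in>V. of_bool (x \<in> A \<and> y = v) * m x y)
      = d A + (\<Sum>x\<in>V. \<Sum>y\<in>V. of_bool (x = v \<and> y \<notin> insert v A) * m x y)"
    unfolding d_def sum.distrib[symmetric] using assms(2) by (intro sum.cong refl) auto
  moreover have "(\<Sum>x\<in>V. \<Sum>y\<in>V. of_bool (x \<in> A \<and> y = v) * m x y) = e v A"
  proof -
    have "(\<Sum>y\<in>V. of_bool (x \<in> A \<and> y = v) * m x y) = of_bool (x \<in> A) * m v x" for x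
    proof -
      have "(\<Sum>y\<in>V. of_bool (x \<in> A \<and> y = v) * m x y) = (\<Sum>y\<in>V. if y = v then of_bool (x \<in> A) * m v x else 0)"
        by (intro sum.cong) (auto simp: sym)
      then show ?thesis using fin assms(1) by simp
    qed
    then show ?thesis unfolding e_def by simp
  qed
  moreover have "(\<Sum>x\<in>V. \<Sum>y\<in>V. of_bool (x = v \<and> y \<notin> insert v A) * m x y) = (\<Sum>y\<in>V. of_bool (y \<notin> A) * m v y)"
  proof -
    have "(\<Sum>x\<in>V. \<Sum>y\<in>V. of_bool (x = v \<and> y \<notin> insert v A) * m x y)
      = (\<Sum>x\<in>V. if x = v then (\<Sum>y\<in>V. of_bool (y \<notin> A) * m v y) else 0)"
      by (intro sum.cong refl) (auto intro!: sum.cong simp: irrefl)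
    then show ?thesis using fin assms(1) by simp
  qed
  moreover have "(\<Sum>y\<in>V. of_bool (y \<notin> A) * m v y) + e v A = 4"
    unfolding e_def sum.distrib[symmetric] deg[OF assms(1), symmetric] by (intro sum.cong) auto
  ultimately show ?thesis by linarith
qed

lemma d_empty: "d {} = 0"
  by (simp add: d_def)

lemma e_empty: "e v {} = 0"
  by (simp add: e_def)

lemma e_insert: "x \<in> V \<Longrightarrow> x \<notin> A \<Longrightarrow> e v (insert x A) = m v x + e v A"
proof -
  assume x: "x \<in> V" "x \<notin> A"
  have "e v (insert x A) = (\<Sum>y\<in>V. (if y = x then m v x else 0) + of_bool (y \<in> A) * m v y)"
    unfolding e_def using x by (intro sum.cong) auto
  also have "\<dots> = m v x + e v A" unfolding e_def sum.distrib using x fin by simp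
  finally show ?thesis .
qed

lemma e_le: "v \<in> V \<Longrightarrow> e v A \<le> 4"
  unfolding e_def deg[symmetric] by (intro sum_mono) auto

definition nbrs :: "'a \<Rightarrow> 'a \<Rightarrow> 'a \<Rightarrow> 'a \<Rightarrow> 'a \<Rightarrow> bool" where
  "nbrs v p q r s = (distinct [v, p, q, r, s] \<and> {v, p, q, r, s} \<subseteq> V \<and>
     m v p = 1 \<and> m v q = 1 \<and> m v r = 1 \<and> m v s = 1)"

lemma nbrs_swap: "nbrs v p q r s \<Longrightarrow> nbrs v q p r s" "nbrs v p q r s \<Longrightarrow> nbrs v p r q s"
  "nbrs v p q r s \<Longrightarrow> nbrs v p q s r"
  by (auto simp: nbrs_def)

lemma nbrs_e:
  assumes "nbrs v p q r s"
  shows "e v A = of_bool (p \<in> A) + of_bool (q \<in> A) + of_bool (r \<in> A) + of_bool (s \<in> A)"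
proof -
  have "m v y = of_bool (y \<in> {p, q, r, s})" if "y \<in> V" for y
  proof (cases "y \<in> {p, q, r, s}")
    case False
    have "e v (insert y {p, q, r, s}) \<le> 4" using assms by (intro e_le) (auto simp: nbrs_def)
    moreover have "e v (insert y {p, q, r, s}) = m v y + e v {p, q, r, s}"
      using that False by (rule e_insert)
    moreover have "e v {p, q, r, s} = 4" using assms by (simp add: nbrs_def e_insert e_empty)
    ultimately show ?thesis using False by auto
  qed (use assms in \<open>auto simp: nbrs_def\<close>)
  then have "e v A = (\<Sum>y\<in>V. of_bool (y \<in> A \<and> y \<in> {p, q, r, s}))"
    unfolding e_def by (intro sum.cong) auto
  also have "\<dots> = (\<Sum>y\<in>{p, q, r, s}. of_bool (y \<in> A \<and> y \<in> {p, q, r, s}))"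
    using assms fin by (intro sum.mono_neutral_right) (auto simp: nbrs_def)
  also have "\<dots> = of_bool (p \<in> A) + of_bool (q \<in> A) + of_bool (r \<in> A) + of_bool (s \<in> A)"
    using assms by (auto simp: nbrs_def)
  finally show ?thesis .
qed

lemma nbrs_1D:
  assumes "nbrs v p q r s" "y \<in> V" "m v y = 1"
  shows "y \<in> {p, q, r, s}"
proof (rule ccontr)
  assume "y \<notin> {p, q, r, s}"
  then have "e v {y} = 0" unfolding nbrs_e[OF assms(1)] by auto
  moreover have "e v {y} = m v y" using e_insert[of y "{}" v] assms(2) by (simp add: e_empty)
  ultimately show False using assms(3) by simp
qed

end

section \<open>Tight multigraphs and the pairings of the edges at a vertex\<close>

locale tight_wgraph = wgraph +
  assumes card4: "4 \<le> card V"
    and tight: "A \<subseteq> V \<Longrightarrow> 2 \<le> card A \<Longrightarrow> 2 \<le> card (V - A) \<Longrightarrow> 6 \<le> d A"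
begin

lemma d_pair:
  assumes "x \<in> V" "y \<in> V" "x \<noteq> y"
  shows "d {x, y} + 2 * m x y = 8"
proof -
  have "d {y} = 4" using d_insert[of y "{}"] assms by (simp add: d_empty e_empty)
  moreover have "e x {y} = m x y" using e_insert[of y "{}" x] assms by (simp add: e_empty)
  ultimately show ?thesis using d_insert[of x "{y}"] assms by simp
qed

text \<open>A double edge would leave a pair of vertices with a cut of at most four edges.\<close>

lemma m_le_1:
  assumes "x \<in> V" "y \<in> V"
  shows "m x y \<le> 1"
proof (cases "x = y")
  case False
  have "card (V - {x, y}) = card V - 2" using assms False fin by (simp add: card_Diff_subset)
  then have "6 \<le> d {x, y}" using assms False card4 by (intro tight) auto
  with d_pair[OF assms False] show ?thesis by simp
qed (simp add: irrefl)

lemma nbrs_ex: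
  assumes v: "v \<in> V"
  shows "\<exists>p q r s. nbrs v p q r s"
proof -
  let ?N = "{y \<in> V. m v y = 1}"
  have "(\<Sum>y\<in>V. m v y) = (\<Sum>y\<in>?N. 1)"
  proof (rule sum.mono_neutral_cong_right[OF fin])
    show "\<forall>i\<in>V - ?N. m v i = 0"
    proof
      fix i assume "i \<in> V - ?N"
      then show "m v i = 0" using m_le_1[OF v, of i] by auto
    qed
  qed auto
  then have "card ?N = 4" using deg[OF v] by simp
  then obtain p q r s where N: "?N = {p, q, r, s}" "distinct [p, q, r, s]"
    by (auto simp: eval_nat_numeral card_Suc_eq)
  have "p \<in> ?N" "q \<in> ?N" "r \<in> ?N" "s \<in> ?N" unfolding N by simp_all
  then have "nbrs v p q r s" using N(2) v irrefl by (auto simp: nbrs_def)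
  then show ?thesis by blast
qed

text \<open>Uncrossing: the cuts of the intersection and of the union add up to at most 12, and
  adding \<open>v\<close>, which has three neighbours in the union, lowers the second by 2. If both
  the intersection and the outer quadrant had two elements, tightness would require 12 where at most
  10 is left.\<close>

lemma crossing_small:
  assumes n: "nbrs v p q r s" and A1: "A1 \<subseteq> V - {v}" "p \<in> A1" "q \<in> A1" "r \<notin> A1" "s \<notin> A1" "d A1 \<le> 6"
    and A2: "A2 \<subseteq> V - {v}" "p \<in> A2" "r \<in> A2" "q \<notin> A2" "s \<notin> A2" "d A2 \<le> 6"
  shows "card (A1 \<inter> A2) \<le> 1 \<or> card (V - {v} - (A1 \<union> A2)) \<le> 1"
proof (rule ccontr)
  let ?I = "A1 \<inter> A2" and ?U = "A1 \<union> A2" and ?W = "V - {v} - (A1 \<union> A2)"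
  assume "\<not> (card ?I \<le> 1 \<or> card ?W \<le> 1)"
  then have c: "2 \<le> card ?I" "2 \<le> card ?W" by auto
  have v: "v \<in> V" "p \<in> V" "s \<in> V" "v \<noteq> p" "v \<noteq> s" using n by (auto simp: nbrs_def)
  have two: "2 \<le> card B" if "x \<in> B" "y \<in> B" "x \<noteq> y" "finite B" for x y and B :: "'a set"
    using card_mono[of B "{x, y}"] that by auto
  have "2 \<le> card (V - ?I)" using A1 A2 v fin by (intro two[of v _ s]) auto
  then have "6 \<le> d ?I" using c(1) A1 by (intro tight) auto
  moreover have "2 \<le> card (V - ?W)" using A1 A2 v fin by (intro two[of v _ p]) auto
  then have "6 \<le> d ?W" using c(2) by (intro tight) auto
  moreover have "d ?W = d (insert v ?U)" using A1 A2 v by (intro d_compl) auto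
  moreover have "d (insert v ?U) + 2 * e v ?U = d ?U + 4" using A1 A2 v by (intro d_insert) auto
  moreover have "e v ?U = 3" using nbrs_e[OF n, of ?U] A1 A2 by simp
  ultimately show False using submodular[of A1 A2] A1(6) A2(6) by linarith
qed

text \<open>Two edges of \<open>v\<close> go into \<open>A\<close> and two do not, so
  \<open>v\<close> may change sides.\<close>

lemma flip_side:
  assumes n: "nbrs v p q r s" and A: "A \<subseteq> V - {v}" "p \<in> A" "q \<in> A" "r \<notin> A" "s \<notin> A"
  shows "d (V - {v} - A) = d A"
proof -
  have v: "v \<in> V" using n by (auto simp: nbrs_def)
  have "d (V - {v} - A) = d (insert v A)" using A v by (intro d_compl) auto
  moreover have "d (insert v A) + 2 * e v A = d A + 4" using A v by (intro d_insert) auto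
  moreover have "e v A = 2" using nbrs_e[OF n, of A] A by simp
  ultimately show ?thesis by simp
qed

lemma small_pair:
  assumes "card P \<le> 1" "card Q \<le> 1" "finite P" "finite Q" "x \<in> P" "y \<in> Q" "x \<noteq> y" "x \<in> V" "y \<in> V"
    "d (P \<union> Q) \<le> 6"
  shows "m x y = 1"
proof -
  have "P = {x}" "Q = {y}" using assms(1-6) card_le_Suc0_iff_eq by auto
  then have "d {x, y} \<le> 6" using assms(10) by (simp add: insert_commute)
  then have "m x y \<ge> 1" using d_pair[OF assms(8,9,7)] by simp
  then show ?thesis using m_le_1[OF assms(8,9)] by simp
qed

text \<open>\<open>A1\<close> and \<open>A2\<close> divide the vertices other than \<open>v\<close>
  into four quadrants, one for each neighbour. By \<open>crossing_small\<close>, applied also with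
  the complement of \<open>A2\<close>, each pair of opposite quadrants contains a singleton. Two
  adjacent singletons form a side of a cut with at most six edges, and hence are joined.\<close>

lemma two_bad_pairings:
  assumes n: "nbrs v p q r s" and A1: "A1 \<subseteq> V - {v}" "p \<in> A1" "q \<in> A1" "r \<notin> A1" "s \<notin> A1" "d A1 \<le> 6"
    and A2: "A2 \<subseteq> V - {v}" "p \<in> A2" "r \<in> A2" "q \<notin> A2" "s \<notin> A2" "d A2 \<le> 6"
  shows "m p q = 1 \<or> m r s = 1 \<or> m p r = 1 \<or> m q s = 1"
proof -
  let ?B1 = "V - {v} - A1" and ?B2 = "V - {v} - A2"
  have V: "p \<in> V" "q \<in> V" "r \<in> V" "s \<in> V" "p \<noteq> q" "p \<noteq> r" "p \<noteq> s" "q \<noteq> r" "q \<noteq> s" "r \<noteq> s"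
    "v \<noteq> p" "v \<noteq> q" "v \<noteq> r" "v \<noteq> s"
    using n by (auto simp: nbrs_def)
  have n2: "nbrs v p r q s" and n3: "nbrs v q p s r" using n nbrs_swap by blast+
  have dB1: "d ?B1 = d A1" by (rule flip_side[OF n A1(1-5)])
  have dB2: "d ?B2 = d A2" by (rule flip_side[OF n2 A2(1-5)])
  have f: "finite A1" "finite A2"
    using finite_subset[OF A1(1)] finite_subset[OF A2(1)] fin by auto
  have 1: "card (A1 \<inter> A2) \<le> 1 \<or> card (V - {v} - (A1 \<union> A2)) \<le> 1"
    by (rule crossing_small[OF n A1 A2])
  have "card (A1 \<inter> ?B2) \<le> 1 \<or> card (V - {v} - (A1 \<union> ?B2)) \<le> 1"
    using A1 A2 V dB2 by (intro crossing_small[OF n3]) auto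
  moreover have "A1 \<inter> ?B2 = A1 - A2" "V - {v} - (A1 \<union> ?B2) = A2 - A1" using A1(1) A2(1) by auto
  ultimately have 2: "card (A1 - A2) \<le> 1 \<or> card (A2 - A1) \<le> 1" by simp
  let ?W = "V - {v} - (A1 \<union> A2)"
  from 1 2 show ?thesis
  proof (elim disjE)
    assume c: "card (A1 \<inter> A2) \<le> 1" "card (A1 - A2) \<le> 1"
    have "(A1 \<inter> A2) \<union> (A1 - A2) = A1" by auto
    then have "m p q = 1" using A1 A2 V f c by (intro small_pair[of "A1 \<inter> A2" "A1 - A2"]) auto
    then show ?thesis by simp
  next
    assume c: "card (A1 \<inter> A2) \<le> 1" "card (A2 - A1) \<le> 1"
    have "(A1 \<inter> A2) \<union> (A2 - A1) = A2" by auto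
    then have "m p r = 1" using A1 A2 V f c by (intro small_pair[of "A1 \<inter> A2" "A2 - A1"]) auto
    then show ?thesis by simp
  next
    assume c: "card ?W \<le> 1" "card (A1 - A2) \<le> 1"
    have "(A1 - A2) \<union> ?W = ?B2" using A1 A2 by auto
    then have "m q s = 1" using A1 A2 V f c dB2 fin by (intro small_pair[of "A1 - A2" ?W]) auto
    then show ?thesis by simp
  next
    assume c: "card ?W \<le> 1" "card (A2 - A1) \<le> 1"
    have "(A2 - A1) \<union> ?W = ?B1" using A1 A2 by auto
    then have "m r s = 1" using A1 A2 V f c dB1 fin by (intro small_pair[of "A2 - A1" ?W]) auto
    then show ?thesis by simp
  qed
qed

end

text \<open>The assumption says that none of the three pairings of the edges at any vertex yields a
  tight graph on the remaining vertices.\<close>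

locale bad_wgraph = tight_wgraph +
  assumes card6: "6 \<le> card V"
    and bad: "nbrs v p q r s \<Longrightarrow> \<exists>A. A \<subseteq> V - {v} \<and> p \<in> A \<and> q \<in> A \<and> r \<notin> A \<and> s \<notin> A \<and> d A \<le> 6"
begin

lemma two_pairings:
  assumes n: "nbrs v p q r s"
  shows "m p q = 1 \<or> m r s = 1 \<or> m p r = 1 \<or> m q s = 1"
proof -
  obtain A1 where "A1 \<subseteq> V - {v}" "p \<in> A1" "q \<in> A1" "r \<notin> A1" "s \<notin> A1" "d A1 \<le> 6"
    using bad[OF n] by blast
  moreover obtain A2 where "A2 \<subseteq> V - {v}" "p \<in> A2" "r \<in> A2" "q \<notin> A2" "s \<notin> A2" "d A2 \<le> 6"
    using bad[OF nbrs_swap(2)[OF n]] by blast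
  ultimately show ?thesis by (rule two_bad_pairings[OF n])
qed

text \<open>By \<open>two_pairings\<close> at least two of the three perfect matchings of the
  neighbours contain an edge of the graph, and edges from different matchings share an end.\<close>

lemma two_edges_star:
  assumes n: "nbrs v p q r s"
  shows "\<exists>p q r s. nbrs v p q r s \<and> m p q = 1 \<and> m p r = 1"
proof -
  have perms: "nbrs v p q r s" "nbrs v p q s r" "nbrs v p r q s" "nbrs v p r s q" "nbrs v p s q r" "nbrs v p s r q"
    "nbrs v q p r s" "nbrs v q p s r" "nbrs v q r p s" "nbrs v q r s p" "nbrs v q s p r" "nbrs v q s r p"
    "nbrs v r p q s" "nbrs v r p s q" "nbrs v r q p s" "nbrs v r q s p" "nbrs v r s p q" "nbrs v r s q p"
    "nbrs v s p q r" "nbrs v s p r q" "nbrs v s q p r" "nbrs v s q r p" "nbrs v s r p q" "nbrs v s r q p"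
    using n unfolding nbrs_def by auto
  have s: "m q p = m p q" "m r p = m p r" "m s p = m p s" "m r q = m q r" "m s q = m q s" "m s r = m r s"
    by (rule sym)+
  show ?thesis
    using two_pairings[of v p q r s] two_pairings[of v p q s r] two_pairings[of v p r s q] perms s
    by metis
qed

text \<open>Let \<open>A\<close> obstruct the pairing of \<open>p\<close> with \<open>s\<close>. As
  \<open>p\<close> has at most one edge into the rest of \<open>A\<close>, removing \<open>p\<close>
  makes the cut too small for tightness. So the rest is \<open>{s}\<close>, and the small cut of
  \<open>{p, s}\<close> forces an edge.\<close>

lemma star:
  assumes v: "v \<in> V"
  shows "\<exists>p q r s. nbrs v p q r s \<and> m p q = 1 \<and> m p r = 1 \<and> m p s = 1"
proof -
  obtain p q r s where n: "nbrs v p q r s" "m p q = 1" "m p r = 1"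
    using nbrs_ex[OF v] two_edges_star by blast
  obtain A where A: "A \<subseteq> V - {v}" "p \<in> A" "s \<in> A" "q \<notin> A" "r \<notin> A" "d A \<le> 6"
    using bad[OF nbrs_swap(2)[OF nbrs_swap(3)[OF n(1)]]] by blast
  let ?B = "A - {p}"
  have V: "v \<in> V" "p \<in> V" "q \<in> V" "r \<in> V" "s \<in> V" "v \<noteq> p" "v \<noteq> q" "v \<noteq> r" "q \<noteq> r" "p \<noteq> s" "p \<noteq> q"
    using n(1) by (auto simp: nbrs_def)
  have "v \<notin> A" using A(1) by auto
  have "m p v = 1" using n(1) sym[of p v] by (simp add: nbrs_def)
  moreover have "e p (insert v (insert q (insert r ?B))) = m p v + (m p q + (m p r + e p ?B))"
    using V A \<open>v \<notin> A\<close> by (simp add: e_insert)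
  ultimately have e1: "e p ?B \<le> 1"
    using e_le[OF V(2), of "insert v (insert q (insert r ?B))"] n by simp
  have iB: "insert p ?B = A" using A by auto
  have "d A + 2 * e p ?B = d ?B + 4" using d_insert[of p ?B] V unfolding iB by simp
  then have dB: "\<not> 6 \<le> d ?B" using e1 A(6) by linarith
  have finB: "finite ?B" "finite A" using finite_subset[OF A(1)] fin by auto
  have "card {v, p} \<le> card (V - ?B)" using V A fin by (intro card_mono) auto
  then have "\<not> 2 \<le> card ?B" using tight[of ?B] dB A(1) V by auto
  then have "card {p} \<le> 1" "card ?B \<le> 1" by auto
  then have "m p s = 1" using V A finB iB by (intro small_pair[of "{p}" ?B]) auto
  then show ?thesis using n by blast
qed

text \<open>A neighbour \<open>p\<close> of \<open>v\<close> adjacent to the other three has the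
  same closed neighbourhood as \<open>v\<close>. The same configuration at \<open>q\<close> yields
  an edge from \<open>q\<close> to \<open>r\<close> or \<open>s\<close>, hence four mutually
  adjacent vertices.\<close>

lemma contradiction: False
proof -
  have "V \<noteq> {}" using card6 by auto
  then obtain v where v: "v \<in> V" by blast
  obtain p q r s where n: "nbrs v p q r s" and pe: "m p q = 1" "m p r = 1" "m p s = 1"
    using star[OF v] by blast
  have V: "p \<in> V" "q \<in> V" "r \<in> V" "s \<in> V" "v \<noteq> p" "v \<noteq> q" "v \<noteq> r" "v \<noteq> s" "p \<noteq> q" "p \<noteq> r" "p \<noteq> s" "q \<noteq> r" "q \<noteq> s"
    and ve: "m v p = 1" "m v q = 1" "m v r = 1" "m v s = 1"
    using n by (auto simp: nbrs_def)
  have np: "nbrs p v q r s" using n pe sym[of p v] by (auto simp: nbrs_def)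
  \<comment> \<open>Four mutually adjacent vertices have only four edges to the outside, and six
    vertices leave an outside large enough for tightness to apply. The complete graph on five
    vertices escapes here.\<close>
  have four: False if z: "z \<in> {r, s}" "m q z = 1" for z
  proof -
    have zV: "z \<in> V" "z \<noteq> v" "z \<noteq> p" "z \<noteq> q" "m v z = 1" "m p z = 1" using z V ve pe by auto
    have "d {z} = 4" using d_insert[of z "{}"] zV by (simp add: d_empty e_empty)
    moreover have "d {q, z} + 2 * e q {z} = d {z} + 4" using V zV by (intro d_insert) auto
    moreover have "d {p, q, z} + 2 * e p {q, z} = d {q, z} + 4" using V zV by (intro d_insert) auto
    moreover have "d {v, p, q, z} + 2 * e v {p, q, z} = d {p, q, z} + 4" using v V zV by (intro d_insert) auto
    moreover have "e q {z} = 1" "e p {q, z} = 2" "e v {p, q, z} = 3"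
      using v V zV ve pe z(2) by (simp_all add: e_insert e_empty)
    ultimately have d4: "d {v, p, q, z} = 4" by linarith
    have "card {v, p, q, z} = 4" using v V zV by auto
    moreover have "card (V - {v, p, q, z}) = card V - card {v, p, q, z}"
      using v V zV fin by (intro card_Diff_subset) auto
    ultimately have "6 \<le> d {v, p, q, z}" using v V zV card6 by (intro tight) auto
    with d4 show False by simp
  qed
  obtain p' a b c where nq: "nbrs q p' a b c" and pe': "m p' a = 1" "m p' b = 1" "m p' c = 1"
    using star[OF V(2)] by blast
  have V': "p' \<in> V" "a \<in> V" "b \<in> V" "c \<in> V" "distinct [q, p', a, b, c]" using nq by (auto simp: nbrs_def)
  have vq: "v \<in> {p', a, b, c}" "p \<in> {p', a, b, c}"
    using nbrs_1D[OF nq v] nbrs_1D[OF nq V(1)] ve(2) pe(1) sym[of q] by auto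
  have fin4: "r \<in> {a, b, c}" if "{a, b, c} \<subseteq> {x, r, s}" for x
  proof -
    have "card {a, b, c} = 3" using V' by auto
    moreover have "card {x, r, s} \<le> 3" by (simp add: card_insert_le_m1)
    ultimately have "card {x, r, s} \<le> card {a, b, c}" by linarith
    from card_seteq[OF _ that this] show ?thesis by blast
  qed
  have qabc: "m q a = 1" "m q b = 1" "m q c = 1" "m q p' = 1" using nq by (auto simp: nbrs_def)
  consider "p' = v" | "p' = p" | "p' \<noteq> v" "p' \<noteq> p" by blast
  then show False
  proof cases
    case 1
    have "{a, b, c} \<subseteq> {p, r, s}"
      using nbrs_1D[OF n V'(2)] nbrs_1D[OF n V'(3)] nbrs_1D[OF n V'(4)] pe' V'(5) 1 by auto
    then have "m q r = 1" using fin4 qabc by blast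
    then show False using four by blast
  next
    case 2
    have "{a, b, c} \<subseteq> {v, r, s}"
      using nbrs_1D[OF np V'(2)] nbrs_1D[OF np V'(3)] nbrs_1D[OF np V'(4)] pe' V'(5) 2 by auto
    then have "m q r = 1" using fin4 qabc by blast
    then show False using four by blast
  next
    case 3
    then have "v \<in> {a, b, c}" using vq by blast
    then have "m v p' = 1" using pe' sym[of v] by auto
    then have "p' \<in> {p, q, r, s}" by (rule nbrs_1D[OF n V'(1)])
    then have "p' \<in> {r, s}" using 3 V'(5) by auto
    then show False using four qabc(4) by blast
  qed
qed

end

section \<open>The multigraph of a word\<close>

lemma wt_sum: "finite I \<Longrightarrow> wt (\<lambda>a b. \<Sum>i\<in>I. f i a b) xs = (\<Sum>i\<in>I. wt (f i) xs)"
  by (induction "\<lambda>a b. \<Sum>i\<in>I. f i a b" xs rule: wt.induct) (simp_all add: sum.distrib)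

lemma cyc_sum: "finite I \<Longrightarrow> cyc (\<lambda>a b. \<Sum>i\<in>I. f i a b) D = (\<Sum>i\<in>I. cyc (f i) D)"
  by (simp add: cyc_def wt_sum)

lemma wt_scale: "wt (\<lambda>a b. c * f a b) xs = c * wt f xs"
  by (induction f xs rule: wt.induct) (simp_all add: algebra_simps)

lemma cyc_scale: "cyc (\<lambda>a b. c * f a b) D = c * cyc f D"
  by (simp add: cyc_def wt_scale)

text \<open>The multiplicity of an edge in the multigraph of which \<open>D\<close> is a closed
  Euler trail; loops are set to 0.\<close>

definition mult :: "'a list \<Rightarrow> 'a \<Rightarrow> 'a \<Rightarrow> nat" where
  "mult D x y = (if x = y then 0 else cyc (\<lambda>a b. of_bool ({a, b} = {x, y})) D)"

lemma edge_indicator: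
  assumes "finite V" "a \<in> V" "b \<in> V"
  shows "(\<Sum>x\<in>V. \<Sum>y\<in>V. of_bool (x \<in> A \<and> y \<notin> A) * of_bool ({a, b} = {x, y})) = (of_bool ((a \<in> A) \<noteq> (b \<in> A)) :: nat)"
proof -
  have delta: "(\<Sum>x\<in>V. \<Sum>y\<in>V. if x = c then if y = d then 1 else 0 else 0) = (1 :: nat)"
    if "c \<in> V" "d \<in> V" for c d
  proof -
    have "(\<Sum>x\<in>V. \<Sum>y\<in>V. if x = c then if y = d then 1 else 0 else (0::nat)) = (\<Sum>x\<in>V. if x = c then 1 else 0)"
      using assms(1) that by (intro sum.cong refl) simp
    then show ?thesis using assms(1) that by simp
  qed
  consider "(a \<in> A) = (b \<in> A)" | "a \<in> A" "b \<notin> A" | "a \<notin> A" "b \<in> A" by blast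
  then show ?thesis
  proof cases
    case 1
    then have eq: "(of_bool (x \<in> A \<and> y \<notin> A) * of_bool ({a, b} = {x, y}) :: nat) = 0" for x y
      by (auto simp: doubleton_eq_iff)
    show ?thesis unfolding eq using 1 by simp
  next
    case 2
    then have eq: "(of_bool (x \<in> A \<and> y \<notin> A) * of_bool ({a, b} = {x, y}) :: nat) = (if x = a then if y = b then 1 else 0 else 0)" for x y
      by (auto simp: doubleton_eq_iff)
    show ?thesis unfolding eq delta[OF assms(2,3)] using 2 by simp
  next
    case 3
    then have eq: "(of_bool (x \<in> A \<and> y \<notin> A) * of_bool ({a, b} = {x, y}) :: nat) = (if x = b then if y = a then 1 else 0 else 0)" for x y
      by (auto simp: doubleton_eq_iff)
    show ?thesis unfolding eq delta[OF assms(3,2)] using 3 by simp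
  qed
qed

lemma cut_mult: "(\<Sum>x\<in>set D. \<Sum>y\<in>set D. of_bool (x \<in> A \<and> y \<notin> A) * mult D x y) = cut D A"
proof -
  let ?V = "set D"
  have "of_bool (x \<in> A \<and> y \<notin> A) * mult D x y =
      cyc (\<lambda>a b. of_bool (x \<in> A \<and> y \<notin> A) * of_bool ({a, b} = {x, y})) D" for x y
    unfolding cyc_scale mult_def by auto
  then have "(\<Sum>x\<in>?V. \<Sum>y\<in>?V. of_bool (x \<in> A \<and> y \<notin> A) * mult D x y) =
      cyc (\<lambda>a b. \<Sum>x\<in>?V. \<Sum>y\<in>?V. of_bool (x \<in> A \<and> y \<notin> A) * of_bool ({a, b} = {x, y})) D"
    by (simp only: cyc_sum finite_set)
  also have "\<dots> = cut D A"
    unfolding cut_def by (intro cyc_cong edge_indicator) auto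
  finally show ?thesis .
qed

lemma cut_single_le:
  assumes "dow D" "x \<in> set D"
  shows "cut D {x} \<le> 4"
proof -
  obtain A B C where D: "D = A @ [x] @ B @ [x] @ C" "x \<notin> set A" "x \<notin> set B" "x \<notin> set C"
    using dow_split[OF assms] by metis
  have "dihedral D ([x] @ B @ [x] @ (C @ A))" unfolding D(1) using dihedral_rot[of A "[x] @ B @ [x] @ C"] by simp
  from cut_dihedral[OF this, of "{x}"] show ?thesis
    using cut_four_blocks[of "[x]" "[x]" "{x}" B "C @ A"] D by auto
qed

lemma singleton_neq: "2 \<le> card S \<Longrightarrow> {x} \<noteq> S"
  by auto

text \<open>The degree of a vertex is the cut of its singleton, which is at most 4 in every double
  occurrence word and at least 4 by tightness.\<close>

lemma tight_wgraph_words: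
  assumes t: "tight D" and card: "4 \<le> card (set D)"
  shows "tight_wgraph (set D) (mult D)"
proof -
  have d: "dow D" using t by (simp add: tight_def)
  have sing: "cut D {x} = 4" if "x \<in> set D" for x
  proof -
    have "{x} \<noteq> set D" using card by (intro singleton_neq) simp
    then show ?thesis using cut_single_le[OF d that] tightD1[OF t, of "{x}"] that by simp
  qed
  have w: "wgraph (set D) (mult D)"
  proof
    fix x y show "mult D x y = mult D y x" by (auto simp: mult_def insert_commute)
  next
    fix x assume x: "x \<in> set D"
    have "(\<Sum>a\<in>set D. \<Sum>y\<in>set D. of_bool (a \<in> {x} \<and> y \<notin> {x}) * mult D a y)
       = (\<Sum>a\<in>set D. if a = x then (\<Sum>y\<in>set D. mult D x y) else 0)"
    proof (intro sum.cong refl)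
      fix a
      show "(\<Sum>y\<in>set D. of_bool (a \<in> {x} \<and> y \<notin> {x}) * mult D a y) =
          (if a = x then (\<Sum>y\<in>set D. mult D x y) else 0)"
      proof (cases "a = x")
        case True
        then have eq: "of_bool (a \<in> {x} \<and> y \<notin> {x}) * mult D a y = mult D x y" for y
          by (auto simp: mult_def)
        show ?thesis unfolding eq using True by simp
      qed simp
    qed
    also have "\<dots> = (\<Sum>y\<in>set D. mult D x y)" using x by simp
    finally show "(\<Sum>y\<in>set D. mult D x y) = 4" unfolding cut_mult using sing[OF x] by simp
  qed (auto simp: mult_def)
  interpret wgraph "set D" "mult D" by (rule w)
  have dc: "d A = cut D A" for A unfolding d_def by (rule cut_mult)
  show ?thesis
    by unfold_locales (use card tightD2[OF t] dc in auto)
qed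

text \<open>The smoothing at \<open>v\<close> that joins \<open>p\<close> to \<open>q\<close> and \<open>r\<close> to \<open>s\<close> lowers the cuts below by two.\<close>

definition good :: "'a list \<Rightarrow> 'a \<Rightarrow> 'a \<Rightarrow> 'a \<Rightarrow> 'a \<Rightarrow> 'a \<Rightarrow> bool" where
  "good D v p q r s = ((\<forall>A. A \<subseteq> set D - {v} \<longrightarrow> p \<in> A \<longrightarrow> q \<in> A \<longrightarrow> r \<notin> A \<longrightarrow> s \<notin> A \<longrightarrow> 8 \<le> cut D A) \<and>
    (\<forall>A. A \<subseteq> set D - {v} \<longrightarrow> r \<in> A \<longrightarrow> s \<in> A \<longrightarrow> p \<notin> A \<longrightarrow> q \<notin> A \<longrightarrow> 8 \<le> cut D A))"

lemma good_perms: "good D v p q r s \<Longrightarrow> good D v q p r s" "good D v p q r s \<Longrightarrow> good D v p q s r"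
  "good D v p q r s \<Longrightarrow> good D v r s p q"
  unfolding good_def by blast+

lemma good_cong: "set D = set E \<Longrightarrow> (\<And>A. cut D A = cut E A) \<Longrightarrow> good D v p q r s = good E v p q r s"
  by (simp add: good_def)

text \<open>If all pairings failed, the multigraph would be a \<open>bad_wgraph\<close>. A failure
  on the side of \<open>r\<close> and \<open>s\<close> is moved to that of \<open>p\<close> and
  \<open>q\<close> by \<open>flip_side\<close>; cuts are even, so less than 8 means at most
  6.\<close>

lemma good_pairing_ex:
  assumes t: "tight D" and card: "6 \<le> card (set D)"
  shows "\<exists>v p q r s. wgraph.nbrs (set D) (mult D) v p q r s \<and> good D v p q r s"
proof (rule ccontr)
  assume no: "\<not> (\<exists>v p q r s. wgraph.nbrs (set D) (mult D) v p q r s \<and> good D v p q r s)"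
  interpret tight_wgraph "set D" "mult D" by (rule tight_wgraph_words) (use assms in auto)
  have dc: "d A = cut D A" for A unfolding d_def by (rule cut_mult)
  have ev: "cut D A \<le> 6" if "\<not> 8 \<le> cut D A" for A
    using that even_cut[of D A] by presburger
  have "bad_wgraph (set D) (mult D)"
  proof
    show "6 \<le> card (set D)" by (rule card)
    fix v p q r s assume n: "nbrs v p q r s"
    then have "\<not> good D v p q r s" using no by blast
    then consider A where "A \<subseteq> set D - {v}" "p \<in> A" "q \<in> A" "r \<notin> A" "s \<notin> A" "\<not> 8 \<le> cut D A"
      | A where "A \<subseteq> set D - {v}" "r \<in> A" "s \<in> A" "p \<notin> A" "q \<notin> A" "\<not> 8 \<le> cut D A"
      unfolding good_def by blast
    then show "\<exists>A. A \<subseteq> set D - {v} \<and> p \<in> A \<and> q \<in> A \<and> r \<notin> A \<and> s \<notin> A \<and> d A \<le> 6"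
    proof cases
      case 1
      then show ?thesis using ev dc by metis
    next
      case (2 A)
      have n': "nbrs v r s p q" using n by (auto simp: nbrs_def)
      have "d (set D - {v} - A) \<le> 6"
        using flip_side[OF n' 2(1-5)] ev[OF 2(6)] dc by simp
      moreover have "set D - {v} - A \<subseteq> set D - {v}" "p \<in> set D - {v} - A" "q \<in> set D - {v} - A"
        using n 2 by (auto simp: nbrs_def)
      ultimately show ?thesis using 2(2,3) by (intro exI[of _ "set D - {v} - A"]) auto
    qed
  qed
  then show False by (rule bad_wgraph.contradiction)
qed

section \<open>Smoothing and local complementation in words\<close>

lemma cyc_chord:
  assumes "X \<noteq> []" "Y \<noteq> []"
  shows "cyc f ([v] @ X @ [v] @ Y) = wt f X + wt f Y + (f v (hd X) + f (last X) v + f v (hd Y) + f (last Y) v)"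
  using assms wt_append[of "[v]" "X @ [v] @ Y" f] wt_append[of X "[v] @ Y" f] wt_append[of "[v]" Y f]
  by (simp add: cyc_eq)

text \<open>Reversing one side of \<open>v\<close> gives another Euler trail of the same
  multigraph.\<close>

lemma cut_local_complement:
  assumes "X \<noteq> []" "Y \<noteq> []"
  shows "cut ([v] @ rev X @ [v] @ Y) A = cut ([v] @ X @ [v] @ Y) A"
proof -
  let ?f = "\<lambda>x y. of_bool ((x \<in> A) \<noteq> (y \<in> A)) :: nat"
  have w: "wt ?f (rev X) = wt ?f X" by (rule wt_rev) auto
  have ne: "rev X \<noteq> []" using assms by simp
  show ?thesis
    unfolding cut_def cyc_chord[OF assms] cyc_chord[OF ne assms(2)] w
    using assms by (simp add: hd_rev last_rev)
qed

lemma tight_sides_nonempty: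
  assumes t: "tight ([v] @ X @ [v] @ Y)" and card: "2 \<le> card (set ([v] @ X @ [v] @ Y))"
  shows "X \<noteq> []" "Y \<noteq> []"
proof -
  let ?D = "[v] @ X @ [v] @ Y"
  have d: "dow ?D" using t by (simp add: tight_def)
  then have n: "v \<notin> set X" "v \<notin> set Y" by (auto simp: dow_def count_list_0_iff)
  have "{v} \<noteq> set ?D" by (rule singleton_neq[OF card])
  then have 4: "4 \<le> cut ?D {v}" using tightD1[OF t, of "{v}"] by simp
  have c2: "cut ([v, v] @ Z) {v} \<le> 2" if "v \<notin> set Z" for Z
    using that by (intro cut_two_blocks) auto
  show "X \<noteq> []" using 4 c2[OF n(2)] by auto
  show "Y \<noteq> []" using 4 c2[OF n(1)] cut_rot[of "[v] @ X" "[v]" "{v}"] by auto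
qed

lemma mset_local_complement: "mset ([v] @ rev X @ [v] @ Y) = mset ([v] @ X @ [v] @ Y)"
  by simp

lemma tight_local_complement:
  assumes t: "tight ([v] @ X @ [v] @ Y)" and ne: "X \<noteq> []" "Y \<noteq> []"
  shows "tight ([v] @ rev X @ [v] @ Y)"
  using t mset_dow[OF mset_local_complement[of v X Y]] unfolding tight_def cut_local_complement[OF ne] by simp

lemma filter_neq: "v \<notin> set X \<Longrightarrow> filter (\<lambda>x. x \<noteq> v) X = X"
  by (rule filter_True) auto

text \<open>Deleting \<open>v\<close> joins \<open>last X\<close> to \<open>hd Y\<close> and
  \<open>last Y\<close> to \<open>hd X\<close>. The new cut of \<open>A\<close> is the smaller of
  the cuts of \<open>A\<close> and \<open>insert v A\<close> in \<open>D\<close>, except when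
  \<open>A\<close> contains one joined pair and misses the other. Then it is smaller by 2, which the
  bound 8 in \<open>good\<close> absorbs.\<close>

lemma tight_smoothing:
  assumes t: "tight D" and D: "D = [v] @ X @ [v] @ Y" and ne: "X \<noteq> []" "Y \<noteq> []"
    and dist: "distinct [hd X, last X, hd Y, last Y]"
    and good: "good D v (hd X) (last Y) (last X) (hd Y)"
  shows "tight (X @ Y)"
proof -
  have d: "dow D" using t by (simp add: tight_def)
  then have n: "v \<notin> set X" "v \<notin> set Y" unfolding D by (auto simp: dow_def count_list_0_iff)
  have sD: "set D = insert v (set (X @ Y))" unfolding D by auto
  have dXY: "dow (X @ Y)"
  proof -
    have "filter (\<lambda>x. x \<noteq> v) D = X @ Y" using n by (simp add: D filter_neq)
    then show ?thesis using dow_filter[OF d] by metis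
  qed
  have ends: "hd X \<in> set (X @ Y)" "last X \<in> set (X @ Y)" "hd Y \<in> set (X @ Y)" "last Y \<in> set (X @ Y)"
    using ne by auto
  have nv: "hd X \<noteq> v" "last X \<noteq> v" "hd Y \<noteq> v" "last Y \<noteq> v" using ends n by auto
  have key: "4 \<le> cut (X @ Y) A \<and> (2 \<le> card A \<longrightarrow> 2 \<le> card (set (X @ Y) - A) \<longrightarrow> 6 \<le> cut (X @ Y) A)"
    if A: "A \<subseteq> set (X @ Y)" "A \<noteq> {}" "A \<noteq> set (X @ Y)" for A
  proof -
    let ?f = "\<lambda>A x y. of_bool ((x \<in> A) \<noteq> (y \<in> A)) :: nat"
    define w where "w = wt (?f A) X + wt (?f A) Y"
    have vA: "v \<notin> A" using A(1) n by auto
    have w2: "wt (?f (insert v A)) X + wt (?f (insert v A)) Y = w"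
      unfolding w_def using n by (intro arg_cong2[of _ _ _ _ "(+)"] wt_cong) auto
    have c1: "cut D A = w + (of_bool (hd X \<in> A) + of_bool (last X \<in> A) + of_bool (hd Y \<in> A) + of_bool (last Y \<in> A))"
      unfolding cut_def D cyc_chord[OF ne] w_def using vA by simp
    have c2: "cut D (insert v A) = w + (of_bool (hd X \<notin> A) + of_bool (last X \<notin> A) + of_bool (hd Y \<notin> A) + of_bool (last Y \<notin> A))"
      unfolding cut_def D cyc_chord[OF ne] w2 using nv by simp
    have c3: "cut (X @ Y) A = w + of_bool ((last X \<in> A) \<noteq> (hd Y \<in> A)) + of_bool ((last Y \<in> A) \<noteq> (hd X \<in> A))"
      unfolding cut_def cyc_append[OF ne] w_def by simp
    have A': "A \<subseteq> set D" "A \<noteq> set D" "insert v A \<subseteq> set D" "insert v A \<noteq> set D" "A \<subseteq> set D - {v}"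
      using A sD vA n by auto
    have four: "4 \<le> cut D A" "4 \<le> cut D (insert v A)"
      using tightD1[OF t, of A] tightD1[OF t, of "insert v A"] A A' by auto
    have g: "8 \<le> cut D A" if "hd X \<in> A" "last Y \<in> A" "last X \<notin> A" "hd Y \<notin> A"
      using good that A'(5) by (auto simp: good_def)
    have g': "8 \<le> cut D A" if "hd X \<notin> A" "last Y \<notin> A" "last X \<in> A" "hd Y \<in> A"
      using good that A'(5) by (auto simp: good_def)
    have finA: "finite A" using A(1) finite_subset by blast
    have six: "6 \<le> cut D A" "6 \<le> cut D (insert v A)" if c: "2 \<le> card A" "2 \<le> card (set (X @ Y) - A)"
    proof -
      have "set D - insert v A = set (X @ Y) - A" using sD n by auto
      moreover have "card (insert v A) = Suc (card A)" using finA vA by simp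
      ultimately show "6 \<le> cut D (insert v A)" using tightD2[OF t A'(3)] c by simp
      have "set (X @ Y) - A \<subseteq> set D - A" using sD by auto
      then have "card (set (X @ Y) - A) \<le> card (set D - A)" by (intro card_mono) auto
      then show "6 \<le> cut D A" using tightD2[OF t A'(1)] c by simp
    qed
    show ?thesis
    proof (intro conjI impI)
      show "4 \<le> cut (X @ Y) A"
        using four g g' unfolding c1 c2 c3
        by (cases "hd X \<in> A"; cases "last X \<in> A"; cases "hd Y \<in> A"; cases "last Y \<in> A") simp_all
      assume "2 \<le> card A" "2 \<le> card (set (X @ Y) - A)"
      from six[OF this] show "6 \<le> cut (X @ Y) A"
        using g g' unfolding c1 c2 c3
        by (cases "hd X \<in> A"; cases "last X \<in> A"; cases "hd Y \<in> A"; cases "last Y \<in> A") simp_all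
    qed
  qed
  show ?thesis
    unfolding tight_def
  proof (intro conjI allI impI dXY)
    fix A assume "A \<subseteq> set (X @ Y)" "A \<noteq> {}" "A \<noteq> set (X @ Y)"
    then show "4 \<le> cut (X @ Y) A" using key by blast
  next
    fix A assume A: "A \<subseteq> set (X @ Y)" "2 \<le> card A" "2 \<le> card (set (X @ Y) - A)"
    then have "A \<noteq> {}" "A \<noteq> set (X @ Y)" by auto
    then show "6 \<le> cut (X @ Y) A" using key A by blast
  qed
qed

definition rigid :: "'a list \<Rightarrow> bool" where
  "rigid D = (\<forall>E. same_graph D E \<longrightarrow> dihedral D E)"

lemma rigid_dihedral:
  assumes "dow D" "dihedral D E" "rigid D"
  shows "rigid E"
  unfolding rigid_def
proof (intro allI impI)
  fix F assume "same_graph E F"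
  then have "dihedral D F" using assms(3) same_graph_trans[OF dihedral_same_graph[OF assms(1,2)]] by (simp add: rigid_def)
  then show "dihedral E F" using dihedral_sym[OF assms(2)] dihedral_trans by blast
qed

text \<open>Tightness is used twice: it turns the mutations of the shorter diagrams into symmetries
  of the circle, as \<open>reinsert\<close> requires, and then does the same for the mutations that
  \<open>reinsert\<close> returns.\<close>

lemma rigid_delete:
  fixes D :: "'a list"
  assumes IH: "\<And>D' E' :: 'a list. length D' < length D \<Longrightarrow> same_graph D' E' \<Longrightarrow> meq D' E'"
    and D: "D = [v] @ X @ [v] @ Y" and t: "tight D" "tight (X @ Y)"
  shows "rigid D"
  unfolding rigid_def
proof (intro allI impI)
  fix E assume same: "same_graph D E"
  have d: "dow D" using t by (simp add: tight_def)
  then have n: "v \<notin> set X" "v \<notin> set Y" unfolding D by (auto simp: dow_def count_list_0_iff)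
  have f: "filter (\<lambda>x. x \<noteq> v) D = X @ Y" using n by (simp add: D filter_neq)
  have "meq (X @ Y) (filter (\<lambda>x. x \<noteq> v) E)"
    using IH[of "X @ Y"] same_graph_filter[OF same, of "\<lambda>x. x \<noteq> v"] unfolding f by (simp add: D)
  then have "dihedral (X @ Y) (filter (\<lambda>x. x \<noteq> v) E)" by (rule tight_meq_dihedral[OF t(2)])
  then have "meq D E" using reinsert[OF same, of v] unfolding f by (simp add: D)
  then show "dihedral D E" by (rule tight_meq_dihedral[OF t(1)])
qed

lemma two_letter_rev:
  assumes "set L \<subseteq> {x, y}" "set M \<subseteq> {x, y}" "x \<noteq> y"
    and "count_list L x + count_list M x = 2" "count_list L y + count_list M y = 2"
  shows "(rev L @ M \<in> {[x, y, x, y], [y, x, y, x]}) =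
    ((L @ M \<in> {[x, y, x, y], [y, x, y, x]}) \<noteq> (count_list L x = 1 \<and> count_list L y = 1))"
proof -
  have len: "length Z = count_list Z x + count_list Z y" if "set Z \<subseteq> {x, y}" for Z
    using that assms(3) by (induction Z) auto
  then have "length (L @ M) = 4" using assms len[of L] len[of M] by simp
  moreover have "\<exists>a b c d. Z = [a, b, c, d]" if "length Z = 4" for Z :: "'a list"
    using that by (auto simp: length_Suc_conv eval_nat_numeral)
  ultimately obtain a b c d where LM: "L @ M = [a, b, c, d]" by blast
  have "set (L @ M) \<subseteq> {x, y}" using assms by auto
  then have abcd: "a \<in> {x, y}" "b \<in> {x, y}" "c \<in> {x, y}" "d \<in> {x, y}" unfolding LM by auto
  from LM consider "L = []" "M = [a, b, c, d]" | "L = [a]" "M = [b, c, d]" | "L = [a, b]" "M = [c, d]"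
    | "L = [a, b, c]" "M = [d]" | "L = [a, b, c, d]" "M = []"
    by (auto simp: append_eq_Cons_conv)
  then show ?thesis
    using abcd assms(3-) by cases (elim insertE emptyE; simp)+
qed

text \<open>Reversing one side of \<open>v\<close> is local complementation of the intersection
  graph: it toggles the adjacency of any two neighbours of \<open>v\<close>.\<close>

lemma crosses_local_complement:
  assumes d: "dow ([v] @ X @ [v] @ Y)" and n: "x \<noteq> v" "y \<noteq> v" "x \<noteq> y"
  shows "crosses ([v] @ rev X @ [v] @ Y) x y =
    (crosses ([v] @ X @ [v] @ Y) x y \<noteq> (count_list X x = 1 \<and> count_list X y = 1))"
proof -
  let ?D = "[v] @ X @ [v] @ Y" and ?P = "\<lambda>z. z = x \<or> z = y"
  have f: "filter ?P ([v] @ rev X @ [v] @ Y) = rev (filter ?P X) @ filter ?P Y"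
    "filter ?P ?D = filter ?P X @ filter ?P Y" using n by (simp_all add: rev_filter)
  have c: "count_list (filter ?P Z) x = count_list Z x" "count_list (filter ?P Z) y = count_list Z y" for Z
    by (simp_all add: count_list_filter_if)
  show ?thesis
  proof (cases "x \<in> set ?D \<and> y \<in> set ?D")
    case True
    then have "count_list ?D x = 2" "count_list ?D y = 2" using d unfolding dow_def by blast+
    then have "count_list X x + count_list Y x = 2" "count_list X y + count_list Y y = 2" using n by simp_all
    then show ?thesis
      unfolding crosses_def f using two_letter_rev[of "filter ?P X" x y "filter ?P Y"] n c by auto
  next
    case False
    then have "\<not> crosses ?D x y" "\<not> crosses ([v] @ rev X @ [v] @ Y) x y"
      using crosses_in[of ?D x y] crosses_in[of "[v] @ rev X @ [v] @ Y" x y] by auto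
    moreover have "count_list X x = 0 \<or> count_list X y = 0" using False by (auto simp: count_list_0_iff)
    ultimately show ?thesis by auto
  qed
qed

lemma same_graph_local_complement:
  assumes same: "same_graph ([v] @ X @ [v] @ Y) ([v] @ X' @ [v] @ Y')"
  shows "same_graph ([v] @ rev X @ [v] @ Y) ([v] @ rev X' @ [v] @ Y')"
proof -
  have d: "dow ([v] @ X @ [v] @ Y)" "dow ([v] @ X' @ [v] @ Y')" and s: "set ([v] @ X @ [v] @ Y) = set ([v] @ X' @ [v] @ Y')"
    and i: "\<And>x y. crosses ([v] @ X @ [v] @ Y) x y = crosses ([v] @ X' @ [v] @ Y') x y"
    using same by (auto simp: same_graph_def)
  have d': "dow ([v] @ rev X @ [v] @ Y)" "dow ([v] @ rev X' @ [v] @ Y')"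
    using d mset_dow[OF mset_local_complement[of v X Y]] mset_dow[OF mset_local_complement[of v X' Y']] by auto
  have n: "v \<notin> set X" "v \<notin> set Y" "v \<notin> set X'" "v \<notin> set Y'"
    using d by (auto simp: dow_def count_list_0_iff)
  have iv: "crosses ([v] @ X @ [v] @ Y) v x \<longleftrightarrow> count_list X x = 1" "crosses ([v] @ rev X @ [v] @ Y) v x \<longleftrightarrow> count_list X x = 1"
    "crosses ([v] @ X' @ [v] @ Y') v x \<longleftrightarrow> count_list X' x = 1" "crosses ([v] @ rev X' @ [v] @ Y') v x \<longleftrightarrow> count_list X' x = 1"
    if "x \<noteq> v" for x
    using crosses_chord[OF d(1), of "[]" v X Y x] crosses_chord[OF d(2), of "[]" v X' Y' x]
      crosses_chord[OF d'(1), of "[]" v "rev X" Y x] crosses_chord[OF d'(2), of "[]" v "rev X'" Y' x] n that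
    by simp_all
  have cX: "count_list X x = 1 \<longleftrightarrow> count_list X' x = 1" if "x \<noteq> v" for x
    using iv[OF that] i by blast
  have "crosses ([v] @ rev X @ [v] @ Y) x y = crosses ([v] @ rev X' @ [v] @ Y') x y" for x y
  proof -
    consider "x = y" | "x = v" "x \<noteq> y" | "y = v" "x \<noteq> y" | "x \<noteq> v" "y \<noteq> v" "x \<noteq> y" by blast
    then show ?thesis
    proof cases
      case 1
      then show ?thesis using crosses_neq[OF d'(1), of x y] crosses_neq[OF d'(2), of x y] by blast
    next
      case 2
      then show ?thesis using iv(2,4)[of y] cX[of y] by blast
    next
      case 3
      then show ?thesis
        using iv(2,4)[of x] cX[of x] crosses_commute[of _ x v] by blast
    next
      case 4
      then show ?thesis
        unfolding crosses_local_complement[OF d(1) 4] crosses_local_complement[OF d(2) 4] using i cX by simp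
    qed
  qed
  then show ?thesis using d' s by (auto simp: same_graph_def)
qed

lemma takeWhile_neq: "v \<notin> set a \<Longrightarrow> takeWhile (\<lambda>z. z \<noteq> v) (a @ v # b) = a"
  by (induction a) auto

text \<open>A rotation beginning with \<open>v\<close> starts at one of the two occurrences of
  \<open>v\<close>.\<close>

lemma chord_rotation_unique:
  assumes "[v] @ A @ [v] @ B = P @ Q" "Q @ P = [v] @ A' @ [v] @ B'"
    and "v \<notin> set A" "v \<notin> set B" "v \<notin> set A'" "v \<notin> set B'"
  shows "(A' = A \<and> B' = B) \<or> (A' = B \<and> B' = A)"
proof -
  have rigid: "a = a' \<and> b = b'" if "a @ [v] @ b = a' @ [v] @ b'" "v \<notin> set a" "v \<notin> set a'" for a b a' b' :: "'a list"
  proof -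
    have "takeWhile (\<lambda>z. z \<noteq> v) (a @ v # b) = a" "takeWhile (\<lambda>z. z \<noteq> v) (a' @ v # b') = a'"
      using that(2,3) by (simp_all add: takeWhile_neq)
    then show ?thesis using that(1) by auto
  qed
  show ?thesis
  proof (cases P)
    case Nil
    then have "A @ [v] @ B = A' @ [v] @ B'" using assms by auto
    then show ?thesis using rigid assms by blast
  next
    case (Cons p P')
    then have p: "p = v" "A @ [v] @ B = P' @ Q" using assms by auto
    show ?thesis
    proof (cases Q)
      case Nil
      then have "A @ [v] @ B = A' @ [v] @ B'" using assms by auto
      then show ?thesis using rigid assms by blast
    next
      case (Cons q Q')
      then have q: "q = v" "Q' @ P = A' @ [v] @ B'" using assms(2) by auto
      have eq: "A @ [v] @ B = P' @ [v] @ Q'" using p Cons q by simp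
      have "count_list (A @ [v] @ B) v = 1" using assms by (simp add: count_list_0_iff)
      then have "v \<notin> set P'" "v \<notin> set Q'" unfolding eq by (auto simp: count_list_0_iff)
      then have "A = P'" "B = Q'" using rigid[OF eq] assms by auto
      moreover have "Q' @ [v] @ P' = A' @ [v] @ B'" using q(2) \<open>P = p # P'\<close> p(1) by simp
      ultimately show ?thesis using rigid[of B A A' B'] assms by auto
    qed
  qed
qed

lemma dihedral_local_complement:
  assumes i: "dihedral ([v] @ A @ [v] @ B) ([v] @ A' @ [v] @ B')"
    and n: "v \<notin> set A" "v \<notin> set B" "v \<notin> set A'" "v \<notin> set B'"
  shows "dihedral ([v] @ rev A @ [v] @ B) ([v] @ rev A' @ [v] @ B')"
proof -
  let ?D = "[v] @ A @ [v] @ B" and ?E = "[v] @ A' @ [v] @ B'"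
  have rot: "dihedral (P @ Q) (Q @ P)" for P Q :: "'a list" by (rule dihedral_rot)
  have rv: "dihedral ([v] @ P @ [v] @ Q) ([v] @ rev Q @ [v] @ rev P)" for P Q
  proof -
    have "dihedral ([v] @ P @ [v] @ Q) (rev ([v] @ P @ [v] @ Q))" by (rule dihedral_rev)
    also have "rev ([v] @ P @ [v] @ Q) = (rev Q @ [v] @ rev P) @ [v]" by simp
    also have "dihedral \<dots> ([v] @ rev Q @ [v] @ rev P)" by (rule rot)
    finally show ?thesis .
  qed
  have sw: "dihedral ([v] @ P @ [v] @ Q) ([v] @ Q @ [v] @ P)" for P Q
    using rot[of "[v] @ P" "[v] @ Q"] by simp
  from i consider k where "?E = rotate k ?D" | k where "?E = rotate k (rev ?D)"
    unfolding dihedral_def by blast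
  then have "(A' = A \<and> B' = B) \<or> (A' = B \<and> B' = A) \<or> (A' = rev B \<and> B' = rev A) \<or> (A' = rev A \<and> B' = rev B)"
  proof cases
    case 1
    obtain P Q where PQ: "?D = P @ Q" "rotate k ?D = Q @ P" using rotate_split by metis
    have e: "Q @ P = ?E" using PQ(2) 1 by simp
    show ?thesis using chord_rotation_unique[OF PQ(1) e n] by blast
  next
    case 2
    have "rev ?D = (rev B @ [v] @ rev A) @ [v]" by simp
    then have "rev ?D = rotate (length [v]) ([v] @ rev B @ [v] @ rev A)" using rotate_append[of "[v]" "rev B @ [v] @ rev A"] by simp
    then have "?E = rotate (k + length [v]) ([v] @ rev B @ [v] @ rev A)" using 2 by (simp only: rotate_rotate)
    then obtain P Q where PQ: "[v] @ rev B @ [v] @ rev A = P @ Q" "?E = Q @ P" using rotate_split by metis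
    have "v \<notin> set (rev B)" "v \<notin> set (rev A)" using n by simp_all
    then show ?thesis using chord_rotation_unique[OF PQ(1) PQ(2)[symmetric] _ _ n(3,4)] by blast
  qed
  then show ?thesis
  proof (elim disjE conjE)
    assume "A' = B" "B' = A"
    then show ?thesis using dihedral_trans[OF rv[of "rev A" B]] by simp
  next
    assume "A' = rev B" "B' = rev A"
    then show ?thesis using sw[of "rev A" B] by simp
  next
    assume "A' = rev A" "B' = rev B"
    then show ?thesis using dihedral_trans[OF rv[of "rev A" B] sw] by simp
  qed simp
qed

text \<open>Reversing one side of \<open>v\<close> is an involution, respects equality of graphs,
  and is compatible with the symmetries of the circle, so rigidity can be pulled back along
  it.\<close>

lemma rigid_local_complement:
  assumes d: "dow ([v] @ X @ [v] @ Y)" and u: "rigid ([v] @ rev X @ [v] @ Y)"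
  shows "rigid ([v] @ X @ [v] @ Y)"
  unfolding rigid_def
proof (intro allI impI)
  let ?D = "[v] @ X @ [v] @ Y"
  fix E assume same: "same_graph ?D E"
  then have dE: "dow E" "v \<in> set E" by (auto simp: same_graph_def)
  then obtain P Q R where E: "E = P @ [v] @ Q @ [v] @ R" "v \<notin> set P" "v \<notin> set Q" "v \<notin> set R"
    using dow_split by metis
  let ?E = "[v] @ Q @ [v] @ (R @ P)"
  have i: "dihedral E ?E" using dihedral_rot[of P "[v] @ Q @ [v] @ R"] E(1) by simp
  have "same_graph ?D ?E" using same dihedral_same_graph[OF dE(1) i] same_graph_trans by blast
  then have "same_graph ([v] @ rev X @ [v] @ Y) ([v] @ rev Q @ [v] @ (R @ P))" by (rule same_graph_local_complement)
  then have "dihedral ([v] @ rev X @ [v] @ Y) ([v] @ rev Q @ [v] @ (R @ P))" using u by (simp add: rigid_def)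
  then have "dihedral ([v] @ rev (rev X) @ [v] @ Y) ([v] @ rev (rev Q) @ [v] @ (R @ P))"
  proof (rule dihedral_local_complement)
    show "v \<notin> set (rev X)" "v \<notin> set Y" using d by (auto simp: dow_def count_list_0_iff)
  qed (use E in auto)
  then show "dihedral ?D E" using dihedral_sym[OF i] dihedral_trans by simp
qed

lemma mult_chord:
  assumes "v \<notin> set X" "v \<notin> set Y" "X \<noteq> []" "Y \<noteq> []" "y \<noteq> v"
  shows "mult ([v] @ X @ [v] @ Y) v y =
    of_bool (hd X = y) + of_bool (last X = y) + of_bool (hd Y = y) + of_bool (last Y = y)"
proof -
  let ?f = "\<lambda>a b. of_bool ({a, b} = {v, y}) :: nat"
  have "wt ?f X = 0" "wt ?f Y = 0" using assms(1,2) by (auto intro!: wt_0 simp: doubleton_eq_iff)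
  then have "cyc ?f ([v] @ X @ [v] @ Y) = ?f v (hd X) + ?f (last X) v + ?f v (hd Y) + ?f (last Y) v"
    unfolding cyc_chord[OF assms(3,4)] by simp
  moreover have "?f v h = of_bool (h = y)" "?f h v = of_bool (h = y)" for h
    using assms(5) by (auto simp: doubleton_eq_iff)
  ultimately show ?thesis using assms(5) unfolding mult_def by simp
qed

section \<open>The three pairings at a chord\<close>

lemma tight_ends:
  assumes t: "tight ([v] @ X @ [v] @ Y)" and card: "4 \<le> card (set ([v] @ X @ [v] @ Y))"
  shows "distinct [hd X, last X, hd Y, last Y]"
    "\<And>y. y \<in> {hd X, last X, hd Y, last Y} \<Longrightarrow> y \<in> set ([v] @ X @ [v] @ Y) \<and> mult ([v] @ X @ [v] @ Y) v y = 1"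
proof -
  let ?D = "[v] @ X @ [v] @ Y"
  interpret tight_wgraph "set ?D" "mult ?D" by (rule tight_wgraph_words[OF t card])
  have ne: "X \<noteq> []" "Y \<noteq> []" using tight_sides_nonempty[OF t] card by auto
  have "dow ?D" using t by (simp add: tight_def)
  then have n: "v \<notin> set X" "v \<notin> set Y" by (auto simp: dow_def count_list_0_iff)
  have ends: "hd X \<in> set X" "last X \<in> set X" "hd Y \<in> set Y" "last Y \<in> set Y" using ne by auto
  have m: "of_bool (hd X = y) + of_bool (last X = y) + of_bool (hd Y = y) + of_bool (last Y = y) \<le> (1 :: nat)"
    if "y \<in> {hd X, last X, hd Y, last Y}" for y
  proof -
    have y: "y \<noteq> v" "y \<in> set ?D" using that ends n by auto
    show ?thesis using m_le_1[of v y] mult_chord[OF n ne y(1)] y(2) by simp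
  qed
  show "distinct [hd X, last X, hd Y, last Y]"
    using m[of "hd X"] m[of "last X"] m[of "hd Y"] by (auto simp: of_bool_def split: if_splits)
  fix y assume y': "y \<in> {hd X, last X, hd Y, last Y}"
  have y: "y \<noteq> v" "y \<in> set ?D" using y' ends n by auto
  have "1 \<le> mult ?D v y" using y' unfolding mult_chord[OF n ne y(1)] by auto
  then show "y \<in> set ?D \<and> mult ?D v y = 1" using m_le_1[of v y] y(2) by simp
qed

text \<open>This is the pairing realised by simply deleting \<open>v\<close> from the word.\<close>

lemma rigid_pairing1:
  fixes D :: "'a list"
  assumes IH: "\<And>D' E' :: 'a list. length D' < length D \<Longrightarrow> same_graph D' E' \<Longrightarrow> meq D' E'"
    and D: "D = [v] @ X @ [v] @ Y" and t: "tight D" and card: "4 \<le> card (set D)"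
    and good: "good D v (hd X) (last Y) (last X) (hd Y)"
  shows "rigid D"
proof -
  have ne: "X \<noteq> []" "Y \<noteq> []" using tight_sides_nonempty[of v X Y] t card D by auto
  have tXY: "tight (X @ Y)"
    using tight_ends(1)[of v X Y] t card D by (intro tight_smoothing[OF t D ne _ good]) auto
  show ?thesis by (rule rigid_delete[OF IH D t tXY])
qed

text \<open>Reversing \<open>X\<close> exchanges \<open>hd X\<close> and \<open>last X\<close>,
  which turns this pairing into the one realised by deletion.\<close>

lemma rigid_pairing2:
  fixes D :: "'a list"
  assumes IH: "\<And>D' E' :: 'a list. length D' < length D \<Longrightarrow> same_graph D' E' \<Longrightarrow> meq D' E'"
    and D: "D = [v] @ X @ [v] @ Y" and t: "tight D" and card: "4 \<le> card (set D)"
    and good: "good D v (hd X) (hd Y) (last X) (last Y)"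
  shows "rigid D"
proof -
  have ne: "X \<noteq> []" "Y \<noteq> []" using tight_sides_nonempty[of v X Y] t card D by auto
  let ?D = "[v] @ rev X @ [v] @ Y"
  have s: "set ?D = set D" "length ?D = length D" by (simp_all add: D)
  have t': "tight ?D" using tight_local_complement[OF _ ne] t D by simp
  have "good D v (last X) (last Y) (hd X) (hd Y)" by (rule good_perms(3)[OF good])
  then have "good ?D v (last X) (last Y) (hd X) (hd Y)"
    using good_cong[OF s(1), of v "last X" "last Y" "hd X" "hd Y"] cut_local_complement[OF ne] D by simp
  then have g: "good ?D v (hd (rev X)) (last Y) (last (rev X)) (hd Y)"
    using ne by (simp add: hd_rev last_rev)
  have card': "4 \<le> card (set ?D)" unfolding s(1) by (rule card)
  have IH': "\<And>D' E' :: 'a list. length D' < length ?D \<Longrightarrow> same_graph D' E' \<Longrightarrow> meq D' E'"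
    unfolding s(2) by (rule IH)
  have u: "rigid ?D" by (rule rigid_pairing1[OF IH' refl t' card' g])
  have "dow ([v] @ X @ [v] @ Y)" using t D by (simp add: tight_def)
  from rigid_local_complement[OF this u] show ?thesis by (simp add: D)
qed

text \<open>The chord \<open>v\<close> does not reach this pairing by itself; a reversal at a chord
  \<open>w\<close> crossing \<open>v\<close> interchanges the roles of \<open>last X\<close> and
  \<open>hd Y\<close>, after which \<open>rigid_pairing2\<close> applies.\<close>

lemma rigid_pairing3:
  fixes D :: "'a list"
  assumes IH: "\<And>D' E' :: 'a list. length D' < length D \<Longrightarrow> same_graph D' E' \<Longrightarrow> meq D' E'"
    and D: "D = [v] @ X @ [v] @ Y" and t: "tight D" and card: "4 \<le> card (set D)"
    and good: "good D v (hd X) (last X) (hd Y) (last Y)"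
  shows "rigid D"
proof -
  have ne: "X \<noteq> []" "Y \<noteq> []" using tight_sides_nonempty[of v X Y] t card D by auto
  have d: "dow D" using t by (simp add: tight_def)
  then have n: "v \<notin> set X" "v \<notin> set Y" unfolding D by (auto simp: dow_def count_list_0_iff)
  \<comment> \<open>Some chord crosses \<open>v\<close>, as otherwise \<open>X\<close> would be
    closed and fill a single arc.\<close>
  have "\<exists>w. count_list X w = 1 \<and> count_list Y w = 1"
  proof (rule ccontr)
    assume no: "\<not> (\<exists>w. count_list X w = 1 \<and> count_list Y w = 1)"
    have disj: "set X \<inter> set Y = {}"
      by (rule closed_from_counts[OF d, of X Y "{#v, v#}"]) (use no in \<open>auto simp: D\<close>)
    have "dihedral D (X @ ([v] @ Y @ [v]))" unfolding D using dihedral_rot[of "[v]" "X @ [v] @ Y"] by simp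
    from cut_dihedral[OF this, of "set X"] have "cut D (set X) \<le> 2"
      using cut_two_blocks[of X "set X" "[v] @ Y @ [v]"] disj n by auto
    moreover have "4 \<le> cut D (set X)" using ne n by (intro tightD1[OF t]) (auto simp: D)
    ultimately show False by simp
  qed
  then obtain w where w: "count_list X w = 1" "count_list Y w = 1" by blast
  obtain X1 X2 where X: "X = X1 @ [w] @ X2" "w \<notin> set X1" "w \<notin> set X2" by (rule count_list_1_split[OF w(1)])
  obtain Y1 Y2 where Y: "Y = Y1 @ [w] @ Y2" "w \<notin> set Y1" "w \<notin> set Y2" by (rule count_list_1_split[OF w(2)])
  let ?M = "X2 @ [v] @ Y1" and ?N = "Y2 @ [v] @ X1"
  let ?D1 = "[w] @ ?M @ [w] @ ?N" and ?D2 = "[w] @ rev ?M @ [w] @ ?N"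
  let ?X = "X1 @ [w] @ rev Y1" and ?Y = "rev X2 @ [w] @ Y2"
  let ?D3 = "[v] @ ?X @ [v] @ ?Y"
  have i1: "dihedral D ?D1" using dihedral_rot[of "[v] @ X1" "[w] @ X2 @ [v] @ Y1 @ [w] @ Y2"] by (simp add: D X Y)
  have i2: "dihedral ?D2 ?D3" using dihedral_rot[of "[w] @ rev Y1 @ [v] @ rev X2 @ [w] @ Y2" "[v] @ X1"] by simp
  have t1: "tight ?D1" by (rule tight_dihedral[OF i1 t])
  have t2: "tight ?D2" by (rule tight_local_complement[OF t1]) auto
  have t3: "tight ?D3" by (rule tight_dihedral[OF i2 t2])
  have s: "set ?D3 = set D" "length ?D3 = length D" by (auto simp: D X Y)
  have c: "cut D A = cut ?D3 A" for A
    using cut_dihedral[OF i1, of A] cut_dihedral[OF i2, of A] cut_local_complement[of ?M ?N w A] by simp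
  have e: "hd ?X = hd X" "last ?X = hd Y" "hd ?Y = last X" "last ?Y = last Y"
    unfolding X Y by (simp_all add: hd_append last_rev hd_rev)
  have g: "good ?D3 v (hd ?X) (hd ?Y) (last ?X) (last ?Y)"
    using good good_cong[OF s(1)[symmetric] c] unfolding e by blast
  have card': "4 \<le> card (set ?D3)" unfolding s(1) by (rule card)
  have IH': "\<And>D' E' :: 'a list. length D' < length ?D3 \<Longrightarrow> same_graph D' E' \<Longrightarrow> meq D' E'"
    unfolding s(2) by (rule IH)
  have "rigid ?D3" by (rule rigid_pairing2[OF IH' refl t3 card' g])
  have d1: "dow ?D1" and d3: "dow ?D3" using t1 t3 by (simp_all only: tight_def)
  from rigid_dihedral[OF d3 dihedral_sym[OF i2] \<open>rigid ?D3\<close>] have "rigid ?D2" .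
  from rigid_local_complement[OF d1 this] have "rigid ?D1" .
  from rigid_dihedral[OF d1 dihedral_sym[OF i1] this] show ?thesis .
qed

text \<open>As an unordered pairing of the four neighbours, the one supplied by
  \<open>good_pairing_ex\<close> is among the three treated above.\<close>

lemma rigid_large:
  fixes D :: "'a list"
  assumes IH: "\<And>D' E' :: 'a list. length D' < length D \<Longrightarrow> same_graph D' E' \<Longrightarrow> meq D' E'"
    and t: "tight D" and card: "6 \<le> card (set D)"
  shows "rigid D"
proof -
  obtain v p q r s where nb: "wgraph.nbrs (set D) (mult D) v p q r s" and gd: "good D v p q r s"
    using good_pairing_ex[OF t card] by blast
  have d: "dow D" using t by (simp add: tight_def)
  interpret tight_wgraph "set D" "mult D" by (rule tight_wgraph_words[OF t]) (use card in simp)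
  have vD: "v \<in> set D" using nb by (simp add: nbrs_def)
  obtain P X Q where D: "D = P @ [v] @ X @ [v] @ Q" using dow_split[OF d vD] by metis
  let ?Y = "Q @ P"
  let ?D = "[v] @ X @ [v] @ ?Y"
  have i: "dihedral D ?D" using dihedral_rot[of P "[v] @ X @ [v] @ Q"] D by simp
  have t': "tight ?D" by (rule tight_dihedral[OF i t])
  have s: "set ?D = set D" "length ?D = length D" by (auto simp: D)
  have card': "4 \<le> card (set ?D)" unfolding s(1) using card by simp
  have mm: "mult D x y = mult ?D x y" for x y
    unfolding mult_def using cyc_dihedral[OF i, of "\<lambda>a b. of_bool ({a, b} = {x, y})"] by (simp add: insert_commute)
  have gd': "good ?D v p q r s" using gd good_cong[OF s(1)[symmetric] cut_dihedral[OF i, symmetric]] by blast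
  note gp = gd' good_perms(1)[OF gd'] good_perms(2)[OF gd'] good_perms(1)[OF good_perms(2)[OF gd']]
  note gall = gp gp[THEN good_perms(3)]
  have dist: "distinct [hd X, last X, hd ?Y, last ?Y]" by (rule tight_ends(1)[OF t' card'])
  have ends: "y \<in> {p, q, r, s}" if "y \<in> {hd X, last X, hd ?Y, last ?Y}" for y
    using tight_ends(2)[OF t' card' that] nbrs_1D[OF nb, of y] mm s(1) by auto
  have e: "hd X \<in> {p, q, r, s}" "last X \<in> {p, q, r, s}" "hd ?Y \<in> {p, q, r, s}" "last ?Y \<in> {p, q, r, s}"
    using ends by blast+
  have three: "good ?D v a d b c \<or> good ?D v a c b d \<or> good ?D v a b c d"
    if "a \<in> {p, q, r, s}" "b \<in> {p, q, r, s}" "c \<in> {p, q, r, s}" "d \<in> {p, q, r, s}" "distinct [a, b, c, d]" for a b c d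
    using that gall by (elim insertE emptyE) simp_all
  have IH': "\<And>D' E' :: 'a list. length D' < length ?D \<Longrightarrow> same_graph D' E' \<Longrightarrow> meq D' E'"
    unfolding s(2) by (rule IH)
  have "rigid ?D"
    using three[OF e dist] rigid_pairing1[OF IH' refl t' card'] rigid_pairing2[OF IH' refl t' card']
      rigid_pairing3[OF IH' refl t' card'] by blast
  have d': "dow ?D" using t' by (simp only: tight_def)
  from rigid_dihedral[OF d' dihedral_sym[OF i] \<open>rigid ?D\<close>] show ?thesis .
qed

section \<open>Relabelling of chords\<close>

lemma dihedral_map:
  assumes "dihedral D E"
  shows "dihedral (map g D) (map g E)"
  using assms unfolding dihedral_def by (auto simp: rotate_map rev_map)

lemma crosses_map:
  assumes inj: "inj_on f (set D)" and xy: "x \<in> set D" "y \<in> set D"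
  shows "crosses (map f D) (f x) (f y) = crosses D x y"
proof -
  let ?P = "\<lambda>z. z = x \<or> z = y"
  have "filter (\<lambda>z. z = f x \<or> z = f y) (map f D) = map f (filter ?P D)"
    unfolding filter_map o_def using inj xy
    by (intro arg_cong[where f = "map f"] filter_cong refl) (auto dest: inj_onD)
  moreover have "map f (filter ?P D) = map f M \<longleftrightarrow> filter ?P D = M" if "set M \<subseteq> {x, y}" for M
    using inj xy that by (intro inj_on_map_eq_map) (auto simp: inj_on_def)
  from this[of "[x, y, x, y]"] this[of "[y, x, y, x]"]
  have "map f (filter ?P D) \<in> {[f x, f y, f x, f y], [f y, f x, f y, f x]} \<longleftrightarrow> filter ?P D \<in> {[x, y, x, y], [y, x, y, x]}"
    by simp
  ultimately show ?thesis unfolding crosses_def by simp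
qed

lemma dow_map: "inj_on f (set D) \<Longrightarrow> dow D \<Longrightarrow> dow (map f D)"
  unfolding dow_def by (auto simp: count_list_inj_map)

lemma same_graph_map:
  assumes inj: "inj_on f (set D)" and same: "same_graph D E"
  shows "same_graph (map f D) (map f E)"
proof -
  have s: "set E = set D" "dow D" "dow E" using same by (auto simp: same_graph_def)
  have injE: "inj_on f (set E)" using inj s by simp
  have "crosses (map f D) u v = crosses (map f E) u v" for u v
  proof (cases "u \<in> f ` set D \<and> v \<in> f ` set D")
    case True
    then obtain x y where xy: "x \<in> set D" "y \<in> set D" "u = f x" "v = f y" by blast
    then show ?thesis
      using crosses_map[OF inj xy(1,2)] crosses_map[OF injE, of x y] s(1) same by (simp add: same_graph_def)
  next
    case False
    then show ?thesis using crosses_in[of "map f D" u v] crosses_in[of "map f E" u v] s(1) by auto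
  qed
  then show ?thesis using dow_map[OF inj s(2)] dow_map[OF injE s(3)] s(1) by (simp add: same_graph_def)
qed

section \<open>Five chords\<close>

datatype five = V0 | V1 | V2 | V3 | V4

text \<open>Conditionals replace the Boolean connectives so that \<open>code_simp\<close> prunes the search.\<close>

fun mem :: "five \<Rightarrow> five list \<Rightarrow> bool" where
  "mem x [] = False"
| "mem x (y # L) = (if x = y then True else mem x L)"

fun odd_in :: "five \<Rightarrow> five list \<Rightarrow> bool" where
  "odd_in x [] = False"
| "odd_in x (y # L) = (if x = y then \<not> odd_in x L else odd_in x L)"

fun seg :: "five \<Rightarrow> five list \<Rightarrow> five list" where
  "seg x [] = []"
| "seg x (y # L) = (if x = y then [] else y # seg x L)"

fun rest :: "five \<Rightarrow> five list \<Rightarrow> five list" where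
  "rest x [] = []"
| "rest x (y # L) = (if x = y then L else rest x L)"

text \<open>The row of \<open>x\<close> in the crossing matrix, see
  \<open>sig_crosses\<close>.\<close>

definition sig :: "five list \<Rightarrow> five \<Rightarrow> bool list" where
  "sig D x = (let s = seg x (rest x D) in map (\<lambda>y. odd_in y s) [V0, V1, V2, V3, V4])"

fun get :: "bool list list \<Rightarrow> five \<Rightarrow> bool list" where
  "get [a, b, c, d, e] x = (case x of V0 \<Rightarrow> a | V1 \<Rightarrow> b | V2 \<Rightarrow> c | V3 \<Rightarrow> d | V4 \<Rightarrow> e)"
| "get _ x = []"

text \<open>\<open>p\<close> is the reversed prefix of the word under construction. At the second
  occurrence of \<open>x\<close> the segment between its ends is complete, so its row of the
  crossing matrix can be compared at once.\<close>

definition step :: "bool list list \<Rightarrow> five list \<Rightarrow> five \<Rightarrow> bool" where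
  "step g p x = (if mem x p then (if mem x (rest x p) then False
     else (let s = seg x p in map (\<lambda>y. odd_in y s) [V0, V1, V2, V3, V4] = get g x)) else True)"

fun all_words :: "nat \<Rightarrow> bool list list \<Rightarrow> (five list \<Rightarrow> bool) \<Rightarrow> five list \<Rightarrow> bool" where
  "all_words 0 g Q p = Q p"
| "all_words (Suc n) g Q p = list_all (\<lambda>x. if step g p x then all_words n g Q (x # p) else True) [V0, V1, V2, V3, V4]"

definition graph :: "five list \<Rightarrow> bool list list" where
  "graph D = map (sig D) [V0, V1, V2, V3, V4]"

text \<open>Together with \<open>rv\<close> this gives all words beginning with \<open>V0\<close>
  that arise by symmetries of the circle: two starting points and two orientations.\<close>

definition swp :: "five list \<Rightarrow> five list" where
  "swp D = V0 # rest V0 (tl D) @ [V0] @ seg V0 (tl D)"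

definition rv :: "five list \<Rightarrow> five list" where
  "rv D = V0 # rev (tl D)"

text \<open>The first of the ten letters is fixed to be \<open>V0\<close>, which leaves nine to
  enumerate.\<close>

definition chk :: "five list \<Rightarrow> bool" where
  "chk D = (let g = graph D; a = swp D; b = rv D; c = swp b in
     all_words 9 g (\<lambda>p. let q = rev p in if q = D then True else if q = a then True else if q = b then True else q = c) [V0])"

fun memp :: "five \<Rightarrow> five \<Rightarrow> (five \<times> five) list \<Rightarrow> bool" where
  "memp x y [] = False"
| "memp x y ((a, b) # L) = (if x = a then (if y = b then True else memp x y L)
    else if x = b then (if y = a then True else memp x y L) else memp x y L)"

text \<open>Trails in the complete graph on five vertices, without the closing edge;
  \<open>used\<close> holds the edges traversed and \<open>p\<close> the reversed prefix.\<close>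

fun all_trails :: "nat \<Rightarrow> five \<Rightarrow> (five \<times> five) list \<Rightarrow> five list \<Rightarrow> (five list \<Rightarrow> bool) \<Rightarrow> bool" where
  "all_trails 0 c used p Q = Q (rev p)"
| "all_trails (Suc n) c used p Q = list_all (\<lambda>x. if x = c then True else if memp c x used then True
    else all_trails n x ((c, x) # used) (x # p) Q) [V0, V1, V2, V3, V4]"

text \<open>Three consecutive letters of a trail without double edges are distinct, so they can be
  named \<open>V0\<close>, \<open>V1\<close>, \<open>V2\<close>; seven letters remain.\<close>

lemma all_trails_chk: "all_trails 7 V2 [(V1, V2), (V0, V1)] [V2, V1, V0] chk"
  by code_simp

section \<open>Soundness of the enumeration\<close>

lemma list_all_five: "list_all P [V0, V1, V2, V3, V4] \<Longrightarrow> P x"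
  by (cases x) auto

lemma memp_Cons: "memp x y ((a, b) # L) \<longleftrightarrow> {x, y} = {a, b} \<or> memp x y L"
  by (auto simp: doubleton_eq_iff)

lemma all_trails_sound:
  assumes "all_trails n c used p Q" "length L = n" "distinct_adj (c # L)"
    and "\<And>x y. x \<noteq> y \<Longrightarrow> wt (\<lambda>a b. of_bool ({a, b} = {x, y})) (c # L) + of_bool (memp x y used) \<le> 1"
  shows "Q (rev p @ L)"
  using assms
proof (induction n arbitrary: c used p L)
  case (Suc n)
  then obtain x L' where L: "L = x # L'" "length L' = n" by (auto simp: length_Suc_conv)
  have xc: "x \<noteq> c" using Suc.prems(3) L by auto
  have "\<not> memp c x used" using Suc.prems(4)[of c x] xc L by (auto simp: doubleton_eq_iff split: if_splits)
  then have "all_trails n x ((c, x) # used) (x # p) Q"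
    using list_all_five[OF Suc.prems(1)[unfolded all_trails.simps], of x] xc by simp
  then have "Q (rev (x # p) @ L')"
  proof (rule Suc.IH[OF _ L(2)])
    show "distinct_adj (x # L')" using Suc.prems(3) L by simp
    fix u v :: five assume "u \<noteq> v"
    have e: "({u, v} = {c, x}) = ({c, x} = {u, v})" by (rule eq_commute)
    have bool: "w + of_bool (P \<or> R) \<le> (1 :: nat)" if "of_bool P + w + of_bool R \<le> (1 :: nat)" for w P R
      using that by (cases P; cases R) simp_all
    show "wt (\<lambda>a b. of_bool ({a, b} = {u, v})) (x # L') + of_bool (memp u v ((c, x) # used)) \<le> 1"
      unfolding memp_Cons e by (rule bool) (use Suc.prems(4)[OF \<open>u \<noteq> v\<close>] in \<open>simp only: L wt.simps\<close>)
  qed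
  then show ?case using L by simp
qed simp

lemma mem_iff: "mem x L \<longleftrightarrow> x \<in> set L"
  by (induction L) auto

lemma odd_in_iff: "odd_in y s \<longleftrightarrow> odd (count_list s y)"
  by (induction s) auto

lemma seg_rest: "x \<notin> set A \<Longrightarrow> seg x (A @ x # B) = A" "x \<notin> set A \<Longrightarrow> rest x (A @ x # B) = B"
  by (induction A) auto

lemma sig_crosses:
  assumes d: "dow D" and x: "x \<in> set D"
  shows "sig D x = map (\<lambda>y. crosses D x y) [V0, V1, V2, V3, V4]"
proof -
  obtain A B C where D: "D = A @ [x] @ B @ [x] @ C" "x \<notin> set A" "x \<notin> set B" "x \<notin> set C"
    using dow_split[OF d x] by metis
  have s: "seg x (rest x D) = B" using D seg_rest by simp
  have "odd (count_list B y) \<longleftrightarrow> crosses D x y" for y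
  proof (cases "y = x")
    case True
    then show ?thesis using D(3) crosses_neq[OF d, of x x] by (auto simp: count_list_0_iff)
  next
    case False
    have "count_list B y \<le> count_list D y" unfolding D(1) by simp
    moreover have "count_list D y \<le> 2" using d count_list_0_iff[of D y] by (cases "y \<in> set D") (auto simp: dow_def)
    ultimately have "count_list B y \<in> {0, 1, 2}" by auto
    moreover have "crosses D x y \<longleftrightarrow> count_list B y = 1" by (rule crosses_chord[OF d D False])
    ultimately show ?thesis by auto
  qed
  then show ?thesis unfolding sig_def s by (simp add: odd_in_iff)
qed

text \<open>No prefix of \<open>E\<close> is pruned, since the rows compared by \<open>step\<close>
  are those of \<open>E\<close> itself.\<close>

lemma all_words_sound:
  assumes "all_words n g Q p" "length L = n" "E = rev p @ L"
    and E: "\<And>x. count_list E x = 2" "\<And>x. get g x = sig E x"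
  shows "Q (rev E)"
  using assms(1-3)
proof (induction n arbitrary: p L)
  case (Suc n)
  then obtain x L' where L: "L = x # L'" "length L' = n" by (auto simp: length_Suc_conv)
  have "step g p x"
  proof (cases "x \<in> set p")
    case True
    then obtain s r where p: "p = s @ x # r" "x \<notin> set s" using split_list_first by metis
    have e: "E = rev r @ x # (rev s @ x # L')" using Suc.prems(3) p L by simp
    have "count_list (rev r) x + count_list (rev s) x + count_list L' x = 0"
      using E(1)[of x] unfolding e by simp
    then have "x \<notin> set r" "x \<notin> set s" "x \<notin> set L'" by (simp_all add: count_list_0_iff)
    moreover from this have "seg x (rest x E) = rev s" unfolding e by (simp add: seg_rest)
    ultimately show ?thesis
      using seg_rest[OF p(2)] E(2)[of x] unfolding step_def mem_iff sig_def p(1)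
      by (simp add: odd_in_iff Let_def)
  qed (simp add: step_def mem_iff)
  then have "all_words n g Q (x # p)"
    using list_all_five[OF Suc.prems(1)[unfolded all_words.simps], of x] by simp
  then show ?case by (rule Suc.IH[OF _ L(2)]) (use Suc.prems(3) L in simp)
qed (use assms in auto)

lemma rv_dihedral: "dihedral (V0 # T) (rv (V0 # T))"
proof -
  have "dihedral (V0 # T) (rev (V0 # T))" by (rule dihedral_rev)
  also have "rev (V0 # T) = rev T @ [V0]" by simp
  also have "dihedral \<dots> ([V0] @ rev T)" by (rule dihedral_rot)
  finally show ?thesis by (simp add: rv_def)
qed

lemma swp_dihedral:
  assumes "V0 \<in> set T"
  shows "dihedral (V0 # T) (swp (V0 # T))"
proof -
  obtain A B where T: "T = A @ V0 # B" "V0 \<notin> set A" using split_list_first[OF assms] by blast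
  then have "swp (V0 # T) = (V0 # B) @ (V0 # A)" by (simp add: swp_def seg_rest)
  then show ?thesis using dihedral_rot[of "V0 # A" "V0 # B"] T by simp
qed

lemma chk_dihedral:
  assumes chk: "chk (V0 # T)" and same: "same_graph (V0 # T) (V0 # U)" and UN: "set (V0 # T) = UNIV"
  shows "dihedral (V0 # T) (V0 # U)"
proof -
  let ?D = "V0 # T" and ?E = "V0 # U"
  have d: "dow ?D" "dow ?E" "set ?E = UNIV" using same UN by (auto simp: same_graph_def)
  have cD: "count_list ?D x = 2" and cE: "count_list ?E x = 2" for x
    using d(1,2) UNIV_I[of x] unfolding dow_def UN d(3) by blast+
  have len: "length L = 10" if "\<And>x. count_list L x = 2" for L :: "five list"
  proof -
    have "length L = count_list L V0 + count_list L V1 + count_list L V2 + count_list L V3 + count_list L V4" for L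
    proof (induction L)
      case (Cons x L)
      then show ?case by (cases x) auto
    qed simp
    then show ?thesis using that by simp
  qed
  have lU: "length U = 9" using len[OF cE] by simp
  have g: "get (graph ?D) x = sig ?E x" for x
  proof -
    have "get (graph ?D) x = sig ?D x" unfolding graph_def by (cases x) simp_all
    also have "\<dots> = map (\<lambda>y. crosses ?D x y) [V0, V1, V2, V3, V4]" using d UN by (intro sig_crosses) auto
    also have "\<dots> = map (\<lambda>y. crosses ?E x y) [V0, V1, V2, V3, V4]" using same by (simp add: same_graph_def)
    also have "\<dots> = sig ?E x" using d by (intro sig_crosses[symmetric]) auto
    finally show ?thesis .
  qed
  have "?E = ?D \<or> ?E = swp ?D \<or> ?E = rv ?D \<or> ?E = swp (rv ?D)"
    using all_words_sound[OF chk[unfolded chk_def Let_def] lU _ cE g] by (auto split: if_splits)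
  moreover have "count_list T V0 = 1" using cD[of V0] by simp
  then have "V0 \<in> set T" by (metis count_list_0_iff zero_neq_one)
  moreover have "dihedral ?D (swp (rv ?D))"
    using rv_dihedral[of T] swp_dihedral[of "rev T"] \<open>V0 \<in> set T\<close> dihedral_trans unfolding rv_def by auto
  ultimately show ?thesis using rv_dihedral[of T] swp_dihedral[of T] by auto
qed

lemma not_distinct_adjD: "\<not> distinct_adj D \<Longrightarrow> \<exists>P a Q. D = P @ [a, a] @ Q"
proof (induction D)
  case (Cons x D)
  then obtain y L where D: "D = y # L" by (cases D) auto
  show ?case
  proof (cases "x = y")
    case True
    then show ?thesis using D by (intro exI[of _ "[]"] exI[of _ x] exI[of _ L]) simp
  next
    case False
    then obtain P a Q where "D = P @ [a, a] @ Q" using Cons D by auto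
    then show ?thesis by (intro exI[of _ "x # P"] exI[of _ a] exI[of _ Q]) simp
  qed
qed simp

text \<open>A letter repeated in a row would fill a single arc.\<close>

lemma tight_distinct_adj:
  assumes t: "tight D" and card: "2 \<le> card (set D)"
  shows "distinct_adj D"
proof (rule ccontr)
  assume "\<not> distinct_adj D"
  then obtain P a Q where D: "D = P @ [a, a] @ Q" using not_distinct_adjD by blast
  have "dow D" using t by (simp add: tight_def)
  then have "count_list D a = 2" using D by (auto simp: dow_def)
  then have "a \<notin> set (Q @ P)" by (simp add: D count_list_0_iff)
  moreover have "dihedral D ([a, a] @ (Q @ P))" using dihedral_rot[of P "[a, a] @ Q"] D by simp
  from cut_dihedral[OF this, of "{a}"] have "cut D {a} \<le> 2"
    using cut_two_blocks[of "[a, a]" "{a}" "Q @ P"] calculation by auto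
  moreover have "4 \<le> cut D {a}"
    using singleton_neq[OF card, of a] D by (intro tightD1[OF t]) auto
  ultimately show False by simp
qed

lemma wt_map: "wt f (map g L) = wt (\<lambda>a b. f (g a) (g b)) L"
proof (induction L)
  case (Cons x L)
  then show ?case by (cases L) auto
qed simp

text \<open>By tightness the multigraph is simple and 4-regular on five vertices, hence complete,
  and the word is one of its Euler trails. Relabelled so that it begins with \<open>V0\<close>,
  \<open>V1\<close>, \<open>V2\<close>, it is among those enumerated.\<close>

lemma rigid_five:
  assumes t: "tight D" and card: "card (set D) = 5"
  shows "rigid D"
  unfolding rigid_def
proof (intro allI impI)
  fix E assume same: "same_graph D E"
  have d: "dow D" "dow E" "set E = set D" using same by (auto simp: same_graph_def)
  interpret tight_wgraph "set D" "mult D" by (rule tight_wgraph_words[OF t]) (use card in simp)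
  have adj: "distinct_adj D" using tight_distinct_adj[OF t] card by simp
  have wt1: "wt (\<lambda>a b. of_bool ({a, b} = {x, y})) D \<le> (1 :: nat)" if "x \<in> set D" "y \<in> set D" "x \<noteq> y" for x y
  proof -
    have "wt (\<lambda>a b. of_bool ({a, b} = {x, y})) D \<le> cyc (\<lambda>a b. of_bool ({a, b} = {x, y})) D"
      using that(1) by (subst cyc_eq) auto
    also have "\<dots> \<le> 1" using m_le_1[OF that(1,2)] that(3) by (simp add: mult_def)
    finally show ?thesis .
  qed
  have "\<not> length D \<le> 2"
  proof
    assume "length D \<le> 2"
    then have "card (set D) \<le> 2" using card_length[of D] by linarith
    with card show False by simp
  qed
  then obtain x0 x1 x2 R where D: "D = x0 # x1 # x2 # R" 
    by (cases D rule: remdups_adj.cases; cases "tl (tl D)") auto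
  have x01: "x0 \<noteq> x1" "x1 \<noteq> x2" using adj D by auto
  have x02: "x0 \<noteq> x2"
  proof
    assume "x0 = x2"
    then have "2 \<le> wt (\<lambda>a b. of_bool ({a, b} = {x0, x1}) :: nat) D" by (simp add: D insert_commute)
    then show False using wt1[of x0 x1] x01 D by simp
  qed
  have "card (set D - {x0, x1, x2}) = 2"
    using x01 x02 card D by (subst card_Diff_subset) auto
  then obtain x3 x4 where x34: "set D - {x0, x1, x2} = {x3, x4}" "x3 \<noteq> x4" by (auto simp: card_2_iff)
  define f where "f z = (if z = x0 then V0 else if z = x1 then V1 else if z = x2 then V2 else if z = x3 then V3 else V4)" for z
  define g where "g n = (case n of V0 \<Rightarrow> x0 | V1 \<Rightarrow> x1 | V2 \<Rightarrow> x2 | V3 \<Rightarrow> x3 | V4 \<Rightarrow> x4)" for n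
  have S: "set D = {x0, x1, x2, x3, x4}" using x34(1) D by auto
  have x3: "x3 \<notin> {x0, x1, x2}" "x4 \<notin> {x0, x1, x2}" using x34 by auto
  have gf: "g (f z) = z" if "z \<in> set D" for z
    using that unfolding S f_def g_def by auto
  have inj: "inj_on f (set D)" using gf by (metis inj_onI)
  have fg: "f (g n) = n" for n using x01 x02 x3 x34(2) unfolding f_def g_def by (cases n) auto
  have fV: "f x0 = V0" "f x1 = V1" "f x2 = V2" using x01 x02 by (auto simp: f_def)
  let ?D = "map f D"
  have D': "?D = V0 # V1 # V2 # map f R" using D fV by simp
  have gS: "g n \<in> set D" for n unfolding S g_def by (cases n) auto
  have UN: "set ?D = UNIV"
  proof -
    have "n \<in> f ` set D" for n using fg gS by (metis imageI)
    then show ?thesis by auto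
  qed
  obtain P Q where E: "E = P @ x0 # Q" using d(3) D split_list[of x0 E] by auto
  have iE: "dihedral E (x0 # Q @ P)" using dihedral_rot[of P "x0 # Q"] E by simp
  have same': "same_graph D (x0 # Q @ P)" using same_graph_trans[OF same dihedral_same_graph[OF d(2) iE]] .
  have sm: "same_graph ?D (V0 # map f (Q @ P))" using same_graph_map[OF inj same'] fV by simp
  have "dow ?D" using sm by (simp add: same_graph_def)
  then have cnt: "count_list ?D x = 2" for x
    using UNIV_I[of x] unfolding dow_def UN by blast
  have len: "length L = count_list L V0 + count_list L V1 + count_list L V2 + count_list L V3 + count_list L V4" for L
  proof (induction L)
    case (Cons x L)
    then show ?case by (cases x) auto
  qed simp
  have "length ?D = 10" using len[of ?D] cnt by simp
  then have lR: "length (map f R) = 7" by (simp add: D)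
  have "chk (rev [V2, V1, V0] @ map f R)"
  proof (rule all_trails_sound[OF all_trails_chk lR])
    have "distinct_adj ?D" using adj inj by (simp add: distinct_adj_mapI)
    then show "distinct_adj (V2 # map f R)" unfolding D' by simp
    fix x y :: five assume xy: "x \<noteq> y"
    have gx: "g x \<in> set D" "g y \<in> set D" "g x \<noteq> g y"
      using gS xy by (auto dest: arg_cong[where f = f] simp: fg)
    have "wt (\<lambda>a b. of_bool ({a, b} = {x, y}) :: nat) ?D = wt (\<lambda>a b. of_bool ({a, b} = {g x, g y})) D"
      unfolding wt_map
    proof (rule wt_cong)
      fix a b assume ab: "a \<in> set D" "b \<in> set D"
      have "f a = x \<longleftrightarrow> a = g x" "f a = y \<longleftrightarrow> a = g y" "f b = x \<longleftrightarrow> b = g x" "f b = y \<longleftrightarrow> b = g y"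
        using gf ab fg by auto
      then show "of_bool ({f a, f b} = {x, y}) = (of_bool ({a, b} = {g x, g y}) :: nat)"
        by (auto simp: doubleton_eq_iff)
    qed
    then have "wt (\<lambda>a b. of_bool ({a, b} = {x, y}) :: nat) ?D \<le> 1" using wt1[OF gx] by simp
    then show "wt (\<lambda>a b. of_bool ({a, b} = {x, y})) (V2 # map f R) + of_bool (memp x y [(V1, V2), (V0, V1)]) \<le> (1 :: nat)"
      unfolding D' memp_Cons by (auto simp: doubleton_eq_iff split: if_splits)
  qed
  then have "chk ?D" by (simp add: D')
  then have "dihedral ?D (V0 # map f (Q @ P))"
    using chk_dihedral[of "V1 # V2 # map f R" "map f (Q @ P)"] sm UN unfolding D' by blast
  then have "dihedral (map g ?D) (map g (V0 # map f (Q @ P)))" by (rule dihedral_map)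
  moreover have "map g ?D = D" using gf by (simp add: map_idI)
  moreover have "map g (V0 # map f (Q @ P)) = x0 # Q @ P"
  proof -
    have "set (Q @ P) \<subseteq> set D" using d(3) E by auto
    then have "map g (map f (Q @ P)) = Q @ P" using gf by (auto intro!: map_idI)
    then show ?thesis by (simp add: g_def)
  qed
  ultimately show "dihedral D E" using dihedral_sym[OF iE] dihedral_trans by simp
qed

section \<open>Intersection graphs determine diagrams up to mutation\<close>

text \<open>After one chord is deleted at most one is left, so the remaining words coincide and
  \<open>reinsert\<close> applies.\<close>

lemma small_meq:
  assumes same: "same_graph D E" and card: "card (set D) \<le> 2"
  shows "meq D E"
proof (cases "D = []")
  case True
  then show ?thesis using same by (simp add: same_graph_def)
next
  case False
  then obtain v where v: "v \<in> set D" by (meson list.set_sel(1))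
  have d: "dow D" "dow E" "set E = set D" using same by (auto simp: same_graph_def)
  have "card (set D - {v}) < 2" using card v by (simp add: card_Diff_singleton)
  then obtain a where a: "set D - {v} \<subseteq> {a}" using card_le_1_subset[of "set D - {v}"] by auto
  have rep: "filter (\<lambda>x. x \<noteq> v) F = replicate (count_list F a) a" if "set F - {v} \<subseteq> {a}" "a \<noteq> v" for F
    using that by (induction F) auto
  have "filter (\<lambda>x. x \<noteq> v) D = filter (\<lambda>x. x \<noteq> v) E"
  proof (cases "a = v")
    case True
    then have "set D \<subseteq> {v}" using a by auto
    then have "filter (\<lambda>x. x \<noteq> v) D = []" "filter (\<lambda>x. x \<noteq> v) E = []" using d(3) by (auto simp: filter_empty_conv)
    then show ?thesis by simp
  next
    case False
    have "count_list D a = count_list E a"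
      using d count_list_0_iff[of D a] count_list_0_iff[of E a] by (cases "a \<in> set D") (auto simp: dow_def)
    then show ?thesis using rep[of D] rep[of E] a d(3) False by simp
  qed
  then show ?thesis using reinsert[OF same v] by simp
qed

theorem same_graph_meq: "same_graph D E \<Longrightarrow> meq D E"
proof (induction "length D" arbitrary: D E rule: less_induct)
  case less
  note IH = less.hyps
  note same = less.prems
  have d: "dow D" using same by (simp add: same_graph_def)
  define small where "small A = (A \<subseteq> set D \<and> A \<noteq> set D \<and> 2 \<le> card A \<and> (card A = 2 \<or> 2 \<le> card (set D - A)) \<and> cut D A \<le> 4)" for A
  have "card (set D) \<le> 2 \<or> 3 \<le> card (set D)" by linarith
  then consider "\<not> conn D" | "card (set D) \<le> 2" | "conn D" "\<exists>A. small A" | "conn D" "\<nexists>A. small A" "3 \<le> card (set D)" by blast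
  then show ?case
  proof cases
    case 1
    show ?thesis by (rule not_conn_meq[OF _ same 1]) (rule IH)
  next
    case 2
    then show ?thesis by (rule small_meq[OF same])
  next
    case 3
    then obtain A where A: "small A" "\<And>B. small B \<Longrightarrow> card A \<le> card B"
      using ex_has_least_nat[of small _ card] by metis
    show ?thesis
    proof (cases "card A = 2")
      case True
      then obtain a u where "A = {a, u}" "a \<noteq> u" by (auto simp: card_2_iff)
      then show ?thesis using A(1) by (intro pair_meq[OF _ same 3(1), of a u] IH) (auto simp: small_def)
    next
      case False
      show ?thesis
      proof (rule split_meq[OF _ same 3(1), of A])
        show "meq D' E'" if "length D' < length D" "same_graph D' E'" for D' E' :: "'a list"
          using that by (rule IH)
        show "A \<subseteq> set D" "3 \<le> card A" "2 \<le> card (set D - A)" "cut D A \<le> 4"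
          using A(1) False by (auto simp: small_def)
        fix C assume C: "C \<subseteq> set D" "2 \<le> card C" "2 \<le> card (set D - C)" "card C < card A"
        then have "\<not> small C" using A(2)[of C] by auto
        moreover have "C \<noteq> set D" using C by auto
        ultimately have "\<not> cut D C \<le> 4" using C by (auto simp: small_def)
        then show "6 \<le> cut D C" using even_cut[of D C] by presburger
      qed
    qed
  next
    case 4
    have big: "6 \<le> cut D A" if A: "A \<subseteq> set D" "2 \<le> card A" "2 \<le> card (set D - A)" for A
    proof -
      have "A \<noteq> set D" using A by auto
      then have "\<not> cut D A \<le> 4" using 4(2) A by (auto simp: small_def)
      then show ?thesis using even_cut[of D A] by presburger
    qed
    then have t: "tight D" using d conn_cut[OF 4(1)] by (auto simp: tight_def)
    consider "card (set D) = 3" | "card (set D) = 4" | "card (set D) = 5" | "6 \<le> card (set D)" using 4(3) by linarith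
    then show ?thesis
    proof cases
      case 1
      then obtain a b c where S: "set D = {a, b, c}" "a \<noteq> b" "a \<noteq> c" "b \<noteq> c" by (auto simp: card_3_iff)
      \<comment> \<open>With three chords, the complement of a single chord is a pair with the same
        cut, hence small.\<close>
      have "set D - {c} = {a, b}" using S by auto
      then have "cut D {a, b} = cut D {c}" using cut_compl[of "{a, b}" D "{c}"] by simp
      then have "small {a, b}" using cut_single_le[OF d, of c] S by (auto simp: small_def)
      then show ?thesis using 4(2) by blast
    next
      case 2
      \<comment> \<open>Each vertex of a tight multigraph has four distinct neighbours, so four
        vertices are too few.\<close>
      interpret tight_wgraph "set D" "mult D" by (rule tight_wgraph_words[OF t]) (use 2 in simp)
      obtain v where "v \<in> set D" using 2 by fastforce
      then obtain p q r s where n: "nbrs v p q r s" using nbrs_ex by blast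
      then have "card {v, p, q, r, s} \<le> card (set D)" by (intro card_mono) (auto simp: nbrs_def)
      moreover have "card {v, p, q, r, s} = 5" using n by (auto simp: nbrs_def)
      ultimately show ?thesis using 2 by simp
    next
      case 3
      then show ?thesis using rigid_five[OF t] same dihedral_meq by (auto simp: rigid_def)
    next
      case 4
      have "rigid D" by (rule rigid_large[OF _ t 4]) (rule IH)
      then show ?thesis using same dihedral_meq by (auto simp: rigid_def)
    qed
  qed
qed

section \<open>Invariance of the weight system under mutation\<close>

lemma wval_mutation:
  assumes "mutation D E" "dow D" "sl2_fun f"
  shows "wval f E = wval f D"
  using assms(1)
proof cases
  case (mutationI s t u0 u1 u2)
  have "count_list (s @ t) c = 2" if c: "c \<in> set (s @ t)" for c
  proof -
    have "count_list u0 c = 0" "count_list u1 c = 0" "count_list u2 c = 0"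
      using mutationI(3) c by (auto simp: count_list_0_iff)
    moreover have "count_list D c = 2" using assms(2) c unfolding dow_def mutationI(1) by auto
    ultimately show ?thesis by (simp add: mutationI(1))
  qed
  then show ?thesis unfolding mutationI(1,2) using wval_rev_share[OF assms(3) mutationI(3)] by blast
qed

lemma wval_meq:
  assumes "meq D E" "dow D" "sl2_fun f"
  shows "wval f E = wval f D"
  using assms(1) unfolding meq_def
proof (induction rule: rtranclp_induct)
  case (step E F)
  have "mset D = mset E" using step(1) meq_mset unfolding meq_def by blast
  then have "dow E" using mset_dow assms(2) by blast
  then show ?case using wval_mutation[OF step(2) _ assms(3)] step(3) by simp
qed simp

section \<open>Coloured graphs of shares\<close>

lemma nbetween_split:
  assumes "a \<notin> set X" "a \<notin> set Y" "a \<notin> set Z" "a \<noteq> b"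
  shows "nbetween (X @ [a] @ Y @ [a] @ Z) a b = count_list Y b"
proof -
  let ?w = "X @ [a] @ Y @ [a] @ Z"
  have nth: "?w ! i = (if i < length X then X ! i else if i = length X then a
      else if i < Suc (length X + length Y) then Y ! (i - Suc (length X))
      else if i = Suc (length X + length Y) then a else Z ! (i - Suc (Suc (length X + length Y))))" for i
    by (auto simp: nth_append nth_Cons' diff_diff_left)
  have pa: "pos ?w a = {length X, Suc (length X + length Y)}"
  proof (intro equalityI subsetI)
    fix i assume "i \<in> pos ?w a"
    then have i: "i < length ?w" "?w ! i = a" by (auto simp: pos_def)
    have "X ! i \<noteq> a" if "i < length X" using assms(1) nth_mem[OF that] by auto
    moreover have "Y ! (i - Suc (length X)) \<noteq> a" if "\<not> i < Suc (length X)" "i < Suc (length X + length Y)"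
    proof -
      have "i - Suc (length X) < length Y" using that by linarith
      then show ?thesis using assms(2) nth_mem by metis
    qed
    moreover have "Z ! (i - Suc (Suc (length X + length Y))) \<noteq> a" if "\<not> i < Suc (Suc (length X + length Y))"
    proof -
      have "i - Suc (Suc (length X + length Y)) < length Z" using that i(1) by simp
      then show ?thesis using assms(3) nth_mem by metis
    qed
    ultimately show "i \<in> {length X, Suc (length X + length Y)}" using i(2) unfolding nth
      by (auto split: if_splits)
  next
    fix i assume "i \<in> {length X, Suc (length X + length Y)}"
    then show "i \<in> pos ?w a" unfolding pos_def mem_Collect_eq nth by auto
  qed
  have "{j \<in> pos ?w b. \<exists>i\<in>pos ?w a. \<exists>k\<in>pos ?w a. i < j \<and> j < k} =
      (\<lambda>j. Suc (length X) + j) ` {j. j < length Y \<and> Y ! j = b}" (is "?L = ?R")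
  proof (intro equalityI subsetI)
    fix j assume "j \<in> ?L"
    then have j: "?w ! j = b" "length X < j" "j < Suc (length X + length Y)" unfolding pa by (auto simp: pos_def)
    then have "Y ! (j - Suc (length X)) = b" unfolding nth by simp
    then show "j \<in> ?R" using j(2,3) by (intro image_eqI[of _ _ "j - Suc (length X)"]) auto
  next
    fix j assume "j \<in> ?R"
    then obtain i where "j = Suc (length X) + i" "i < length Y" "Y ! i = b" by blast
    then show "j \<in> ?L" unfolding pa unfolding pos_def mem_Collect_eq nth by auto
  qed
  then have "nbetween ?w a b = card {j. j < length Y \<and> Y ! j = b}"
    unfolding nbetween_def by (simp only:) (simp add: card_image inj_on_def)
  also have "\<dots> = count_list Y b"
    by (simp add: count_list_eq_length_filter length_filter_conv_card eq_commute)
  finally show ?thesis .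
qed

lemma before_split:
  assumes "a \<notin> set X" "a \<notin> set Y"
  shows "before (X @ [a] @ Y) a b \<longleftrightarrow> b \<in> set Y"
proof
  assume "before (X @ [a] @ Y) a b"
  then obtain i j where ij: "i < j" "j < length (X @ [a] @ Y)" "(X @ [a] @ Y) ! i = a" "(X @ [a] @ Y) ! j = b"
    by (auto simp: before_def)
  have "\<not> i < length X" using ij(3) assms(1) nth_mem[of i X] by (auto simp: nth_append)
  then have j: "length X < j" using ij(1) by simp
  then have "(X @ [a] @ Y) ! j = Y ! (j - Suc (length X))" by (simp add: nth_append)
  moreover have "j - Suc (length X) < length Y" using ij(2) j by simp
  ultimately show "b \<in> set Y" using ij(4) nth_mem by metis
next
  assume "b \<in> set Y"
  then obtain j where "j < length Y" "Y ! j = b" by (auto simp: in_set_conv_nth)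
  then show "before (X @ [a] @ Y) a b"
    unfolding before_def by (intro exI[of _ "length X"] exI[of _ "Suc (length X) + j"]) (simp add: nth_append)
qed

lemma nbetween_crosses:
  assumes d: "dow (p @ w @ q)" and a: "count_list w a = 2" and ab: "a \<noteq> b"
  shows "nbetween w a b = 1 \<longleftrightarrow> crosses (p @ w @ q) a b"
proof -
  obtain X Y Z where w: "w = X @ [a] @ Y @ [a] @ Z" "a \<notin> set X" "a \<notin> set Y" "a \<notin> set Z"
    using count_list_2_split[OF a] by metis
  have "a \<in> set w" using w by simp
  then have "count_list (p @ w @ q) a = 2" using d unfolding dow_def by simp
  then have "a \<notin> set p" "a \<notin> set q" using a by (auto simp: count_list_0_iff)
  moreover have "p @ w @ q = (p @ X) @ [a] @ Y @ [a] @ (Z @ q)" by (simp add: w)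
  ultimately show ?thesis
    using crosses_chord[OF d, of "p @ X" a Y "Z @ q" b] w ab nbetween_split[OF w(2-4) ab] by simp
qed

lemma arch_on_iff:
  assumes "share_wf (s, t)" "a \<in> chords (s, t)"
  shows "is_arch (s, t) a \<longleftrightarrow> count_list t a \<noteq> 1"
    and "\<not> is_arch (s, t) a \<longleftrightarrow> count_list s a = 1 \<and> count_list t a = 1"
proof -
  have "count_list s a + count_list t a = 2" using assms by (simp add: share_wf_def chords_def)
  then show "is_arch (s, t) a \<longleftrightarrow> count_list t a \<noteq> 1"
    and "\<not> is_arch (s, t) a \<longleftrightarrow> count_list s a = 1 \<and> count_list t a = 1"
    unfolding is_arch_def arch_on_def fst_conv snd_conv by linarith+
qed

text \<open>On the circle \<open>s @ t\<close> an arch crosses a chord exactly when it is adjacent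
  to it. Two bridges in the same order on both strands alternate on this circle, so for bridges
  crossing is the negation of adjacency.\<close>

lemma adj_iff_crosses:
  assumes wf: "share_wf (s, t)" and ab: "a \<in> chords (s, t)" "b \<in> chords (s, t)" "a \<noteq> b"
  shows "adj (s, t) a b \<longleftrightarrow> (crosses (s @ t) a b \<longleftrightarrow> is_arch (s, t) a \<or> is_arch (s, t) b)"
proof -
  have d: "dow ([] @ s @ t)" "dow (s @ t @ [])" using wf by (simp_all add: share_wf_def dow_def)
  have arch: "arch_on s x \<Longrightarrow> nbetween s x y = 1 \<longleftrightarrow> crosses (s @ t) x y"
      "arch_on t x \<Longrightarrow> nbetween t x y = 1 \<longleftrightarrow> crosses (s @ t) x y" if "x \<noteq> y" for x y
    using nbetween_crosses[OF d(1) _ that] nbetween_crosses[OF d(2) _ that] by (simp_all add: arch_on_def)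
  show ?thesis
  proof (cases "is_arch (s, t) a \<or> is_arch (s, t) b")
    case True
    then show ?thesis
      using ab arch[OF ab(3)] arch[of b a] crosses_commute[of "s @ t" a b]
      unfolding adj_def is_bridge_def is_arch_def fst_conv snd_conv by blast
  next
    case False
    then have ca: "count_list s a = 1" "count_list t a = 1" and cb: "count_list s b = 1" "count_list t b = 1"
      using arch_on_iff(2)[OF wf] ab by auto
    obtain X Y where s: "s = X @ [a] @ Y" "a \<notin> set X" "a \<notin> set Y" using count_list_1_split[OF ca(1)] by metis
    obtain X' Y' where t: "t = X' @ [a] @ Y'" "a \<notin> set X'" "a \<notin> set Y'" using count_list_1_split[OF ca(2)] by metis
    have st: "s @ t = X @ [a] @ (Y @ X') @ [a] @ Y'" by (simp add: s t)
    have d': "dow (s @ t)" using d(2) by simp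
    have i: "crosses (s @ t) a b \<longleftrightarrow> count_list (Y @ X') b = 1"
      using crosses_chord[OF d' st, of b] s t ab(3) by auto
    have bef: "before s a b \<longleftrightarrow> count_list Y b \<noteq> 0" "before t a b \<longleftrightarrow> count_list Y' b \<noteq> 0"
      using before_split[OF s(2,3)] before_split[OF t(2,3)] by (simp_all add: s(1) t(1) count_list_0_iff)
    have c: "count_list X b + count_list Y b = 1" "count_list X' b + count_list Y' b = 1"
      using cb ab(3) by (simp_all add: s(1) t(1))
    have "adj (s, t) a b \<longleftrightarrow> before s a b \<noteq> before t a b"
      using False ab unfolding adj_def is_bridge_def is_arch_def fst_conv snd_conv by blast
    also have "\<dots> \<longleftrightarrow> \<not> crosses (s @ t) a b"
      unfolding i bef count_list_append using c by linarith
    finally show ?thesis using False by blast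
  qed
qed

text \<open>\<open>Inr undefined\<close> serves only as a name distinct from all \<open>Inl\<close>
  labels. The ends of this chord mark the places at which \<open>join\<close> inserts the strands of
  \<open>H\<close>.\<close>

definition chord_closure :: "'a share \<Rightarrow> ('a + 'b) list" where
  "chord_closure I = map Inl (fst I) @ [Inr undefined] @ map Inl (snd I) @ [Inr undefined]"

lemma count_list_Inl: "count_list (map Inl w) (Inl a) = count_list w a" "count_list (map Inl w) (Inr b) = 0"
  by (induction w) auto

lemma count_list_Inr: "count_list (map Inr w) (Inr a) = count_list w a" "count_list (map Inr w) (Inl b) = 0"
  by (induction w) auto

lemma dow_chord_closure: "share_wf I \<Longrightarrow> dow (chord_closure I :: ('a + 'b) list)"
  unfolding dow_def share_wf_def chord_closure_def by (auto simp: count_list_Inl)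

lemma dow_join: "share_wf I \<Longrightarrow> share_wf H \<Longrightarrow> dow (join I H)"
  unfolding dow_def share_wf_def join_def by (auto simp: count_list_Inl count_list_Inr)

lemma crosses_chord_closure:
  assumes wf: "share_wf I"
  shows "crosses (chord_closure I :: ('a + 'b) list) (Inl a) (Inl b) \<longleftrightarrow> crosses (fst I @ snd I) a b"
    and "crosses (chord_closure I :: ('a + 'b) list) (Inr undefined) (Inl a) \<longleftrightarrow> a \<in> chords I \<and> \<not> is_arch I a"
proof -
  obtain s t where I: "I = (s, t)" by (cases I)
  let ?D = "chord_closure I :: ('a + 'b) list"
  show "crosses ?D (Inl a) (Inl b) \<longleftrightarrow> crosses (fst I @ snd I) a b"
  proof (cases "a \<in> set (s @ t) \<and> b \<in> set (s @ t)")
    case True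
    have "crosses ?D (Inl a) (Inl b) \<longleftrightarrow> crosses (filter (\<lambda>z. z \<noteq> Inr undefined) ?D) (Inl a) (Inl b)"
      by (rule crosses_filter[symmetric]) auto
    also have "filter (\<lambda>z. z \<noteq> Inr undefined) ?D = map Inl (s @ t)"
      by (simp add: chord_closure_def I filter_map o_def)
    also have "crosses \<dots> (Inl a) (Inl b) \<longleftrightarrow> crosses (s @ t) a b"
      using True by (intro crosses_map) auto
    finally show ?thesis by (simp add: I)
  next
    case False
    then show ?thesis using crosses_in[of ?D "Inl a" "Inl b"] crosses_in[of "s @ t" a b]
      by (auto simp: chord_closure_def I)
  qed
  have D: "?D = map Inl s @ [Inr undefined] @ map Inl t @ [Inr undefined] @ []" by (simp add: chord_closure_def I)
  have "crosses ?D (Inr undefined) (Inl a) \<longleftrightarrow> count_list (map Inl t :: ('a + 'b) list) (Inl a) = 1"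
    by (rule crosses_chord[OF dow_chord_closure[OF wf] D]) auto
  then have i: "crosses ?D (Inr undefined) (Inl a) \<longleftrightarrow> count_list t a = 1" by (simp add: count_list_Inl)
  show "crosses ?D (Inr undefined) (Inl a) \<longleftrightarrow> a \<in> chords I \<and> \<not> is_arch I a"
  proof (cases "a \<in> chords I")
    case True
    then show ?thesis using arch_on_iff(1)[of s t a] wf i by (simp add: I)
  next
    case False
    then have "count_list t a = 0" by (simp add: count_list_0_iff chords_def I)
    then show ?thesis using i False by simp
  qed
qed

text \<open>Crossings with the additional chord record the colours, and by
  \<open>adj_iff_crosses\<close> colours and adjacency together determine the remaining
  crossings.\<close>

lemma same_graph_chord_closure:
  assumes wf: "share_wf I1" "share_wf I2" and f: "coloured_graph_iso I1 I2 f"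
  shows "same_graph (map (map_sum f id) (chord_closure I1)) (chord_closure I2 :: ('a + 'b) list)"
proof -
  let ?g = "map_sum f id :: 'a + 'b \<Rightarrow> 'a + 'b"
  let ?D = "chord_closure I1 :: ('a + 'b) list" and ?E = "chord_closure I2 :: ('a + 'b) list"
  let ?v = "Inr undefined :: 'a + 'b"
  have S: "set (chord_closure I) = insert ?v (Inl ` chords I)" for I :: "'a share"
    by (auto simp: chord_closure_def chords_def)
  have bij: "inj_on f (chords I1)" "f ` chords I1 = chords I2"
    and col: "\<And>c. c \<in> chords I1 \<Longrightarrow> is_arch I2 (f c) = is_arch I1 c"
    and adj: "\<And>a b. a \<in> chords I1 \<Longrightarrow> b \<in> chords I1 \<Longrightarrow> adj I2 (f a) (f b) = adj I1 a b"
    using f by (auto simp: coloured_graph_iso_def bij_betw_def)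
  have inj: "inj_on ?g (set ?D)" using bij(1) by (auto simp: S inj_on_def)
  have set: "set (map ?g ?D) = set ?E" by (simp add: S bij(2)[symmetric] image_image)
  have d: "dow ?D" "dow ?E" by (rule dow_chord_closure[OF wf(1)], rule dow_chord_closure[OF wf(2)])
  have d': "dow (map ?g ?D)" using dow_map[OF inj d(1)] .
  have chords: "crosses ?D (Inl a) (Inl b) = crosses ?E (Inl (f a)) (Inl (f b))"
    if ab: "a \<in> chords I1" "b \<in> chords I1" for a b
  proof (cases "a = b")
    case True
    then show ?thesis using crosses_neq[OF d(1)] crosses_neq[OF d(2)] by blast
  next
    case False
    have fab: "f a \<in> chords I2" "f b \<in> chords I2" "f a \<noteq> f b"
      using bij ab False by (auto dest: inj_onD)
    have "adj I1 a b \<longleftrightarrow> (crosses (fst I1 @ snd I1) a b \<longleftrightarrow> is_arch I1 a \<or> is_arch I1 b)"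
      using adj_iff_crosses[of "fst I1" "snd I1" a b] wf ab False by simp
    moreover have "adj I2 (f a) (f b) \<longleftrightarrow> (crosses (fst I2 @ snd I2) (f a) (f b) \<longleftrightarrow> is_arch I2 (f a) \<or> is_arch I2 (f b))"
      using adj_iff_crosses[of "fst I2" "snd I2" "f a" "f b"] wf fab by simp
    ultimately have "crosses (fst I1 @ snd I1) a b \<longleftrightarrow> crosses (fst I2 @ snd I2) (f a) (f b)"
      using adj[OF ab] col[OF ab(1)] col[OF ab(2)] by blast
    then show ?thesis using crosses_chord_closure(1)[OF wf(1)] crosses_chord_closure(1)[OF wf(2)] by blast
  qed
  have cut: "crosses ?D ?v (Inl a) = crosses ?E ?v (Inl (f a))" if "a \<in> chords I1" for a
    using crosses_chord_closure(2)[OF wf(1), of a] crosses_chord_closure(2)[OF wf(2), of "f a"] that bij(2) col[OF that] by auto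
  have "crosses ?D x y = crosses ?E (?g x) (?g y)" if xy: "x \<in> set ?D" "y \<in> set ?D" for x y
  proof -
    consider "x = ?v" "y = ?v" | a where "x = ?v" "y = Inl a" "a \<in> chords I1"
      | a where "x = Inl a" "y = ?v" "a \<in> chords I1"
      | a b where "x = Inl a" "y = Inl b" "a \<in> chords I1" "b \<in> chords I1"
      using xy unfolding S by blast
    then show ?thesis
    proof cases
      case 1
      then show ?thesis using crosses_neq[OF d(1), of ?v ?v] crosses_neq[OF d(2), of ?v ?v] by auto
    next
      case 2
      then show ?thesis using cut by simp
    next
      case 3
      then show ?thesis using cut crosses_commute[of ?D x y] crosses_commute[of ?E "?g x" "?g y"] by simp
    next
      case 4
      then show ?thesis using chords by simp
    qed
  qed
  then have eq: "crosses (map ?g ?D) (?g x) (?g y) = crosses ?E (?g x) (?g y)" if "x \<in> set ?D" "y \<in> set ?D" for x y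
    using crosses_map[OF inj that] that by simp
  have "crosses (map ?g ?D) u v = crosses ?E u v" for u v
  proof (cases "u \<in> ?g ` set ?D \<and> v \<in> ?g ` set ?D")
    case True
    then show ?thesis using eq by blast
  next
    case False
    then have "u \<notin> set ?E \<or> v \<notin> set ?E" unfolding set[symmetric] by simp
    moreover have "u \<notin> set (map ?g ?D) \<or> v \<notin> set (map ?g ?D)" using False by simp
    ultimately show ?thesis using crosses_in[of "map ?g ?D" u v] crosses_in[of ?E u v] by blast
  qed
  then show ?thesis using d d' set by (simp add: same_graph_def)
qed

theorem theorem3:
  fixes I1 I2 :: "'a share"
  assumes "share_wf I1" and "share_wf I2"
    and "\<exists>f. coloured_graph_iso I1 I2 f"
  shows "\<forall>H :: 'b share. share_wf H \<longrightarrow> eq_U (w_sl2 (join I1 H)) (w_sl2 (join I2 H))"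
proof (intro allI impI eq_U_I)
  fix H :: "'b share" and h
  assume H: "share_wf H" and h: "sl2_fun h"
  obtain f where f: "coloured_graph_iso I1 I2 f" using assms(3) by blast
  let ?g = "map_sum f id :: 'a + 'b \<Rightarrow> 'a + 'b"
  let ?v = "Inr undefined :: 'a + 'b"
  \<comment> \<open>Replacing the additional chord by the strands of \<open>H\<close> produces the
    joins, and by \<open>sub_meq\<close> it respects mutations.\<close>
  define ins where "ins = sub ?v [map Inr (fst H), map Inr (snd H)]"
  have chord_closure: "chord_closure I = map Inl (fst I) @ [?v] @ map Inl (snd I) @ [?v] @ []" for I :: "'a share"
    by (simp add: chord_closure_def)
  have gclos: "map ?g (chord_closure I) = map (Inl \<circ> f) (fst I) @ [?v] @ map (Inl \<circ> f) (snd I) @ [?v] @ []" for I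
    by (simp add: chord_closure_def)
  have E: "ins (chord_closure I2) = join I2 H"
    unfolding ins_def chord_closure by (subst sub_two) (auto simp: join_def)
  have D: "ins (map ?g (chord_closure I1)) = map ?g (join I1 H)"
    unfolding ins_def gclos by (subst sub_two) (auto simp: join_def)
  have same: "same_graph (map ?g (chord_closure I1)) (chord_closure I2 :: ('a + 'b) list)"
    by (rule same_graph_chord_closure[OF assms(1,2) f])
  then have "meq (map ?g (chord_closure I1)) (chord_closure I2)" by (rule same_graph_meq)
  then have m: "meq (ins (map ?g (chord_closure I1))) (ins (chord_closure I2))"
    unfolding ins_def
  proof (rule sub_meq)
    have "dow (map ?g (chord_closure I1))" using same by (simp add: same_graph_def)
    then show "count_list (map ?g (chord_closure I1)) ?v = 2" unfolding dow_def gclos by simp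
    show "(set (map Inr (fst H)) \<union> set (map Inr (snd H))) \<inter> (set (map ?g (chord_closure I1)) - {?v}) = {}"
      unfolding gclos by auto
  qed
  \<comment> \<open>\<open>f\<close> merely renames chords, and \<open>wval\<close> is independent
    of the names.\<close>
  have inj: "inj_on ?g (set (join I1 H))"
    using f by (auto simp: join_def inj_on_def coloured_graph_iso_def bij_betw_def chords_def)
  then have "dow (map ?g (join I1 H))" using dow_map dow_join[OF assms(1) H] by blast
  then have "wval h (join I2 H) = wval h (map ?g (join I1 H))"
    using wval_meq[OF m[unfolded D E] _ h] by blast
  then show "wval h (join I1 H) = wval h (join I2 H)" using wval_map[OF inj] by simp
qed

end
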